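(* Let $m\geq 27$. Then the complex-valued random variable $W_1$ admits a density with respect to Lebesgue measure on $\mathbb C$, and its support is the whole complex plane. Moreover there exists $a>1$ such that $\mathbb E e^{i\langle t,W_1\rangle}=O(|t|^{-a})$ as $|t|\to+\infty$, $t\in\mathbb C$.
   Context: Let $m\geq 2$ be an integer and write $l_k(x_1,\dots,x_{m-1})=x_k$. For $1\le k\le m-2$ let $w_k\in\mathbb R^{m-1}$ have $-1$ in coordinate $k$, $+1$ in coordinate $k+1$ and $0$ elsewhere; let $w_{m-1}$ have $m$ in coordinate $1$, $-1$ in coordinate $m-1$ and $0$ elsewhere. Let $(X(t))_{t\ge0}$ be the right-continuous continuous-time Markov process with infinitesimal generator $Gf(v)=\sum_{k=1}^{m-1}k\,l_k(v)[f(v+w_k)-f(v)]$ (equivalently: a multitype branching process with $m-1$ colours, a particle of colour $k$ lives an exponential time of parameter $k$ and at death is replaced by one particle of colour $k+1$ if $k\le m-2$, or by $m$ particles of colour $1$ if $k=m-1$), started from $X(0)=e_1=(1,0,\dots,0)$. Let $\chi(\lambda)=\prod_{k=1}^{m-1}(\lambda+k)-m!$; its roots are simple, and $\lambda_2$ denotes the root with the second largest real part and positive imaginary part (for $m\ge27$, $\Re\lambda_2\in]1/2,1[$). Let $\binom{z}{n}=z(z-1)\cdots(z-n+1)/n!$ and $u_2(x_1,\dots,x_{m-1})=\sum_{k=1}^{m-1}\binom{\lambda_2+k-1}{k-1}x_k$. For $m\ge 27$, $W_1:=\lim_{t\to+\infty}e^{-\lambda_2 t}u_2(X(t))$ (the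 limit exists almost surely). For $x,y\in\mathbb C$, $\langle x,y\rangle=\Re(\overline{x}y)$. *)

theory Defs
  imports "HOL-Probability.Probability" "HOL-Library.Landau_Symbols"
begin

text \<open>States are vectors (x_1,...,x_{m-1}) in Z^{m-1}, encoded as functions nat => int
  where only coordinates 1..m-1 are used.\<close>

definition e1 :: "nat \<Rightarrow> int" where
  "e1 = (\<lambda>j. if j = 1 then 1 else 0)"

definition wvec :: "nat \<Rightarrow> nat \<Rightarrow> (nat \<Rightarrow> int)" where
  "wvec m k = (\<lambda>j. if k \<le> m - 2 then (if j = k then -1 else if j = k + 1 then 1 else 0)
                   else (if j = 1 then int m else if j = m - 1 then -1 else 0))"

definition rate :: "nat \<Rightarrow> (nat \<Rightarrow> int) \<Rightarrow> real" where
  "rate m v = (\<Sum>k=1..m-1. real k * real_of_int (v k))"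

text \<open>Choice of the jump type from a uniform variable u: k is chosen with probability
  k l_k(v) / q(v).\<close>
definition pick :: "nat \<Rightarrow> (nat \<Rightarrow> int) \<Rightarrow> real \<Rightarrow> nat" where
  "pick m v u = (LEAST k. 1 \<le> k \<and> u * rate m v < (\<Sum>j=1..k. real j * real_of_int (v j)))"

primrec Ychain :: "nat \<Rightarrow> (nat \<Rightarrow> real) \<Rightarrow> nat \<Rightarrow> (nat \<Rightarrow> int)" where
  "Ychain m U 0 = e1"
| "Ychain m U (Suc n) = (\<lambda>j. Ychain m U n j + wvec m (pick m (Ychain m U n) (U n)) j)"

text \<open>Jump times, holding times E_i / q(Y_i) with E_i standard exponential.\<close>
definition Tjump :: "nat \<Rightarrow> (nat \<Rightarrow> real) \<Rightarrow> (nat \<Rightarrow> real) \<Rightarrow> nat \<Rightarrow> real" where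
  "Tjump m E U n = (\<Sum>i<n. E i / rate m (Ychain m U i))"

definition Xproc :: "nat \<Rightarrow> (nat \<Rightarrow> real) \<Rightarrow> (nat \<Rightarrow> real) \<Rightarrow> real \<Rightarrow> (nat \<Rightarrow> int)" where
  "Xproc m E U t = Ychain m U (LEAST n. t < Tjump m E U (Suc n))"

definition chi :: "nat \<Rightarrow> complex \<Rightarrow> complex" where
  "chi m z = (\<Prod>k=1..m-1. z + of_nat k) - of_nat (fact m)"

definition is_lambda2 :: "nat \<Rightarrow> complex \<Rightarrow> bool" where
  "is_lambda2 m l \<longleftrightarrow> chi m l = 0 \<and> Im l > 0 \<and>
     (\<exists>r1. (\<exists>z. chi m z = 0 \<and> Re z = r1) \<and> (\<forall>z. chi m z = 0 \<longrightarrow> Re z \<le> r1) \<and>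
           Re l < r1 \<and> (\<forall>z. chi m z = 0 \<and> Re z < r1 \<longrightarrow> Re z \<le> Re l))"

definition u2 :: "nat \<Rightarrow> complex \<Rightarrow> (nat \<Rightarrow> int) \<Rightarrow> complex" where
  "u2 m l v = (\<Sum>k=1..m-1. ((l + of_nat k - 1) gchoose (k - 1)) * of_int (v k))"

text \<open>W_1 = lim_{t -> oo} e^{-l t} u_2(X(t)) (set to 0 on the null set where it fails to exist).\<close>
definition W1 :: "nat \<Rightarrow> complex \<Rightarrow> (nat \<Rightarrow> real) \<Rightarrow> (nat \<Rightarrow> real) \<Rightarrow> complex" where
  "W1 m l E U = (let f = (\<lambda>t::real. exp (- l * complex_of_real t) * u2 m l (Xproc m E U t))
                 in if (\<exists>L. (f \<longlongrightarrow> L) at_top) then Lim at_top f else 0)"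

end

theory Submission
  imports Defs
begin

text \<open>Let \<open>T\<^sub>n\<close> and \<open>Y\<^sub>n\<close> be the jump times and the states of the embedded chain. The total rate of
  \<open>Y\<^sub>n\<close> is \<open>n + 1\<close> whatever the jumps are, and \<open>exp (- \<lambda>\<^sub>2 T\<^sub>n) u\<^sub>2 (Y\<^sub>n)\<close> is a martingale, bounded in square mean
  because \<open>Re \<lambda>\<^sub>2 > 1/2\<close>; its limit is \<open>W\<^sub>1\<close>. Let \<open>\<phi>\<close> be the characteristic function of the limit. By the
  branching property, the state of \<open>m\<close> particles of colour 1 has characteristic function \<open>\<phi>^m\<close>, so that
  \<open>\<phi> z\<close> is the mean of \<open>\<phi>^m\<close> over a random point of the spiral \<open>exp (- cnj \<lambda>\<^sub>2 s) z\<close>, \<open>s \<ge> 0\<close>. The lifetime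
  of the last particle makes the phase oscillate, hence \<open>limsup |\<phi>| < 1\<close>; the equation improves this to
  \<open>\<phi> \<longrightarrow> 0\<close> and then to \<open>\<phi> = O(|z| powr - a)\<close> for every \<open>a < 1 / Re \<lambda>\<^sub>2\<close>. A few independent copies
  have an integrable characteristic function, which makes the law of their sum, and therefore that of \<open>W\<^sub>1\<close>,
  absolutely continuous. Finally, the support is closed, and it contains \<open>exp (- \<lambda>\<^sub>2 s) (x\<^sub>1 + \<dots> + x\<^sub>m)\<close> for its points
  \<open>x\<^sub>1, \<dots>, x\<^sub>m\<close> and \<open>s \<ge> 0\<close>: sums of points of a spiral fill the plane.\<close>

section \<open>The roots of the characteristic polynomial\<close>

text \<open>Quantities are indexed by an arbitrary starting population and treated by conditioning
  on the first jump, which takes the place of filtrations and conditional expectations. The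
  resulting constants follow one recursion, \<open>tail_var\<close>. That it tends to 0 is where
  \<open>Re l > 1/2\<close> acts: this gives convergence of the martingale, absence of explosion,
  and uniqueness for the first-step equation. Uniqueness is the crux of the branching property. In
  the embedded chain all particles share one clock and one sequence of uniforms, so subpopulations
  are not visibly independent; instead, the characteristic function of a union and the product of
  the separate ones are shown to solve the same equation. Since \<open>1 / Re l < 2\<close>, the
  decay obtained for one particle falls short of integrability over the plane, whence the detour
  through several particles. The way back to one particle is a mixture of rotated and contracted
  laws, which keeps null sets null. The law of a sum is known only through its characteristic
  function; Gaussian smoothing turns this knowledge into statements about discs.\<close>

lemma chi_one: "m \<ge> 1 \<Longrightarrow> chi m 1 = 0"
proof -
  assume "m \<ge> 1"
  have "(\<Prod>k=1..m-1. (1::complex) + of_nat k) = of_nat (\<Prod>k=1..m-1. Suc k)"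
    by simp
  also have "(\<Prod>k=1..m-1. Suc k) = fact m"
    using \<open>m \<ge> 1\<close>
  proof (induction m rule: nat_induct_at_least)
    case (Suc n)
    then have "{1..Suc n - 1} = insert n {1..n-1}" by auto
    with Suc show ?case by simp
  qed simp
  finally show ?thesis by (simp add: chi_def)
qed

lemma prod_Suc_eq_fact: "m \<ge> 1 \<Longrightarrow> (\<Prod>k=1..m-1. 1 + real k) = fact m"
proof -
  assume "m \<ge> 1"
  then have "of_real (\<Prod>k=1..m-1. 1 + real k) = (of_real (fact m) :: complex)"
    using chi_one[of m] by (simp add: chi_def)
  then show ?thesis by (simp only: of_real_eq_iff)
qed

text \<open>For \<open>Re z >= 1\<close> each factor satisfies \<open>|z + k| >= 1 + k\<close>,
  strictly unless \<open>z = 1\<close>, while at a root the product of these moduli equals the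
  product of the \<open>1 + k\<close>. So 1 is the only root of largest real part.\<close>

lemma chi_root_Re_le_1:
  assumes "m \<ge> 2" "chi m z = 0"
  shows "Re z \<le> 1" "Re z = 1 \<Longrightarrow> Im z = 0"
proof -
  have eq: "(\<Prod>k=1..m-1. cmod (z + of_nat k)) = fact m"
  proof -
    have "(\<Prod>k=1..m-1. cmod (z + of_nat k)) = cmod (\<Prod>k=1..m-1. z + of_nat k)"
      by (simp add: prod_norm)
    also have "\<dots> = cmod (of_nat (fact m))" using assms by (simp add: chi_def)
    finally show ?thesis by simp
  qed
  have le: "1 + real k \<le> cmod (z + of_nat k)" if "Re z \<ge> 1" for k
    using complex_Re_le_cmod[of "z + of_nat k"] that by simp
  have lt: False if "Re z \<ge> 1" and "\<And>k. k \<in> {1..m-1} \<Longrightarrow> 1 + real k < cmod (z + of_nat k)"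
  proof -
    have "(\<Prod>k=1..m-1. 1 + real k) < (\<Prod>k=1..m-1. cmod (z + of_nat k))"
    proof (rule prod_mono_strict[of 1])
      show "1 \<in> {1..m-1}" using assms(1) by auto
      then show "1 + real 1 < cmod (z + of_nat 1)" by (rule that(2))
      show "0 \<le> 1 + real i \<and> 1 + real i \<le> cmod (z + of_nat i)" if "i \<in> {1..m-1}" for i
        using le[OF \<open>Re z \<ge> 1\<close>] by auto
      show "0 < cmod (z + of_nat i)" if "i \<in> {1..m-1}" for i
        using le[OF \<open>Re z \<ge> 1\<close>, of i] by linarith
    qed auto
    then show False using prod_Suc_eq_fact[of m] eq assms by simp
  qed
  show "Re z \<le> 1"
  proof (rule ccontr)
    assume "\<not> Re z \<le> 1"
    moreover have "Re z + real k \<le> cmod (z + of_nat k)" for k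
      using complex_Re_le_cmod[of "z + of_nat k"] by simp
    ultimately have "1 + real k < cmod (z + of_nat k)" for k
      by (metis add_less_cancel_right less_le_trans not_le)
    then show False using \<open>\<not> Re z \<le> 1\<close> by (intro lt) auto
  qed
  show "Im z = 0" if "Re z = 1"
  proof (rule ccontr)
    assume im: "Im z \<noteq> 0"
    have "1 + real k < cmod (z + of_nat k)" for k
    proof -
      have "(1 + real k)\<^sup>2 < (cmod (z + of_nat k))\<^sup>2"
        using im that by (simp add: cmod_power2)
      then show ?thesis by (rule power_less_imp_less_base) simp
    qed
    with lt that show False by simp
  qed
qed

section \<open>A root with real part between 1/2 and 1\<close>

lemma Complex_polar:
  assumes "a > 0"
  shows "Complex a y = of_real (sqrt (a\<^sup>2 + y\<^sup>2)) * cis (arctan (y / a))"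
proof -
  have "a\<^sup>2 + y\<^sup>2 = a\<^sup>2 * (1 + (y/a)\<^sup>2)" using assms by (simp add: field_simps)
  then have s: "sqrt (a\<^sup>2 + y\<^sup>2) = a * sqrt (1 + (y/a)\<^sup>2)" using assms by (simp add: real_sqrt_mult)
  have nz: "sqrt (1 + (y/a)\<^sup>2) \<noteq> 0" by (simp add: add_nonneg_eq_0_iff)
  show ?thesis unfolding s
    using assms nz by (auto simp: complex_eq_iff cos_arctan sin_arctan)
qed

lemma prod_Complex_polar:
  assumes "\<And>k. k \<in> G \<Longrightarrow> a k > 0"
  shows "(\<Prod>k\<in>G. Complex (a k) y) =
    of_real (\<Prod>k\<in>G. sqrt ((a k)\<^sup>2 + y\<^sup>2)) * cis (\<Sum>k\<in>G. arctan (y / a k))"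
proof -
  have "(\<Prod>k\<in>G. Complex (a k) y) = (\<Prod>k\<in>G. of_real (sqrt ((a k)\<^sup>2 + y\<^sup>2)) * cis (arctan (y / a k)))"
    using assms Complex_polar by (intro prod.cong) auto
  also have "\<dots> = of_real (\<Prod>k\<in>G. sqrt ((a k)\<^sup>2 + y\<^sup>2)) * (\<Prod>k\<in>G. cis (arctan (y / a k)))"
    by (simp add: prod.distrib)
  also have "(\<Prod>k\<in>G. cis (arctan (y / a k))) = cis (\<Sum>k\<in>G. arctan (y / a k))"
    by (induction G rule: infinite_finite_induct) (auto simp: cis_mult)
  finally show ?thesis .
qed

text \<open>The sum is the continuous argument of the product and is nonnegative; were it at most a
  quarter turn, the real part could not be negative. In the application the sign of a rational
  number thus certifies an inequality between arctangents and \<open>pi\<close>.\<close>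

lemma sum_arctan_gt_half_pi:
  assumes "\<And>k. k \<in> G \<Longrightarrow> a k > 0" "y \<ge> 0" "Re (\<Prod>k\<in>G. Complex (a k) y) < 0"
  shows "(\<Sum>k\<in>G. arctan (y / a k)) > pi / 2"
proof (rule ccontr)
  assume "\<not> ?thesis"
  then have le: "(\<Sum>k\<in>G. arctan (y / a k)) \<le> pi / 2" by simp
  have "(\<Sum>k\<in>G. arctan (y / a k)) \<ge> 0"
    using assms by (intro sum_nonneg) (auto simp: zero_le_arctan_iff intro!: divide_nonneg_pos)
  then have "cos (\<Sum>k\<in>G. arctan (y / a k)) \<ge> 0" using le by (intro cos_ge_zero) auto
  moreover have "(\<Prod>k\<in>G. sqrt ((a k)\<^sup>2 + y\<^sup>2)) \<ge> 0" by (intro prod_nonneg) auto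
  ultimately have "Re (\<Prod>k\<in>G. Complex (a k) y) \<ge> 0"
    using assms(1) by (simp add: prod_Complex_polar del: of_real_prod)
  with assms(3) show False by simp
qed

text \<open>The point \<open>1/2 + 11/5 i\<close> certifies the threshold 27: the four index sets below partition
  \<open>{1..26}\<close>, and each of them contributes more than a quarter turn.\<close>

lemma sum_1_26_partition:
  fixes f :: "nat \<Rightarrow> real"
  shows "sum f {1..26} = sum f {1,11,15,19,23,26} + sum f {2,7,10,14,17,22} +
    sum f {3,6,9,13,18,21,24} + sum f {4,5,8,12,16,20,25}"
proof -
  have "{1..26} = set [1..<27::nat]" by (simp add: atLeastAtMost_upt)
  also have "[1..<27::nat] = [1,2,3,4,5,6,7,8,9,10,11,12,13,14,15,16,17,18,19,20,21,22,23,24,25,26]"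
    by (simp add: upt_conv_Cons)
  finally show ?thesis by (simp only: set_simps) simp
qed

lemma arg_certificate:
  assumes "m \<ge> 27"
  shows "(\<Sum>k=1..m-1. arctan ((11/5) / (1/2 + real k))) > 2 * pi"
proof -
  let ?t = "\<lambda>k::nat. arctan ((11/5) / (1/2 + real k))"
  let ?P = "\<lambda>G. Re (\<Prod>k\<in>G. Complex (1/2 + real k) (11/5)) < 0"
  let ?G1 = "{1,11,15,19,23,26::nat}" and ?G2 = "{2,7,10,14,17,22::nat}"
    and ?G3 = "{3,6,9,13,18,21,24::nat}" and ?G4 = "{4,5,8,12,16,20,25::nat}"
  have P: "?P ?G1" "?P ?G2" "?P ?G3" "?P ?G4" by (simp_all add: complex_mult)
  have half: "sum ?t G > pi/2" if "?P G" for G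
    using that by (intro sum_arctan_gt_half_pi) auto
  note P[THEN half]
  moreover have "sum ?t {1..26} = sum ?t ?G1 + sum ?t ?G2 + sum ?t ?G3 + sum ?t ?G4"
    by (rule sum_1_26_partition)
  ultimately have "sum ?t {1..26} > 2 * pi" by linarith
  also have "sum ?t {1..26} \<le> sum ?t {1..m-1}"
    using assms by (intro sum_mono2) (auto simp: zero_le_arctan_iff)
  finally show ?thesis .
qed

text \<open>Places \<open>1/2 + 11/5 i\<close> below the level curve used in
  \<open>chi_root_exists\<close>. Passing from m to m + 1 multiplies the two sides by
  \<open>(1/2 + m)^2 + (11/5)^2\<close> and \<open>(1 + m)^2\<close>, and the former is at most the
  latter; only the base case is a numerical computation.\<close>

lemma modulus_certificate:
  assumes "m \<ge> 27"
  shows "(\<Prod>k=1..m-1. (1/2 + real k)\<^sup>2 + (11/5)\<^sup>2) < (fact m)\<^sup>2"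
  using assms
proof (induction m rule: nat_induct_at_least)
  case base
  have "{1..27-1} = set [1..<27::nat]" by auto
  then have "(\<Prod>k=1..27-1. (1/2 + real k)\<^sup>2 + (11/5)\<^sup>2) = (\<Prod>k\<leftarrow>[1..<27::nat]. (1/2 + real k)\<^sup>2 + (11/5)\<^sup>2)"
    by (simp only: prod.distinct_set_conv_list[OF distinct_upt])
  also have "[1..<27::nat] = [1,2,3,4,5,6,7,8,9,10,11,12,13,14,15,16,17,18,19,20,21,22,23,24,25,26]"
    by (simp add: upt_conv_Cons)
  also have "(\<Prod>k\<leftarrow>\<dots>. (1/2 + real k)\<^sup>2 + (11/5)\<^sup>2) < (fact 27)\<^sup>2"
    by (simp add: fact_numeral power2_eq_square)
  finally show ?case .
next
  case (Suc m)
  have "{1..Suc m - 1} = insert m {1..m-1}" using Suc by auto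
  moreover have "m \<notin> {1..m-1}" using Suc by auto
  ultimately have "(\<Prod>k=1..Suc m-1. (1/2 + real k)\<^sup>2 + (11/5)\<^sup>2) =
      ((1/2 + real m)\<^sup>2 + (11/5)\<^sup>2) * (\<Prod>k=1..m-1. (1/2 + real k)\<^sup>2 + (11/5)\<^sup>2)" by simp
  also have "\<dots> \<le> (1 + real m)\<^sup>2 * (\<Prod>k=1..m-1. (1/2 + real k)\<^sup>2 + (11/5)\<^sup>2)"
    using Suc by (intro mult_right_mono prod_nonneg) (auto simp: power2_eq_square algebra_simps)
  also have "\<dots> < (1 + real m)\<^sup>2 * (fact m)\<^sup>2"
    using Suc by (intro mult_strict_left_mono) auto
  finally show ?case by (simp add: power_mult_distrib add.commute)
qed

text \<open>Follow the curve on which the product of the \<open>z + k\<close> has modulus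
  \<open>fact m\<close>. Its argument is 0 at \<open>z = 1\<close> and exceeds a full turn above
  real part 1/2, because there the curve passes above the certified point and the argument increases
  with the imaginary part. Where the argument is \<open>2 * pi\<close>, the product is
  \<open>fact m\<close> itself.\<close>

lemma chi_root_exists:
  assumes m: "m \<ge> 27"
  shows "\<exists>z. chi m z = 0 \<and> 1/2 < Re z \<and> Re z < 1"
proof -
  define F where "F x y = (\<Prod>k=1..m-1. (x + real k)\<^sup>2 + y\<^sup>2)" for x y :: real
  define T where "T x y = (\<Sum>k=1..m-1. arctan (y / (x + real k)))" for x y :: real
  have contF: "continuous_on S (\<lambda>p. F (f p) (g p))" if "continuous_on S f" "continuous_on S g"
    for S :: "'b::topological_space set" and f g
    unfolding F_def by (intro continuous_intros that)
  have F_mono: "F x y < F x y'" if "x \<ge> 0" "0 \<le> y" "y < y'" for x y y'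
    unfolding F_def using that m
    by (intro prod_mono_strict) (auto intro!: power_strict_mono add_nonneg_pos)
  have F_mono_x: "F x y < F x' y" if "0 \<le> x" "x < x'" for x x' y
    unfolding F_def using that m
    by (intro prod_mono_strict) (auto intro!: power_strict_mono add_pos_nonneg)
  have F1: "F 1 0 = (fact m)\<^sup>2"
    using prod_Suc_eq_fact[of m] m unfolding F_def by (simp add: prod_power_distrib[symmetric])
  have F_half: "F (1/2) (11/5) < (fact m)\<^sup>2"
    using modulus_certificate[OF m] by (simp add: F_def)
  \<comment> \<open>The factor \<open>k = 1\<close> alone exceeds \<open>(fact m)^2\<close> and the
    others are at least 1, so the ordinate of the curve can be sought in the compact interval
    \<open>{0..fact m}\<close>.\<close>
  have F_large: "F x (fact m) > (fact m)\<^sup>2" if "x \<ge> 0" for x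
  proof -
    have "F x (fact m) = ((x + 1)\<^sup>2 + (fact m)\<^sup>2) * (\<Prod>k\<in>{2..m-1}. (x + real k)\<^sup>2 + (fact m)\<^sup>2)"
    proof -
      have "{1..m-1} = insert 1 {2..m-1}" using m by auto
      then show ?thesis by (simp add: F_def)
    qed
    moreover have "(\<Prod>k\<in>{2..m-1}. (x + real k)\<^sup>2 + (fact m)\<^sup>2) \<ge> 1"
      by (intro prod_ge_1 add_increasing) (auto intro!: one_le_power fact_ge_1)
    moreover have "(x + 1)\<^sup>2 + (fact m)\<^sup>2 > (fact m)\<^sup>2" using that by auto
    ultimately show ?thesis
      by (smt (verit) mult_le_cancel_left1 zero_le_power2)
  qed
  have ex: "\<exists>y\<in>{0..fact m}. F x y = (fact m)\<^sup>2" if "x \<in> {1/2..1}" for x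
  proof -
    have "F x 0 \<le> (fact m)\<^sup>2"
      using F_mono_x[of x 1 0] F1 that by (cases "x = 1") auto
    moreover have "F x (fact m) \<ge> (fact m)\<^sup>2" using F_large[of x] that by simp
    ultimately have "\<exists>y\<ge>0. y \<le> fact m \<and> F x y = (fact m)\<^sup>2"
      by (intro IVT') (auto intro!: contF continuous_intros)
    then show ?thesis by auto
  qed
  define Y where "Y x = (SOME y. y \<in> {0..fact m} \<and> F x y = (fact m)\<^sup>2)" for x
  have Y: "Y x \<in> {0..fact m}" "F x (Y x) = (fact m)\<^sup>2" if "x \<in> {1/2..1}" for x
    using someI_ex[of "\<lambda>y. y \<in> {0..fact m} \<and> F x y = (fact m)\<^sup>2"] ex[OF that] unfolding Y_def by blast+
  have Y_unique: "y = Y x" if "x \<in> {1/2..1}" "y \<ge> 0" "F x y = (fact m)\<^sup>2" for x y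
    using Y[OF that(1)] F_mono[of x y "Y x"] F_mono[of x "Y x" y] that by (cases y "Y x" rule: linorder_cases) auto
  \<comment> \<open>The level set is closed and, \<open>F\<close> being strictly increasing in the
    ordinate, it is a graph with values in a compact set. The closed graph argument takes the place
    of the implicit function theorem.\<close>
  have "continuous_on {1/2..1} Y"
  proof (rule continuous_from_closed_graph[of "{0..fact m}"])
    show "compact {0..fact m :: real}" by simp
    show "Y \<in> {1/2..1} \<rightarrow> {0..fact m}" using Y by auto
    have "(\<lambda>x. (x, Y x)) ` {1/2..1} = {p \<in> {1/2..1} \<times> {0..fact m}. F (fst p) (snd p) = (fact m)\<^sup>2}"
      using Y Y_unique by (auto simp: image_iff)
    moreover have "closed \<dots>"
      by (intro continuous_closed_preimage_constant contF continuous_intros closed_Times)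
    ultimately show "closed ((\<lambda>x. (x, Y x)) ` {1/2..1})" by simp
  qed
  then have "continuous_on {1/2..1} (\<lambda>x. T x (Y x))"
    unfolding T_def by (intro continuous_intros) auto
  moreover have Y1: "Y 1 = 0" using Y_unique[of 1 0] F1 by simp
  then have "T 1 (Y 1) \<le> 2 * pi" by (simp add: T_def)
  moreover have T_half: "T (1/2) (Y (1/2)) > 2 * pi"
  proof -
    have "Y (1/2) > 11/5"
      using F_mono[of "1/2" "Y (1/2)" "11/5"] F_half Y[of "1/2"]
        by (cases "Y (1/2)" "11/5::real" rule: linorder_cases) auto
    then have "T (1/2) (11/5) \<le> T (1/2) (Y (1/2))"
      unfolding T_def by (intro sum_mono arctan_monotone' divide_right_mono) auto
    with arg_certificate[OF m] show ?thesis by (simp add: T_def)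
  qed
  ultimately obtain x where x: "1/2 \<le> x" "x \<le> 1" "T x (Y x) = 2 * pi"
    using IVT2'[of "\<lambda>x. T x (Y x)" 1 "2 * pi" "1/2"] by auto
  have "x \<noteq> 1/2" using T_half x(3) by (metis less_irrefl)
  moreover have "x \<noteq> 1" using x(3) Y1 by (auto simp: T_def)
  moreover have "chi m (Complex x (Y x)) = 0"
  proof -
    have "(\<Prod>k=1..m-1. Complex x (Y x) + of_nat k) = (\<Prod>k=1..m-1. Complex (x + real k) (Y x))"
      by (intro prod.cong) (auto simp: complex_eq_iff)
    also have "\<dots> = of_real (\<Prod>k=1..m-1. sqrt ((x + real k)\<^sup>2 + (Y x)\<^sup>2)) * cis (T x (Y x))"
      unfolding T_def using x by (intro prod_Complex_polar) auto
    also have "(\<Prod>k=1..m-1. sqrt ((x + real k)\<^sup>2 + (Y x)\<^sup>2)) = sqrt (F x (Y x))"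
      unfolding F_def
      by (intro real_sqrt_unique[symmetric])
        (auto simp: prod_power_distrib intro!: prod_nonneg)
    also have "sqrt (F x (Y x)) = fact m" using Y[of x] x by simp
    also have "cis (T x (Y x)) = 1" using x by simp
    finally show ?thesis by (simp add: chi_def)
  qed
  ultimately show ?thesis using x by (intro exI[of _ "Complex x (Y x)"]) auto
qed

text \<open>The root 1 forces \<open>r1 = 1\<close> in \<open>is_lambda2\<close>; the root just
  found then pushes the second largest real part above 1/2.\<close>

lemma is_lambda2_bounds:
  assumes "m \<ge> 27" "is_lambda2 m l"
  shows "chi m l = 0" "Im l > 0" "1/2 < Re l" "Re l < 1"
proof -
  obtain r1 where r1: "\<exists>z. chi m z = 0 \<and> Re z = r1" "\<And>z. chi m z = 0 \<Longrightarrow> Re z \<le> r1"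
    "Re l < r1" "\<And>z. chi m z = 0 \<Longrightarrow> Re z < r1 \<Longrightarrow> Re z \<le> Re l"
    using assms(2) unfolding is_lambda2_def by blast
  have "r1 = 1" using r1(1) r1(2)[of 1] chi_one[of m] chi_root_Re_le_1[of m] assms(1) by force
  then show "Re l < 1" using r1 by simp
  obtain z where "chi m z = 0" "1/2 < Re z" "Re z < 1" using chi_root_exists assms by blast
  with r1(4)[of z] \<open>r1 = 1\<close> show "1/2 < Re l" by simp
qed (use assms in \<open>auto simp: is_lambda2_def\<close>)

text \<open>The coefficients of \<open>u2\<close> form an eigenvector of the mean drift: a particle
  of colour k jumps at rate k and exchanges its coefficient for the next one, and this amounts to
  multiplication by \<open>l\<close>. It is the absorption identity of binomial
  coefficients.\<close>

lemma eigen_coeff: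
  fixes l :: complex
  shows "of_nat (Suc k) * (((l + of_nat (Suc (Suc k)) - 1) gchoose Suc k) - ((l + of_nat (Suc k) - 1) gchoose k))
         = l * ((l + of_nat (Suc k) - 1) gchoose k)"
proof -
  have "of_nat (Suc k) * ((l + of_nat (Suc k)) gchoose Suc k) = (l + of_nat (Suc k)) * ((l + of_nat k) gchoose k)"
    using gbinomial_absorption[of k "l + of_nat (Suc k)"] by (simp add: algebra_simps)
  then show ?thesis by (simp add: algebra_simps)
qed

section \<open>The embedded jump chain\<close>

definition expo :: "real measure" where "expo = density lborel (exponential_density 1)"
definition unif :: "real measure" where "unif = density lborel (indicator {0..1})"
definition step_space :: "(real \<times> real) measure" where "step_space = expo \<Otimes>\<^sub>M unif"
text \<open>One exponential and one uniform variable per jump. On this canonical space a path is a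
  first step followed by an independent path of the same law (\<open>distr_case_nat_path\<close>);
  the variables of the theorem are transported here at the end.\<close>

definition path_space :: "(nat \<Rightarrow> real \<times> real) measure" where "path_space = PiM UNIV (\<lambda>_. step_space)"

lemma sets_expo[measurable_cong, simp]: "sets expo = sets borel" by (simp add: expo_def)
lemma sets_unif[measurable_cong, simp]: "sets unif = sets borel" by (simp add: unif_def)
lemma space_expo[simp]: "space expo = UNIV" by (simp add: expo_def)
lemma space_unif[simp]: "space unif = UNIV" by (simp add: unif_def)
lemma sets_step_space[measurable_cong]: "sets step_space = sets (borel \<Otimes>\<^sub>M borel)"
  unfolding step_space_def by (intro sets_pair_measure_cong) simp_all
lemma sets_path_space[measurable_cong]: "sets path_space = sets (PiM UNIV (\<lambda>_. borel \<Otimes>\<^sub>M borel))"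
  unfolding path_space_def by (intro sets_PiM_cong sets_step_space refl)
lemma space_step_space[simp]: "space step_space = UNIV" by (simp add: step_space_def space_pair_measure)
lemma space_path_space[simp]: "space path_space = UNIV" by (simp add: path_space_def space_PiM)

interpretation expo: prob_space expo
  unfolding expo_def by (rule prob_space_exponential_density) simp
interpretation unif: prob_space unif
  by (rule prob_spaceI) (simp add: unif_def emeasure_density)
interpretation step_pair: pair_prob_space expo unif ..
interpretation step_space: prob_space step_space
  unfolding step_space_def by (rule step_pair.prob_space_axioms)
interpretation path: sequence_space step_space ..
interpretation path_space: prob_space path_space
  unfolding path_space_def by (rule path.prob_space_axioms)
interpretation path_pair: pair_prob_space step_space path_space ..

lemma AE_expo_pos: "AE e in expo. e > 0"
  unfolding expo_def
  by (subst AE_density) (auto simp: exponential_density_def intro!: AE_I'[of "{0}"])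

lemma AE_unif: "AE u in unif. 0 \<le> u \<and> u < 1"
  unfolding unif_def
  by (subst AE_density) (auto simp: indicator_def intro!: AE_I'[of "{1}"])

lemma measurable_case_nat_path[measurable]:
  "(\<lambda>(x, \<omega>). case_nat x \<omega>) \<in> measurable (step_space \<Otimes>\<^sub>M path_space) path_space"
  unfolding path_space_def by measurable

lemma distr_case_nat_path:
  "distr (step_space \<Otimes>\<^sub>M path_space) path_space (\<lambda>(x, \<omega>). case_nat x \<omega>) = path_space"
  unfolding path_space_def by (rule path.PiM_iter)

lemma measurable_case_nat_path2[measurable (raw)]:
  assumes "f \<in> measurable path_space N"
  shows "(\<lambda>p. f (case_nat (fst p) (snd p))) \<in> measurable (step_space \<Otimes>\<^sub>M path_space) N"
  using measurable_compose[OF measurable_case_nat_path assms] by (simp add: split_beta')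

text \<open>The Markov property at the first jump: with the first step fixed, the rest of the path
  is integrated as a fresh path. Estimates by induction on the number of jumps peel off the first
  jump with this rule or with \<open>integral_path\<close>.\<close>

lemma nn_integral_path:
  assumes [measurable]: "f \<in> borel_measurable path_space"
  shows "(\<integral>\<^sup>+\<omega>. f \<omega> \<partial>path_space) = (\<integral>\<^sup>+x. \<integral>\<^sup>+\<omega>. f (case_nat x \<omega>) \<partial>path_space \<partial>step_space)"
proof -
  have "(\<integral>\<^sup>+\<omega>. f \<omega> \<partial>path_space) = (\<integral>\<^sup>+p. f (case_nat (fst p) (snd p)) \<partial>(step_space \<Otimes>\<^sub>M path_space))"
    by (subst distr_case_nat_path[symmetric]) (simp add: nn_integral_distr split_beta')
  also have "\<dots> = (\<integral>\<^sup>+x. \<integral>\<^sup>+\<omega>. f (case_nat x \<omega>) \<partial>path_space \<partial>step_space)"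
    by (subst path_space.nn_integral_fst[symmetric]) simp_all
  finally show ?thesis .
qed

lemma integral_path:
  fixes f :: "_ \<Rightarrow> 'b::{banach, second_countable_topology}"
  assumes "integrable path_space f"
  shows "(\<integral>\<omega>. f \<omega> \<partial>path_space) = (\<integral>x. \<integral>\<omega>. f (case_nat x \<omega>) \<partial>path_space \<partial>step_space)"
proof -
  have [measurable]: "f \<in> borel_measurable path_space" using assms by auto
  have "integrable (step_space \<Otimes>\<^sub>M path_space) (\<lambda>p. f (case_nat (fst p) (snd p)))"
    using assms by (subst (asm) distr_case_nat_path[symmetric]) (simp add: integrable_distr_eq split_beta')
  then have "(\<integral>p. f (case_nat (fst p) (snd p)) \<partial>(step_space \<Otimes>\<^sub>M path_space))
      = (\<integral>x. \<integral>\<omega>. f (case_nat x \<omega>) \<partial>path_space \<partial>step_space)"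
    by (subst path_pair.integral_fst'[symmetric]) simp_all
  moreover have "(\<integral>\<omega>. f \<omega> \<partial>path_space) = (\<integral>p. f (case_nat (fst p) (snd p)) \<partial>(step_space \<Otimes>\<^sub>M path_space))"
    by (subst distr_case_nat_path[symmetric]) (simp add: integral_distr split_beta')
  ultimately show ?thesis by simp
qed

section \<open>Populations and the law of one jump\<close>

definition vadd :: "(nat \<Rightarrow> int) \<Rightarrow> (nat \<Rightarrow> int) \<Rightarrow> nat \<Rightarrow> int" where
  "vadd v w = (\<lambda>j. v j + w j)"

text \<open>Positivity of the rate excludes the empty population, from which no jump can be
  drawn.\<close>

definition valid :: "nat \<Rightarrow> (nat \<Rightarrow> int) \<Rightarrow> bool" where
  "valid m v \<longleftrightarrow> (\<forall>j. 0 \<le> v j) \<and> (\<forall>j. j \<notin> {1..m-1} \<longrightarrow> v j = 0) \<and> rate m v > 0"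

definition stepv :: "nat \<Rightarrow> (nat \<Rightarrow> int) \<Rightarrow> real \<times> real \<Rightarrow> nat \<Rightarrow> int" where
  "stepv m v x = vadd v (wvec m (pick m v (snd x)))"

lemma rate_vadd: "rate m (vadd v w) = rate m v + rate m w"
  by (simp add: rate_def vadd_def algebra_simps sum.distrib)

lemma u2_vadd: "u2 m l (vadd v w) = u2 m l v + u2 m l w"
  by (simp add: u2_def vadd_def algebra_simps sum.distrib)

lemma rate_ge_1: "valid m v \<Longrightarrow> rate m v \<ge> 1"
proof -
  assume v: "valid m v"
  define n where "n = (\<Sum>k=1..m-1. int k * v k)"
  have n: "rate m v = of_int n" by (simp add: rate_def n_def)
  moreover have "rate m v > 0" using v by (simp add: valid_def)
  ultimately have "n \<ge> 1" by simp
  then show ?thesis unfolding n by simp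
qed

text \<open>Stated for arbitrary coefficients because the rate, with \<open>c j = j\<close>, and
  \<open>u2\<close>, with the binomial coefficients, are both linear forms in the state.\<close>

lemma sum_if_wvec1:
  assumes "m \<ge> 3" "k \<ge> 1" "k \<le> m - 2"
  shows "(\<Sum>j=1..m-1. c j * of_int (wvec m k j)) = c (k + 1) - (c k :: 'a::comm_ring_1)"
proof -
  have "(\<Sum>j=1..m-1. c j * of_int (wvec m k j)) =
    (\<Sum>j=1..m-1. (if j = k + 1 then c j else 0) - (if j = k then c j else 0))"
    using assms by (intro sum.cong) (auto simp: wvec_def)
  also have "\<dots> = (\<Sum>j=1..m-1. if j = k + 1 then c j else 0) - (\<Sum>j=1..m-1. if j = k then c j else 0)"
    by (rule sum_subtractf)
  also have "\<dots> = c (k + 1) - c k"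
  proof -
    have "k + 1 \<in> {1..m-1}" "k \<in> {1..m-1}" using assms by auto
    then show ?thesis by (simp only: sum.delta finite_atLeastAtMost if_True)
  qed
  finally show ?thesis .
qed

lemma sum_if_wvec2:
  assumes "m \<ge> 3" "k > m - 2"
  shows "(\<Sum>j=1..m-1. c j * of_int (wvec m k j)) = of_nat m * c 1 - (c (m - 1) :: 'a::comm_ring_1)"
proof -
  have "(\<Sum>j=1..m-1. c j * of_int (wvec m k j)) =
    (\<Sum>j=1..m-1. (if j = 1 then of_nat m * c j else 0) - (if j = m - 1 then c j else 0))"
    using assms by (intro sum.cong) (auto simp: wvec_def)
  also have "\<dots> = (\<Sum>j=1..m-1. if j = 1 then of_nat m * c j else 0) - (\<Sum>j=1..m-1. if j = m - 1 then c j else 0)"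
    by (rule sum_subtractf)
  also have "\<dots> = of_nat m * c 1 - c (m - 1)"
  proof -
    have "1 \<in> {1..m-1}" "m - 1 \<in> {1..m-1}" using assms by auto
    then show ?thesis by (simp only: sum.delta finite_atLeastAtMost if_True)
  qed
  finally show ?thesis .
qed

text \<open>A change of colour trades rate k for k + 1; the splitting trades one particle of rate
  \<open>m - 1\<close> for m particles of rate 1.\<close>

lemma rate_wvec: "m \<ge> 3 \<Longrightarrow> k \<ge> 1 \<Longrightarrow> rate m (wvec m k) = 1"
  using sum_if_wvec1[of m k real] sum_if_wvec2[of m k real] unfolding rate_def
  by (cases "k \<le> m - 2") (auto simp: of_nat_diff)

lemma valid_vadd_wvec:
  assumes "m \<ge> 3" "valid m v" "k \<in> {1..m-1}" "v k > 0"
  shows "valid m (vadd v (wvec m k))"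
proof -
  have "vadd v (wvec m k) j \<ge> 0" for j
  proof (cases "j = k")
    case True
    then show ?thesis using assms by (auto simp: vadd_def wvec_def valid_def)
  next
    case False
    then have "wvec m k j \<ge> 0" using assms by (auto simp: wvec_def)
    then show ?thesis using assms by (auto simp: vadd_def valid_def)
  qed
  moreover have "vadd v (wvec m k) j = 0" if "j \<notin> {1..m-1}" for j
    using that assms by (auto simp: vadd_def wvec_def valid_def)
  ultimately show ?thesis using assms unfolding valid_def
    by (simp add: rate_vadd rate_wvec)
qed

definition cum :: "(nat \<Rightarrow> int) \<Rightarrow> nat \<Rightarrow> real" where
  "cum v k = (\<Sum>j=1..k. real j * real_of_int (v j))"

lemma cum_0[simp]: "cum v 0 = 0" by (simp add: cum_def)
lemma cum_Suc: "cum v (Suc k) = cum v k + real (Suc k) * real_of_int (v (Suc k))" by (simp add: cum_def)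
lemma cum_top: "cum v (m - Suc 0) = rate m v" by (simp add: cum_def rate_def)

lemma cum_mono: "valid m v \<Longrightarrow> j \<le> k \<Longrightarrow> cum v j \<le> cum v k"
  unfolding cum_def by (intro sum_mono2) (auto simp: valid_def)

text \<open>The conjunct \<open>u < 1\<close> guards the left-hand side: for \<open>u >= 1\<close>
  no index qualifies, and \<open>LEAST\<close> is then an unspecified number that might happen to be
  k.\<close>

lemma pick_eq_iff:
  assumes "valid m v" "0 \<le> u" "k \<in> {1..m-1}"
  shows "pick m v u = k \<and> u < 1 \<longleftrightarrow> u \<in> {cum v (k - 1) / rate m v ..< cum v k / rate m v}"
proof -
  have q: "rate m v > 0" using assms by (simp add: valid_def)
  let ?P = "\<lambda>k. 1 \<le> k \<and> u * rate m v < cum v k"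
  have pick: "pick m v u = Least ?P" by (simp add: pick_def cum_def)
  show ?thesis
  proof
    assume *: "pick m v u = k \<and> u < 1"
    have "u * rate m v < cum v (m - 1)" using * q by (simp add: cum_top)
    then have "?P (m - 1)" using assms by auto
    then have "?P k" using LeastI[of ?P "m - 1"] * pick by simp
    moreover have "\<not> ?P (k - 1)" using not_less_Least[of "k - 1" ?P] * pick assms by auto
    then have "cum v (k - 1) \<le> u * rate m v" using assms q by (cases "k = 1") auto
    ultimately show "u \<in> {cum v (k - 1) / rate m v ..< cum v k / rate m v}" using q by (simp add: field_simps)
  next
    assume "u \<in> {cum v (k - 1) / rate m v ..< cum v k / rate m v}"
    then have *: "cum v (k - 1) \<le> u * rate m v" "u * rate m v < cum v k" using q by (auto simp: field_simps)
    have "Least ?P = k"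
    proof (rule Least_equality)
      fix y assume y: "?P y"
      show "k \<le> y"
      proof (rule ccontr)
        assume "\<not> k \<le> y"
        then have "cum v y \<le> cum v (k - 1)" using assms by (intro cum_mono) auto
        with y * show False by simp
      qed
    qed (use * assms in auto)
    moreover have "cum v k \<le> rate m v" using cum_mono[of m v k "m-1"] assms cum_top by auto
    then have "u * rate m v < 1 * rate m v" using * by simp
    then have "u < 1" using q by (simp only: mult_less_cancel_right_pos)
    ultimately show "pick m v u = k \<and> u < 1" using pick by simp
  qed
qed

lemma pick_in:
  assumes "valid m v" "0 \<le> u" "u < 1"
  shows "pick m v u \<in> {1..m-1}" "v (pick m v u) > 0"
proof -
  have q: "rate m v > 0" using assms by (simp add: valid_def)
  let ?P = "\<lambda>k. 1 \<le> k \<and> u * rate m v < cum v k"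
  have pick: "pick m v u = Least ?P" by (simp add: pick_def cum_def)
  have "m - 1 \<noteq> 0" using q by (intro notI) (simp add: rate_def)
  then have "?P (m - 1)" using assms q by (simp add: cum_top)
  then have "?P (Least ?P)" "Least ?P \<le> m - 1" using LeastI[of ?P "m - 1"] Least_le[of ?P "m-1"] by auto
  then show *: "pick m v u \<in> {1..m-1}" unfolding pick by auto
  have "u \<in> {cum v (pick m v u - 1) / rate m v ..< cum v (pick m v u) / rate m v}"
    using pick_eq_iff[OF assms(1,2) *] assms(3) by blast
  then have "cum v (pick m v u - 1) / rate m v < cum v (pick m v u) / rate m v" by auto
  then have "cum v (pick m v u - 1) < cum v (pick m v u)" using q by (simp add: divide_less_cancel)
  moreover obtain k where "pick m v u = Suc k" using * by (cases "pick m v u") auto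
  ultimately show "v (pick m v u) > 0" by (simp add: cum_Suc zero_less_mult_iff)
qed

lemma pick_measurable[measurable]: "pick m v \<in> measurable borel (count_space UNIV)"
  unfolding pick_def by measurable

lemma measure_pick:
  assumes "valid m v" "k \<in> {1..m-1}"
  shows "emeasure unif {u. pick m v u = k} = ennreal (real k * real_of_int (v k) / rate m v)"
proof -
  have q: "rate m v > 0" using assms by (simp add: valid_def)
  let ?a = "cum v (k - 1) / rate m v" and ?b = "cum v k / rate m v"
  have ab: "0 \<le> ?a" "?a \<le> ?b" "?b \<le> 1"
    using q cum_mono[OF assms(1), of 0 "k-1"] cum_mono[OF assms(1), of "k-1" k]
      cum_mono[OF assms(1), of k "m-1"] assms by (auto simp: cum_top divide_right_mono)
  have "emeasure unif {u. pick m v u = k} = emeasure unif {?a..<?b}"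
  proof (rule emeasure_eq_AE)
    show "AE u in unif. u \<in> {u. pick m v u = k} \<longleftrightarrow> u \<in> {?a..<?b}"
      using AE_unif
    proof eventually_elim
      case (elim u)
      then show ?case using pick_eq_iff[OF assms(1) _ assms(2), of u] by auto
    qed
  qed auto
  also have "\<dots> = (\<integral>\<^sup>+u. indicator {?a..<?b} u \<partial>lborel)"
    unfolding unif_def using ab
    by (subst emeasure_density) (auto intro!: nn_integral_cong simp del: nn_integral_indicator split: split_indicator)
  also have "\<dots> = ennreal (?b - ?a)" using ab by simp
  also have "?b - ?a = real k * real_of_int (v k) / rate m v"
  proof -
    obtain j where "k = Suc j" using assms(2) by (cases k) auto
    then show ?thesis by (simp add: cum_Suc diff_divide_distrib[symmetric])
  qed
  finally show ?thesis .
qed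

definition jump_prob :: "nat \<Rightarrow> (nat \<Rightarrow> int) \<Rightarrow> nat \<Rightarrow> real" where
  "jump_prob m v k = real k * real_of_int (v k) / rate m v"

lemma jump_prob_nonneg: "valid m v \<Longrightarrow> jump_prob m v k \<ge> 0"
  by (auto simp: jump_prob_def valid_def intro!: divide_nonneg_pos)

lemma sum_jump_prob: "valid m v \<Longrightarrow> (\<Sum>k=1..m-1. jump_prob m v k) = 1"
  unfolding jump_prob_def sum_divide_distrib[symmetric] rate_def[symmetric] by (simp add: valid_def)

lemma AE_pick_sum:
  fixes G :: "nat \<Rightarrow> 'b::comm_monoid_add"
  assumes "valid m v"
  shows "AE u in unif. G (pick m v u) = (\<Sum>k=1..m-1. if pick m v u = k then G k else 0)"
  using AE_unif
proof eventually_elim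
  case (elim u)
  then show ?case using pick_in[OF assms, of u] by simp
qed

lemma nn_integral_pick:
  assumes "valid m v"
  shows "(\<integral>\<^sup>+u. G (pick m v u) \<partial>unif) = (\<Sum>k=1..m-1. ennreal (jump_prob m v k) * G k)"
proof -
  have "(\<integral>\<^sup>+u. G (pick m v u) \<partial>unif) = (\<integral>\<^sup>+u. (\<Sum>k=1..m-1. G k * indicator {u. pick m v u = k} u) \<partial>unif)"
    using AE_pick_sum[OF assms, of G] by (intro nn_integral_cong_AE) (auto simp: indicator_def if_distrib cong: if_cong)
  also have "\<dots> = (\<Sum>k=1..m-1. \<integral>\<^sup>+u. G k * indicator {u. pick m v u = k} u \<partial>unif)"
    by (rule nn_integral_sum) measurable
  also have "\<dots> = (\<Sum>k=1..m-1. ennreal (jump_prob m v k) * G k)"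
    by (intro sum.cong refl, subst nn_integral_cmult_indicator)
       (auto simp: measure_pick[OF assms] jump_prob_def mult.commute)
  finally show ?thesis .
qed

lemma has_bochner_integral_pick:
  fixes G :: "nat \<Rightarrow> 'b::{banach, second_countable_topology}"
  assumes "valid m v"
  shows "has_bochner_integral unif (\<lambda>u. G (pick m v u)) (\<Sum>k=1..m-1. jump_prob m v k *\<^sub>R G k)"
proof -
  have "has_bochner_integral unif (\<lambda>u. \<Sum>k=1..m-1. indicat_real {u. pick m v u = k} u *\<^sub>R G k)
     (\<Sum>k=1..m-1. measure unif {u. pick m v u = k} *\<^sub>R G k)"
  proof (intro has_bochner_integral_sum has_bochner_integral_scaleR_left has_bochner_integral_real_indicator)
    fix k show "{u. pick m v u = k} \<in> sets unif" by measurable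
  qed (simp add: unif.emeasure_finite less_top[symmetric])
  moreover have "(\<Sum>k=1..m-1. measure unif {u. pick m v u = k} *\<^sub>R G k) = (\<Sum>k=1..m-1. jump_prob m v k *\<^sub>R G k)"
    using jump_prob_nonneg[OF assms] by (intro sum.cong refl) (simp add: measure_def measure_pick[OF assms] jump_prob_def)
  moreover have "AE u in unif. G (pick m v u) = (\<Sum>k=1..m-1. indicat_real {u. pick m v u = k} u *\<^sub>R G k)"
    using AE_pick_sum[OF assms, of G]
  proof eventually_elim
    case (elim u)
    show ?case unfolding elim by (intro sum.cong) auto
  qed
  ultimately show ?thesis
    by (subst has_bochner_integral_cong_AE[where g="\<lambda>u. \<Sum>k=1..m-1. indicat_real {u. pick m v u = k} u *\<^sub>R G k"])
      (auto intro!: measurable_compose[OF pick_measurable])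
qed

lemma AE_step_valid:
  assumes "m \<ge> 3" "valid m v"
  shows "AE x in step_space. fst x > 0 \<and> valid m (stepv m v x) \<and> rate m (stepv m v x) = rate m v + 1"
proof -
  have "AE x in step_space. fst x > 0"
    unfolding step_space_def
  proof (rule step_pair.AE_pair_measure)
    show "{x \<in> space (expo \<Otimes>\<^sub>M unif). 0 < fst x} \<in> sets (expo \<Otimes>\<^sub>M unif)" by measurable
  qed (use AE_expo_pos in simp)
  moreover have "AE x in step_space. 0 \<le> snd x \<and> snd x < 1"
    unfolding step_space_def
  proof (rule step_pair.AE_pair_measure)
    show "{x \<in> space (expo \<Otimes>\<^sub>M unif). 0 \<le> snd x \<and> snd x < 1} \<in> sets (expo \<Otimes>\<^sub>M unif)" by measurable
  qed (use AE_unif in simp)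
  ultimately show ?thesis
  proof eventually_elim
    case (elim x)
    then show ?case using pick_in[OF assms(2), of "snd x"] valid_vadd_wvec[OF assms] rate_wvec[OF assms(1)]
      by (auto simp: stepv_def rate_vadd)
  qed
qed

section \<open>Second moments, and integrals against the exponential law\<close>

lemma (in prob_space) norm_integral_sq_le:
  fixes f :: "'a \<Rightarrow> complex"
  assumes [measurable]: "f \<in> borel_measurable M"
    and B: "(\<integral>\<^sup>+x. ennreal ((cmod (f x))\<^sup>2) \<partial>M) \<le> ennreal B" "B \<ge> 0"
  shows "integrable M f" "(\<integral>x. cmod (f x) \<partial>M)\<^sup>2 \<le> B" "(cmod (\<integral>x. f x \<partial>M))\<^sup>2 \<le> B"
proof -
  have CS: "(\<integral>\<^sup>+x. ennreal (cmod (f x)) \<partial>M)\<^sup>2 \<le> ennreal B"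
  proof -
    have "(\<integral>\<^sup>+x. ennreal (cmod (f x)) \<partial>M)\<^sup>2 \<le> (\<integral>\<^sup>+x. (ennreal (cmod (f x)))\<^sup>2 \<partial>M) * (\<integral>\<^sup>+x. 1\<^sup>2 \<partial>M)"
      using Cauchy_Schwarz_nn_integral[of "\<lambda>x. ennreal (cmod (f x))" M "\<lambda>_. 1"] by simp
    then show ?thesis using B by (simp add: ennreal_power emeasure_space_1)
  qed
  have fin: "(\<integral>\<^sup>+x. ennreal (cmod (f x)) \<partial>M) < \<infinity>"
    using CS by (auto simp: less_top[symmetric] top_unique ennreal_top_eq_mult_iff power2_eq_square ennreal_mult_top)
  show I: "integrable M f" by (rule integrableI_bounded) (use fin in auto)
  then have "ennreal ((\<integral>x. cmod (f x) \<partial>M)\<^sup>2) \<le> ennreal B"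
    using CS by (subst (asm) nn_integral_eq_integral) (auto simp: ennreal_power)
  then show 1: "(\<integral>x. cmod (f x) \<partial>M)\<^sup>2 \<le> B" using B by simp
  have "(cmod (\<integral>x. f x \<partial>M))\<^sup>2 \<le> (\<integral>x. cmod (f x) \<partial>M)\<^sup>2"
    by (intro power_mono integral_norm_bound) auto
  with 1 show "(cmod (\<integral>x. f x \<partial>M))\<^sup>2 \<le> B" by linarith
qed

text \<open>Tilting the exponential density by \<open>exp (- a * e)\<close> gives
  \<open>1 / (1 + a)\<close> times the density of rate \<open>1 + a\<close>. Discount factors have
  \<open>a > 0\<close>; \<open>decay_step\<close> uses a negative \<open>a\<close>.\<close>

lemma nn_integral_expo_exp:
  assumes "a > -1"
  shows "(\<integral>\<^sup>+e. ennreal (exp (- a * e)) \<partial>expo) = ennreal (1 / (1 + a))"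
proof -
  interpret E: prob_space "density lborel (exponential_density (1 + a))"
    using assms by (intro prob_space_exponential_density) simp
  have "(\<integral>\<^sup>+e. ennreal (exp (- a * e)) \<partial>expo) =
     (\<integral>\<^sup>+e. ennreal (exponential_density 1 e) * ennreal (exp (- a * e)) \<partial>lborel)"
    unfolding expo_def by (subst nn_integral_density) (auto simp: exponential_density_nonneg)
  also have "\<dots> = (\<integral>\<^sup>+e. ennreal (1 / (1 + a)) * ennreal (exponential_density (1 + a) e) \<partial>lborel)"
  proof (intro nn_integral_cong)
    fix e :: real
    have "exponential_density 1 e * exp (- a * e) = 1 / (1 + a) * exponential_density (1 + a) e"
      using assms by (simp add: exponential_density_def exp_add[symmetric] algebra_simps add_divide_distrib[symmetric])
        (simp add: field_simps)
    then show "ennreal (exponential_density 1 e) * ennreal (exp (- a * e)) =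
       ennreal (1 / (1 + a)) * ennreal (exponential_density (1 + a) e)"
      using assms by (simp add: ennreal_mult[symmetric] exponential_density_nonneg del: times_divide_eq_left)
  qed
  also have "\<dots> = ennreal (1 / (1 + a)) * emeasure (density lborel (exponential_density (1 + a))) (space lborel)"
    by (subst nn_integral_cmult) (auto simp: emeasure_density)
  finally show ?thesis using E.emeasure_space_1 by simp
qed

lemma integrable_expo_bounded:
  fixes h :: "real \<Rightarrow> complex"
  assumes "h \<in> borel_measurable borel" "\<And>x. x > 0 \<Longrightarrow> cmod (h x) \<le> B"
  shows "integrable expo h"
proof (rule expo.integrable_const_bound[where B=B])
  show "AE x in expo. cmod (h x) \<le> B" using AE_expo_pos assms(2) by auto
qed (use assms in simp)

text \<open>Think of \<open>F s\<close> as the integral of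
  \<open>q * exp (- q * r) *\<^sub>R h r\<close> over \<open>r > s\<close>: its limit at 0 is the
  mean of \<open>h\<close> at an exponential time of rate q. Identities about such means can then be
  proved by exhibiting \<open>F\<close>.\<close>

lemma integral_expo_FTC:
  fixes h F :: "real \<Rightarrow> complex"
  assumes q: "q > 0"
    and F: "\<And>s. s > 0 \<Longrightarrow> (F has_vector_derivative - ((q * exp (- q * s)) *\<^sub>R h s)) (at s)"
    and h: "\<And>s. s > 0 \<Longrightarrow> isCont h s" and meas: "h \<in> borel_measurable borel"
    and B: "\<And>s. s > 0 \<Longrightarrow> cmod (h s) \<le> B"
    and A: "(F \<longlongrightarrow> A) (at_right 0)" and Z: "(F \<longlongrightarrow> 0) at_top"
  shows "(\<integral>e. h (e / q) \<partial>expo) = A"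
proof -
  define f where "f s = - ((q * exp (- q * s)) *\<^sub>R h s)" for s
  have [measurable]: "h \<in> borel_measurable borel" by (rule meas)
  have "integrable expo (\<lambda>e. h (e / q))"
    using q B by (intro integrable_expo_bounded[where B=B]) auto
  then have int: "integrable lborel (\<lambda>e. exponential_density 1 e *\<^sub>R h (e / q))"
    unfolding expo_def by (subst (asm) integrable_density) (auto simp: exponential_density_nonneg)
  have "(\<integral>e. h (e / q) \<partial>expo) = (\<integral>e. exponential_density 1 e *\<^sub>R h (e / q) \<partial>lborel)"
    unfolding expo_def by (subst integral_density) (auto simp: exponential_density_nonneg)
  also have "\<dots> = q *\<^sub>R (\<integral>s. exponential_density 1 (q * s) *\<^sub>R h s \<partial>lborel)"
    using q by (subst lborel_integral_real_affine[where c=q and t=0]) auto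
  also have "\<dots> = (\<integral>s. q *\<^sub>R (exponential_density 1 (q * s) *\<^sub>R h s) \<partial>lborel)"
    by (rule integral_scaleR_right[symmetric])
  also have "\<dots> = (\<integral>s. indicator {0<..} s *\<^sub>R - f s \<partial>lborel)"
  proof (rule integral_cong_AE)
    show "AE s in lborel. q *\<^sub>R exponential_density 1 (q * s) *\<^sub>R h s = indicator {0<..} s *\<^sub>R - f s"
      using AE_lborel_singleton[of 0]
      by eventually_elim (use q in \<open>auto simp: exponential_density_def f_def indicator_def mult_less_0_iff\<close>)
  qed (auto simp: f_def)
  finally have eq: "(\<integral>e. h (e / q) \<partial>expo) = (\<integral>s. indicator {0<..} s *\<^sub>R - f s \<partial>lborel)" .
  have "integrable lborel (\<lambda>s. exponential_density 1 (q * s) *\<^sub>R h s)"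
    using lborel_integrable_real_affine[OF int, of q 0] q by simp
  then have "integrable lborel (\<lambda>s. q *\<^sub>R (exponential_density 1 (q * s) *\<^sub>R h s))"
    by (rule integrable_scaleR_right)
  then have "integrable lborel (\<lambda>s. indicator {0<..} s *\<^sub>R - f s)"
  proof (rule integrable_cong_AE_imp)
    show "AE s in lborel. q *\<^sub>R exponential_density 1 (q * s) *\<^sub>R h s = indicator {0<..} s *\<^sub>R - f s"
      using AE_lborel_singleton[of 0]
      by eventually_elim (use q in \<open>auto simp: exponential_density_def f_def indicator_def mult_less_0_iff\<close>)
  qed (auto simp: f_def)
  from integrable_minus[OF this] have intf: "set_integrable lborel {0<..} f"
    unfolding set_integrable_def by simp
  have "(LBINT s=0..\<infinity>. f s) = 0 - A"
  proof (rule interval_integral_FTC_integrable[where F=F])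
    show "((F \<circ> real_of_ereal) \<longlongrightarrow> A) (at_right 0)"
      using A by (simp add: ereal_tendsto_simps zero_ereal_def)
    show "((F \<circ> real_of_ereal) \<longlongrightarrow> 0) (at_left \<infinity>)" using Z by (simp add: ereal_tendsto_simps)
    show "set_integrable lborel (einterval 0 \<infinity>) f" using intf by (simp add: zero_ereal_def)
  qed (use F h in \<open>auto simp: f_def intro!: continuous_intros\<close>)
  also have "(LBINT s=0..\<infinity>. f s) = (LINT s:{0<..}|lborel. f s)"
    unfolding interval_lebesgue_integral_def by (simp add: zero_ereal_def)
  finally show ?thesis unfolding eq set_lebesgue_integral_def by simp
qed

lemma integral_expo_cexp:
  assumes q: "q > 0" and c: "Re c \<ge> 0"
  shows "(\<integral>e. exp (- (c * of_real (e / q))) \<partial>expo) = of_real q / (of_real q + c)"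
proof -
  define w where "w = of_real q + c"
  have nz: "w \<noteq> 0" using q c by (auto simp: complex_eq_iff w_def)
  show ?thesis unfolding w_def[symmetric]
  proof (rule integral_expo_FTC[where F="\<lambda>s. of_real q / w * exp (- (w * of_real s))" and B=1])
  show "((\<lambda>s. of_real q / w * exp (- (w * of_real s))) has_vector_derivative
     - ((q * exp (- q * s)) *\<^sub>R exp (- (c * of_real s)))) (at s)" for s
  proof (rule has_vector_derivative_eq_rhs[OF has_vector_derivative_real_field])
    show "((\<lambda>z. of_real q / w * exp (- (w * z))) has_field_derivative
      - (of_real q * exp (- (w * of_real s)))) (at (of_real s))"
      by (auto intro!: derivative_eq_intros simp: nz)
  qed (simp add: w_def scaleR_conv_of_real exp_of_real[symmetric] exp_add[symmetric] algebra_simps)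
  show "((\<lambda>s. of_real q / w * exp (- (w * of_real s))) \<longlongrightarrow>
     of_real q / w) (at_right 0)"
    by (auto intro!: tendsto_eq_intros simp: nz)
  have "((\<lambda>s. norm (of_real q / w) * exp (- (Re w * s))) \<longlongrightarrow> 0) at_top"
    using q c unfolding w_def by real_asymp
  then show "((\<lambda>s. of_real q / w * exp (- (w * of_real s))) \<longlongrightarrow> 0) at_top"
    by (rule tendsto_norm_zero_cancel[OF tendsto_cong[THEN iffD1, rotated]]) (simp add: norm_mult norm_divide)
  show "cmod (exp (- (c * of_real s))) \<le> 1" if "s > 0" for s using c that by simp
qed (use q in \<open>auto intro!: continuous_intros borel_measurable_continuous_onI\<close>)
qed

lemma measurable_stepv:
  "(\<lambda>x. G (stepv m v x)) \<in> borel_measurable (borel \<Otimes>\<^sub>M borel)"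
  unfolding stepv_def
  by (rule measurable_compose[of "\<lambda>x. pick m v (snd x)" _ "count_space UNIV" "\<lambda>k. G (vadd v (wvec m k))"]) simp_all

text \<open>A state is a bare function, and the next state depends on the path only through the
  natural number \<open>pick\<close>; a composition over countably many values therefore gives
  measurability.\<close>

lemma measurable_shift_step:
  assumes "\<And>v. F v \<in> measurable path_space N"
  shows "(\<lambda>\<omega>. F (stepv m v (\<omega> 0)) (\<lambda>i. \<omega> (Suc i))) \<in> measurable path_space N"
proof -
  have *: "(\<lambda>\<omega> i. \<omega> (Suc i)) \<in> measurable path_space path_space"
    unfolding path_space_def
    by (intro measurable_PiM_single') (auto simp: space_PiM intro: measurable_component_singleton)
  show ?thesis unfolding stepv_def
    by (rule measurable_compose_countable[of "\<lambda>k \<omega>. F (vadd v (wvec m k)) (\<lambda>i. \<omega> (Suc i))"])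
       (auto intro: measurable_compose[OF * assms])
qed

lemma nn_integral_step:
  assumes "valid m v" and [measurable]: "g \<in> borel_measurable borel"
  shows "(\<integral>\<^sup>+x. g (fst x) * G (stepv m v x) \<partial>step_space) =
    (\<integral>\<^sup>+e. g e \<partial>expo) * (\<Sum>k=1..m-1. ennreal (jump_prob m v k) * G (vadd v (wvec m k)))"
proof -
  note measurable_stepv[of G m v, measurable]
  have "(\<integral>\<^sup>+x. g (fst x) * G (stepv m v x) \<partial>step_space) =
    (\<integral>\<^sup>+e. \<integral>\<^sup>+u. g e * G (stepv m v (e, u)) \<partial>unif \<partial>expo)"
    unfolding step_space_def by (subst unif.nn_integral_fst[symmetric]) simp_all
  also have "\<dots> = (\<integral>\<^sup>+e. g e * (\<integral>\<^sup>+u. G (vadd v (wvec m (pick m v u))) \<partial>unif) \<partial>expo)"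
    by (intro nn_integral_cong, subst nn_integral_cmult[symmetric])
       (auto simp: stepv_def intro!: measurable_compose[OF pick_measurable])
  also have "\<dots> = (\<integral>\<^sup>+e. g e \<partial>expo) * (\<integral>\<^sup>+u. G (vadd v (wvec m (pick m v u))) \<partial>unif)"
    by (rule nn_integral_multc) simp
  finally show ?thesis by (simp add: nn_integral_pick[OF assms(1), of "\<lambda>k. G (vadd v (wvec m k))"])
qed

lemma integrable_step:
  fixes g G :: "_ \<Rightarrow> complex"
  assumes "valid m v" "integrable expo g"
  shows "integrable step_space (\<lambda>x. g (fst x) * G (stepv m v x))"
proof -
  note measurable_stepv[of G m v, measurable]
  have [measurable]: "g \<in> borel_measurable borel" using assms(2) by auto
  have "(\<integral>\<^sup>+x. ennreal (cmod (g (fst x) * G (stepv m v x))) \<partial>step_space) =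
    (\<integral>\<^sup>+x. ennreal (cmod (g (fst x))) * ennreal (cmod (G (stepv m v x))) \<partial>step_space)"
    by (simp add: norm_mult ennreal_mult)
  also have "\<dots> = (\<integral>\<^sup>+e. ennreal (cmod (g e)) \<partial>expo) * (\<Sum>k=1..m-1. ennreal (jump_prob m v k)
      * ennreal (cmod (G (vadd v (wvec m k)))))"
    by (subst nn_integral_step[OF assms(1), of "\<lambda>e. ennreal (cmod (g e))" "\<lambda>v. ennreal (cmod (G v))"]) auto
  also have "\<dots> < \<infinity>"
    using assms(2) unfolding integrable_iff_bounded
    by (auto simp: ennreal_mult_less_top ennreal_mult_eq_top_iff ennreal_mult[symmetric] jump_prob_nonneg[OF assms(1)] less_top[symmetric])
  finally show ?thesis by (intro integrableI_bounded) auto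
qed

lemma integral_step:
  fixes g G :: "_ \<Rightarrow> complex"
  assumes "valid m v" "integrable expo g"
  shows "(\<integral>x. g (fst x) * G (stepv m v x) \<partial>step_space) =
    (\<integral>e. g e \<partial>expo) * (\<Sum>k=1..m-1. of_real (jump_prob m v k) * G (vadd v (wvec m k)))"
proof -
  have "(\<integral>x. g (fst x) * G (stepv m v x) \<partial>step_space) =
    (\<integral>e. \<integral>u. g e * G (stepv m v (e, u)) \<partial>unif \<partial>expo)"
    using integrable_step[OF assms, of G] unfolding step_space_def
    by (subst step_pair.integral_fst'[symmetric]) simp_all
  also have "\<dots> = (\<integral>e. g e * (\<integral>u. G (vadd v (wvec m (pick m v u))) \<partial>unif) \<partial>expo)"
    by (simp add: stepv_def)
  also have "\<dots> = (\<integral>e. g e \<partial>expo) * (\<integral>u. G (vadd v (wvec m (pick m v u))) \<partial>unif)"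
    by simp
  also have "(\<integral>u. G (vadd v (wvec m (pick m v u))) \<partial>unif) = (\<Sum>k=1..m-1. jump_prob m v k *\<^sub>R G (vadd v (wvec m k)))"
    using has_bochner_integral_pick[OF assms(1), of "\<lambda>k. G (vadd v (wvec m k))"]
      by (rule has_bochner_integral_integral_eq)
  finally show ?thesis by (simp add: scaleR_conv_of_real)
qed

text \<open>The lower bound on \<open>Re l\<close> keeps the martingale bounded in square mean; the
  upper bound leaves room for a decay exponent \<open>a > 1\<close> with
  \<open>a * Re l < 1\<close>.\<close>

locale search_urn =
  fixes m :: nat and l :: complex
  assumes m3: "m \<ge> 3" and root: "chi m l = 0" and Im_pos: "Im l > 0"
    and Re_half: "1/2 < Re l" and Re_lt_1: "Re l < 1"
begin

definition coef :: "nat \<Rightarrow> complex" where "coef k = (l + of_nat k - 1) gchoose (k - 1)"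

lemma u2_coef: "u2 m l v = (\<Sum>k=1..m-1. coef k * of_int (v k))"
  by (simp add: u2_def coef_def)

lemma coef_rec: "of_nat (Suc k) * coef (Suc (Suc k)) = (l + of_nat (Suc k)) * coef (Suc k)"
  using eigen_coeff[of k l] by (simp add: coef_def algebra_simps)

lemma coef_1: "coef (Suc 0) = 1" by (simp add: coef_def)

lemma fact_coef: "fact k * coef (Suc k) = (\<Prod>j=1..k. l + of_nat j)"
proof (induction k)
  case (Suc k)
  have "fact (Suc k) * coef (Suc (Suc k)) = fact k * (of_nat (Suc k) * coef (Suc (Suc k)))"
    by (simp add: algebra_simps)
  also have "\<dots> = (l + of_nat (Suc k)) * (fact k * coef (Suc k))"
    by (subst coef_rec) (simp add: algebra_simps)
  finally show ?case using Suc by simp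
qed (simp add: coef_1)

text \<open>For \<open>k <= m - 2\<close> this is the recurrence of the coefficients. The splitting
  colour \<open>m - 1\<close> closes the cycle: \<open>fact_coef\<close> turns its coefficient into
  the product in \<open>chi\<close>, and \<open>chi m l = 0\<close> supplies the identity that is
  required there.\<close>

lemma u2_wvec:
  assumes "k \<in> {1..m-1}"
  shows "of_nat k * u2 m l (wvec m k) = l * coef k"
proof (cases "k \<le> m - 2")
  case True
  then obtain j where "k = Suc j" using assms by (cases k) auto
  have w: "u2 m l (wvec m k) = coef (k + 1) - coef k"
    unfolding u2_coef using assms True by (intro sum_if_wvec1[OF m3]) auto
  show ?thesis unfolding w
    using coef_rec[of j] \<open>k = Suc j\<close> by (simp add: algebra_simps)
next
  case False
  then have k: "k = Suc (m - 2)" using assms m3 by auto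
  have "(l + of_nat (Suc (m-2))) * (fact (m - 2) * coef k) = (\<Prod>j=1..Suc (m-2). l + of_nat j)"
    unfolding k fact_coef by simp
  also have "Suc (m - 2) = m - 1" using m3 by simp
  also have "(\<Prod>j=1..m-1. l + of_nat j) = fact m" using root by (simp add: chi_def)
  also have "fact m = of_nat m * (of_nat (m - 1) * (fact (m - 2) :: complex))"
  proof -
    have "m = Suc (Suc (m - 2))" using m3 by simp
    then show ?thesis using fact_Suc[of "Suc (m-2)", where 'a=complex] fact_Suc[of "m-2", where 'a=complex]
      by (metis diff_Suc_1)
  qed
  finally have "fact (m - 2) * ((l + of_nat (m - 1)) * coef k) = fact (m - 2) * (of_nat m * of_nat (m - 1))"
    by (simp add: algebra_simps)
  then have "(l + of_nat (m - 1)) * coef k = of_nat m * of_nat (m - 1)"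
    by (simp only: mult_left_cancel fact_nonzero not_False_eq_True)
  moreover have "k = m - 1" using k m3 by simp
  moreover have "u2 m l (wvec m k) = of_nat m * coef 1 - coef (m - 1)"
    unfolding u2_coef using sum_if_wvec2[OF m3, of k coef] False by simp
  then have "of_nat (m - 1) * u2 m l (wvec m k) = of_nat m * of_nat (m - 1) - of_nat (m - 1) * coef (m - 1)"
    by (simp add: coef_1 right_diff_distrib)
  ultimately have "of_nat k * u2 m l (wvec m k) = (l + of_nat (m - 1)) * coef k - of_nat (m - 1) * coef k"
    by simp
  then show ?thesis by (simp add: distrib_right)
qed

text \<open>A jump thus multiplies the mean of \<open>u2\<close> by \<open>1 + l / rate\<close>,
  while the discount over the holding time has mean \<open>rate / (rate + l)\<close>. The two cancel
  in \<open>expectation_Wn\<close>.\<close>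

lemma drift:
  assumes "valid m v"
  shows "(\<Sum>k=1..m-1. of_real (jump_prob m v k) * u2 m l (wvec m k)) = l / of_real (rate m v) * u2 m l v"
proof -
  have "(\<Sum>k=1..m-1. of_real (jump_prob m v k) * u2 m l (wvec m k)) =
     (\<Sum>k=1..m-1. (of_int (v k) / of_real (rate m v)) * (of_nat k * u2 m l (wvec m k)))"
    by (intro sum.cong) (auto simp: jump_prob_def)
  also have "\<dots> = (\<Sum>k=1..m-1. (of_int (v k) / of_real (rate m v)) * (l * coef k))"
    using u2_wvec by (intro sum.cong) auto
  also have "\<dots> = l / of_real (rate m v) * u2 m l v"
    by (simp add: u2_coef sum_distrib_left mult_ac)
  finally show ?thesis .
qed

end

section \<open>The discounted martingale\<close>

text \<open>The total rate grows by one at each jump, so \<open>tail_var s n q\<close> is the rate \<open>q + n\<close> after \<open>n\<close> jumps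
  times the second moment of the modulus \<open>exp (- s t)\<close> of the discount factor at that jump.\<close>

fun tail_var :: "real \<Rightarrow> nat \<Rightarrow> real \<Rightarrow> real" where
  "tail_var s 0 q = q"
| "tail_var s (Suc n) q = q / (q + 2 * s) * tail_var s n (q + 1)"

lemma tail_var_nonneg: "s > 0 \<Longrightarrow> q > 0 \<Longrightarrow> tail_var s n q \<ge> 0"
  by (induction n arbitrary: q) auto

text \<open>Unfolded, \<open>tail_var s n q\<close> is \<open>q + n\<close> times the product of
  \<open>(q + j) / (q + j + 2 * s)\<close> over \<open>j < n\<close>, hence of order
  \<open>n powr (1 - 2 * s)\<close>. The induction compares one factor at a time, through
  \<open>1 + x <= exp x\<close> and \<open>ln x <= x - 1\<close>.\<close>

lemma tail_var_le:
  assumes "s > 1/2" "q > 0"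
  shows "tail_var s n q \<le> q * ((q + 2 * s) / (q + 2 * s + n)) powr (2 * s - 1)"
  using assms(2)
proof (induction n arbitrary: q)
  case (Suc n)
  define x where "x = q + 2 * s"
  define c where "c = 2 * s - 1"
  have x: "x > 0" "c > 0" "q + 1 = x - c" "q > 0" using Suc assms by (auto simp: x_def c_def)
  have "tail_var s n (q + 1) \<le> (q + 1) * ((x + 1) / (x + 1 + n)) powr c"
    using Suc.IH[of "q + 1"] Suc.prems by (simp add: x_def c_def add_ac)
  from mult_left_mono[OF this, of "q / x"]
  have "tail_var s (Suc n) q \<le> q / x * ((q + 1) * ((x + 1) / (x + 1 + n)) powr c)"
    using x(1,2,4) by (simp add: x_def)
  also have "\<dots> = q * (((q + 1) / x) * ((x + 1) / (x + 1 + n)) powr c)" by simp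
  also have "\<dots> \<le> q * ((x / (x + 1)) powr c * ((x + 1) / (x + 1 + n)) powr c)"
  proof (intro mult_left_mono mult_right_mono)
    have "(q + 1) / x = 1 + - c / x" using x by (simp add: field_simps)
    also have "\<dots> \<le> exp (- c / x)" by (rule exp_ge_add_one_self)
    also have "\<dots> \<le> (x / (x + 1)) powr c"
    proof -
      have "ln ((x + 1) / x) \<le> 1 / x" using x ln_le_minus_one[of "(x+1)/x"] by (simp add: field_simps)
      moreover have "ln (x / (x + 1)) = - ln ((x + 1) / x)" using x by (simp add: ln_div)
      ultimately have "c * (- (1 / x)) \<le> c * ln (x / (x + 1))" using x by (intro mult_left_mono) auto
      then show ?thesis using x by (simp add: powr_def)
    qed
    finally show "(q + 1) / x \<le> (x / (x + 1)) powr c" .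
  qed (use Suc.prems in auto)
  also have "(x / (x + 1)) powr c * ((x + 1) / (x + 1 + n)) powr c = (x / (x + 1 + n)) powr c"
    using x by (subst powr_mult[symmetric]) auto
  finally show ?case by (simp add: x_def c_def add_ac)
next
  case (0 q)
  then have "q + 2 * s > 0" using assms(1) by simp
  then show ?case by simp
qed

lemma tail_var_tendsto_0:
  assumes "s > 1/2" "q > 0"
  shows "(\<lambda>n. tail_var s n q) \<longlonglongrightarrow> 0"
proof (rule tendsto_sandwich)
  show "\<forall>\<^sub>F n in sequentially. 0 \<le> tail_var s n q" using tail_var_nonneg assms by auto
  show "\<forall>\<^sub>F n in sequentially. tail_var s n q \<le> q * ((q + 2 * s) / (q + 2 * s + n)) powr (2 * s - 1)"
    using tail_var_le assms by auto
  show "(\<lambda>n. q * ((q + 2 * s) / (q + 2 * s + real n)) powr (2 * s - 1)) \<longlonglongrightarrow> 0"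
    using assms by real_asymp
qed simp

context search_urn
begin

definition fac :: "(nat \<Rightarrow> int) \<Rightarrow> real \<times> real \<Rightarrow> complex" where
  "fac v x = exp (- (l * of_real (fst x / rate m v)))"

text \<open>The recursion consumes the first step rather than the last, to match
  \<open>nn_integral_path\<close>; \<open>Wn_eq\<close> recovers the discounted value of
  \<open>u2\<close> at the n-th jump.\<close>

primrec Wn :: "nat \<Rightarrow> (nat \<Rightarrow> int) \<Rightarrow> (nat \<Rightarrow> real \<times> real) \<Rightarrow> complex" where
  "Wn 0 v \<omega> = u2 m l v"
| "Wn (Suc n) v \<omega> = fac v (\<omega> 0) * Wn n (stepv m v (\<omega> 0)) (\<lambda>i. \<omega> (Suc i))"

lemma Wn_0: "Wn 0 v = (\<lambda>_. u2 m l v)" by auto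

lemma Wn_case_nat: "Wn (Suc n) v (case_nat x \<omega>) = fac v x * Wn n (stepv m v x) \<omega>" by simp

lemma fac_nonzero[simp]: "fac v x \<noteq> 0" by (simp add: fac_def)

lemma measurable_fac[measurable]: "fac v \<in> borel_measurable (borel \<Otimes>\<^sub>M borel)"
  unfolding fac_def by measurable

lemma measurable_Wn[measurable]: "Wn n v \<in> borel_measurable path_space"
proof (induction n arbitrary: v)
  case 0
  show ?case by (simp add: Wn_0)
next
  case (Suc n)
  note measurable_shift_step[OF Suc, measurable]
  have "Wn (Suc n) v = (\<lambda>\<omega>. fac v (\<omega> 0) * Wn n (stepv m v (\<omega> 0)) (\<lambda>i. \<omega> (Suc i)))" by auto
  then show ?case by simp
qed

lemma cmod_fac_sq: "(cmod (fac v x))\<^sup>2 = exp (- (2 * Re l / rate m v) * fst x)"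
  by (simp add: fac_def exp_double[symmetric] algebra_simps)

lemma nn_integral_fac_step:
  assumes "valid m v"
  shows "(\<integral>\<^sup>+x. ennreal ((cmod (fac v x))\<^sup>2) * G (stepv m v x) \<partial>step_space) =
    ennreal (rate m v / (rate m v + 2 * Re l)) * (\<Sum>k=1..m-1. ennreal (jump_prob m v k) * G (vadd v (wvec m k)))"
proof -
  have q: "rate m v > 0" using assms by (simp add: valid_def)
  have "(\<integral>\<^sup>+x. ennreal ((cmod (fac v x))\<^sup>2) * G (stepv m v x) \<partial>step_space) =
    (\<integral>\<^sup>+e. ennreal (exp (- (2 * Re l / rate m v) * e)) \<partial>expo) * (\<Sum>k=1..m-1. ennreal (jump_prob m v k) * G (vadd v (wvec m k)))"
    unfolding cmod_fac_sq
    by (rule nn_integral_step[OF assms, of "\<lambda>e. ennreal (exp (- (2 * Re l / rate m v) * e))"]) measurable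
  also have "(\<integral>\<^sup>+e. ennreal (exp (- (2 * Re l / rate m v) * e)) \<partial>expo) = ennreal (1 / (1 + 2 * Re l / rate m v))"
    using q Re_half by (intro nn_integral_expo_exp) (auto simp: field_simps intro!: less_le_trans[of "-1" 0])
  also have "1 / (1 + 2 * Re l / rate m v) = rate m v / (rate m v + 2 * Re l)"
    using q by (simp add: field_simps)
  finally show ?thesis .
qed

text \<open>An absent colour has jump probability 0, so the bound is demanded only where the new
  state is a genuine population.\<close>

lemma sum_jump_le:
  assumes "valid m v"
    and "\<And>k. k \<in> {1..m-1} \<Longrightarrow> v k > 0 \<Longrightarrow> G (vadd v (wvec m k)) \<le> ennreal (g k)" "\<And>k. g k \<ge> 0"
  shows "(\<Sum>k=1..m-1. ennreal (jump_prob m v k) * G (vadd v (wvec m k))) \<le> ennreal (\<Sum>k=1..m-1. jump_prob m v k * g k)"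
proof -
  have "ennreal (jump_prob m v k) * G (vadd v (wvec m k)) \<le> ennreal (jump_prob m v k * g k)"
    if k: "k \<in> {1..m-1}" for k
  proof (cases "v k > 0")
    case True
    then show ?thesis using assms k jump_prob_nonneg[OF assms(1), of k]
      by (auto simp: ennreal_mult intro!: mult_left_mono)
  next
    case False
    then have "v k = 0" using assms(1) by (auto simp: valid_def antisym_conv2)
    then show ?thesis by (simp add: jump_prob_def)
  qed
  then have "(\<Sum>k=1..m-1. ennreal (jump_prob m v k) * G (vadd v (wvec m k)))
      \<le> (\<Sum>k=1..m-1. ennreal (jump_prob m v k * g k))"
    by (rule sum_mono)
  also have "\<dots> = ennreal (\<Sum>k=1..m-1. jump_prob m v k * g k)"
    using jump_prob_nonneg[OF assms(1)] assms(3) by (intro sum_ennreal) auto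
  finally show ?thesis .
qed

definition Dvar :: real where "Dvar = (\<Sum>k=1..m-1. (cmod (u2 m l (wvec m k)))\<^sup>2)"
text \<open>Chosen so that \<open>Cvar * (q + 1) + Dvar = (1 + 2 * Re l / q) * (Cvar * q)\<close>: a
  multiple of the rate then absorbs the variance of the jump.\<close>

definition Cvar :: real where "Cvar = Dvar / (2 * Re l - 1)"

lemma Cvar_nonneg: "Cvar \<ge> 0"
  using Re_half unfolding Cvar_def Dvar_def by (intro divide_nonneg_nonneg sum_nonneg) auto

text \<open>By \<open>drift\<close>, the cross term of the square turns \<open>|u2|^2\<close> into
  \<open>(1 + 2 * Re l / q) * |u2|^2\<close>. The choice of \<open>Cvar\<close> produces the same
  factor for the multiple of the rate, and the mean squared discount
  \<open>q / (q + 2 * Re l)\<close> cancels it. So the discounted sum of the two is a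
  supermartingale.\<close>

lemma second_moment_step:
  assumes v: "valid m v"
  shows "rate m v / (rate m v + 2 * Re l) * (\<Sum>k=1..m-1. jump_prob m v k
      * ((cmod (u2 m l (vadd v (wvec m k))))\<^sup>2 + Cvar * (rate m v + 1)))
    \<le> (cmod (u2 m l v))\<^sup>2 + Cvar * rate m v"
proof -
  let ?q = "rate m v" and ?p = "jump_prob m v" and ?d = "\<lambda>k. u2 m l (wvec m k)" and ?u = "u2 m l v"
  have q: "?q > 0" using v by (simp add: valid_def)
  have "(\<Sum>k=1..m-1. ?p k * ((cmod (u2 m l (vadd v (wvec m k))))\<^sup>2 + Cvar * (?q + 1))) =
    (\<Sum>k=1..m-1. ?p k * ((cmod ?u)\<^sup>2 + Cvar * (?q + 1)) + 2 * Re (cnj ?u * (of_real (?p k) * ?d k)) + ?p k * (cmod (?d k))\<^sup>2)"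
    unfolding u2_vadd cmod_power2 by (intro sum.cong refl) (simp add: power2_eq_square algebra_simps)
  also have "\<dots> = (\<Sum>k=1..m-1. ?p k) * ((cmod ?u)\<^sup>2 + Cvar * (?q + 1)) +
      2 * Re (cnj ?u * (\<Sum>k=1..m-1. of_real (?p k) * ?d k)) + (\<Sum>k=1..m-1. ?p k * (cmod (?d k))\<^sup>2)"
    by (simp only: sum.distrib sum_distrib_left sum_distrib_right Re_sum)
  also have "\<dots> \<le> ((cmod ?u)\<^sup>2 + Cvar * (?q + 1)) + 2 * Re (cnj ?u * (l / of_real ?q * ?u)) + Dvar"
  proof -
    have "?p k \<le> 1" if "k \<in> {1..m-1}" for k
      using member_le_sum[OF that, of ?p] jump_prob_nonneg[OF v] sum_jump_prob[OF v] by auto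
    then have "(\<Sum>k=1..m-1. ?p k * (cmod (?d k))\<^sup>2) \<le> Dvar"
      unfolding Dvar_def using jump_prob_nonneg[OF v] by (intro sum_mono mult_left_le_one_le) auto
    then show ?thesis unfolding drift[OF v] sum_jump_prob[OF v] by simp
  qed
  also have "Re (cnj ?u * (l / of_real ?q * ?u)) = Re l / ?q * (cmod ?u)\<^sup>2"
    using q unfolding cmod_power2 by (simp add: power2_eq_square field_simps)
  also have "((cmod ?u)\<^sup>2 + Cvar * (?q + 1)) + 2 * (Re l / ?q * (cmod ?u)\<^sup>2) + Dvar =
     (1 + 2 * Re l / ?q) * (cmod ?u)\<^sup>2 + (Cvar * (?q + 1) + Dvar)" by (simp add: algebra_simps)
  also have "Dvar = Cvar * (2 * Re l - 1)" using Re_half by (simp add: Cvar_def)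
  also have "Cvar * (?q + 1) + Cvar * (2 * Re l - 1) = (1 + 2 * Re l / ?q) * (Cvar * ?q)"
    using q by (simp add: field_simps)
  finally have "(\<Sum>k=1..m-1. ?p k * ((cmod (u2 m l (vadd v (wvec m k))))\<^sup>2 + Cvar * (?q + 1))) \<le>
     (1 + 2 * Re l / ?q) * ((cmod ?u)\<^sup>2 + Cvar * ?q)" by (simp add: algebra_simps)
  then have "?q / (?q + 2 * Re l) * (\<Sum>k=1..m-1. ?p k * ((cmod (u2 m l (vadd v (wvec m k))))\<^sup>2 + Cvar * (?q + 1))) \<le>
     ?q / (?q + 2 * Re l) * ((1 + 2 * Re l / ?q) * ((cmod ?u)\<^sup>2 + Cvar * ?q))"
    using q Re_half by (intro mult_left_mono) auto
  also have "1 + 2 * Re l / ?q = (?q + 2 * Re l) / ?q" using q by (simp add: field_simps)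
  moreover have "?q / (?q + 2 * Re l) * ((?q + 2 * Re l) / ?q) = 1"
  proof -
    have "?q + 2 * Re l > 0" using q Re_half by simp
    then show ?thesis using q by simp
  qed
  then have "?q / (?q + 2 * Re l) * ((?q + 2 * Re l) / ?q * ((cmod ?u)\<^sup>2 + Cvar * ?q)) = (cmod ?u)\<^sup>2 + Cvar * ?q"
    by (simp only: mult.assoc[symmetric] mult_1)
  ultimately show ?thesis by simp
qed

lemma second_moment:
  assumes "valid m v"
  shows "(\<integral>\<^sup>+\<omega>. ennreal ((cmod (Wn n v \<omega>))\<^sup>2) \<partial>path_space) \<le> ennreal ((cmod (u2 m l v))\<^sup>2 + Cvar * rate m v)"
  using assms
proof (induction n arbitrary: v)
  case 0
  then show ?case using Cvar_nonneg by (auto simp: path_space.emeasure_space_1[simplified] valid_def)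
next
  case (Suc n)
  have q: "rate m v > 0" using Suc by (simp add: valid_def)
  let ?R = "\<lambda>v. \<integral>\<^sup>+\<omega>. ennreal ((cmod (Wn n v \<omega>))\<^sup>2) \<partial>path_space"
  have "(\<integral>\<^sup>+\<omega>. ennreal ((cmod (Wn (Suc n) v \<omega>))\<^sup>2) \<partial>path_space) =
    (\<integral>\<^sup>+x. ennreal ((cmod (fac v x))\<^sup>2) * ?R (stepv m v x) \<partial>step_space)"
    by (subst nn_integral_path, measurable, simp only: Wn_case_nat norm_mult power_mult_distrib)
       (simp add: ennreal_mult nn_integral_cmult)
  also have "\<dots> = ennreal (rate m v / (rate m v + 2 * Re l)) * (\<Sum>k=1..m-1. ennreal (jump_prob m v k)
      * ?R (vadd v (wvec m k)))"
    by (rule nn_integral_fac_step) fact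
  also have "\<dots> \<le> ennreal (rate m v / (rate m v + 2 * Re l)) *
    ennreal (\<Sum>k=1..m-1. jump_prob m v k * ((cmod (u2 m l (vadd v (wvec m k))))\<^sup>2 + Cvar * (rate m v + 1)))"
  proof (intro mult_left_mono sum_jump_le)
    fix k assume k: "k \<in> {1..m-1}" "v k > 0"
    have "rate m (vadd v (wvec m k)) = rate m v + 1" using k by (simp add: rate_vadd rate_wvec[OF m3])
    then show "?R (vadd v (wvec m k)) \<le> ennreal ((cmod (u2 m l (vadd v (wvec m k))))\<^sup>2 + Cvar * (rate m v + 1))"
      using Suc.IH[OF valid_vadd_wvec[OF m3 Suc.prems k]] by simp
  qed (use Suc.prems q Cvar_nonneg in auto)
  also have "\<dots> \<le> ennreal ((cmod (u2 m l v))\<^sup>2 + Cvar * rate m v)"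
    using ennreal_leI[OF second_moment_step[OF Suc.prems]] q Re_half by (simp add: ennreal_mult'[symmetric])
  finally show ?case .
qed

lemma integrable_Wn: "valid m v \<Longrightarrow> integrable path_space (Wn n v)"
  by (rule path_space.norm_integral_sq_le(1)[OF measurable_Wn second_moment]) (use Cvar_nonneg in \<open>auto simp: valid_def\<close>)

lemma integrable_Wn_sq: "valid m v \<Longrightarrow> integrable path_space (\<lambda>\<omega>. (cmod (Wn n v \<omega>))\<^sup>2)"
  using second_moment[of v n] by (intro integrableI_bounded) (auto intro: le_less_trans)

lemma expectation_Wn:
  assumes "valid m v"
  shows "(\<integral>\<omega>. Wn n v \<omega> \<partial>path_space) = u2 m l v"
  using assms
proof (induction n arbitrary: v)
  case (Suc n)
  have q: "rate m v > 0" using Suc by (simp add: valid_def)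
  have nz: "of_real (rate m v) + l \<noteq> 0" using q Re_half by (auto simp: complex_eq_iff)
  have ig: "integrable expo (\<lambda>e. exp (- (l * of_real (e / rate m v))))"
    using q Re_half by (intro integrable_expo_bounded[where B=1]) auto
  have "(\<integral>\<omega>. Wn (Suc n) v \<omega> \<partial>path_space) = (\<integral>x. fac v x * (\<integral>\<omega>. Wn n (stepv m v x) \<omega> \<partial>path_space) \<partial>step_space)"
    by (subst integral_path[OF integrable_Wn[OF Suc.prems]]) simp
  also have "\<dots> = (\<integral>x. fac v x * u2 m l (stepv m v x) \<partial>step_space)"
  proof (rule integral_cong_AE)
    show "AE x in step_space. fac v x * (\<integral>\<omega>. Wn n (stepv m v x) \<omega> \<partial>path_space) = fac v x * u2 m l (stepv m v x)"
      using AE_step_valid[OF m3 Suc.prems] by eventually_elim (simp add: Suc.IH)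
  qed (use measurable_stepv[where G="\<lambda>v. \<integral>\<omega>. Wn n v \<omega> \<partial>path_space"] measurable_stepv[where G="u2 m l"] in measurable)
  also have "\<dots> = (\<integral>e. exp (- (l * of_real (e / rate m v))) \<partial>expo) * (\<Sum>k=1..m-1. of_real (jump_prob m v k)
      * u2 m l (vadd v (wvec m k)))"
    unfolding fac_def by (rule integral_step[OF Suc.prems ig])
  also have "(\<Sum>k=1..m-1. of_real (jump_prob m v k) * u2 m l (vadd v (wvec m k))) =
     of_real (\<Sum>k=1..m-1. jump_prob m v k) * u2 m l v + (\<Sum>k=1..m-1. of_real (jump_prob m v k) * u2 m l (wvec m k))"
    by (simp only: u2_vadd distrib_left sum.distrib sum_distrib_right of_real_sum)
  also have "(\<integral>e. exp (- (l * of_real (e / rate m v))) \<partial>expo) = of_real (rate m v) / (of_real (rate m v) + l)"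
    using q Re_half by (intro integral_expo_cexp) auto
  finally have "(\<integral>\<omega>. Wn (Suc n) v \<omega> \<partial>path_space) =
    of_real (rate m v) / (of_real (rate m v) + l) * (u2 m l v + l / of_real (rate m v) * u2 m l v)"
    unfolding drift[OF Suc.prems] sum_jump_prob[OF Suc.prems] by simp
  also have "u2 m l v + l / of_real (rate m v) * u2 m l v = (of_real (rate m v) + l) / of_real (rate m v) * u2 m l v"
    using q by (simp add: field_simps)
  finally show ?case using q nz by simp
qed (simp add: Wn_0 path_space.prob_space[simplified])

text \<open>Decomposition into variance and bias about an arbitrary point. It yields both the upper
  bound on the variance and the lower bound that Doob's inequality needs.\<close>

lemma nn_integral_Wn_center:
  assumes v: "valid m v"
  shows "(\<integral>\<^sup>+\<omega>. ennreal ((cmod (Wn n v \<omega> - c))\<^sup>2) \<partial>path_space) =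
    ennreal ((\<integral>\<omega>. (cmod (Wn n v \<omega>))\<^sup>2 \<partial>path_space) - (cmod (u2 m l v))\<^sup>2 + (cmod (u2 m l v - c))\<^sup>2)"
proof -
  have eq: "(cmod (Wn n v \<omega> - c))\<^sup>2 = (cmod (Wn n v \<omega>))\<^sup>2 - 2 * Re (cnj c * Wn n v \<omega>) + (cmod c)\<^sup>2" for \<omega>
    unfolding cmod_power2 by (simp add: power2_eq_square algebra_simps)
  have B: "has_bochner_integral path_space (\<lambda>\<omega>. (cmod (Wn n v \<omega>))\<^sup>2 - 2 * Re (cnj c * Wn n v \<omega>) + (cmod c)\<^sup>2)
     ((\<integral>\<omega>. (cmod (Wn n v \<omega>))\<^sup>2 \<partial>path_space) - 2 * Re (cnj c * u2 m l v) + (cmod c)\<^sup>2)"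
  proof (intro has_bochner_integral_add has_bochner_integral_diff)
    show "has_bochner_integral path_space (\<lambda>\<omega>. 2 * Re (cnj c * Wn n v \<omega>)) (2 * Re (cnj c * u2 m l v))"
      using has_bochner_integral_integrable[OF integrable_Wn[OF v, of n]] unfolding expectation_Wn[OF v]
      by (intro has_bochner_integral_mult_right has_bochner_integral_bounded_linear[OF bounded_linear_Re])
    show "has_bochner_integral path_space (\<lambda>x. (cmod c)\<^sup>2) ((cmod c)\<^sup>2)"
      using has_bochner_integral_integrable[of path_space "\<lambda>x. (cmod c)\<^sup>2"]
        by (simp add: path_space.prob_space[simplified])
  qed (use has_bochner_integral_integrable[OF integrable_Wn_sq[OF v]] in auto)
  note int = has_bochner_integral_iff[THEN iffD1, OF B, THEN conjunct1]
  have "(\<integral>\<omega>. (cmod (Wn n v \<omega>))\<^sup>2 - 2 * Re (cnj c * Wn n v \<omega>) + (cmod c)\<^sup>2 \<partial>path_space) =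
    (\<integral>\<omega>. (cmod (Wn n v \<omega>))\<^sup>2 \<partial>path_space) - 2 * Re (cnj c * u2 m l v) + (cmod c)\<^sup>2"
    by (rule has_bochner_integral_integral_eq[OF B])
  also have "\<dots> = (\<integral>\<omega>. (cmod (Wn n v \<omega>))\<^sup>2 \<partial>path_space) - (cmod (u2 m l v))\<^sup>2 + (cmod (u2 m l v - c))\<^sup>2"
    unfolding cmod_power2 by (simp add: power2_eq_square algebra_simps)
  finally have *: "(\<integral>\<omega>. (cmod (Wn n v \<omega> - c))\<^sup>2 \<partial>path_space) =
    (\<integral>\<omega>. (cmod (Wn n v \<omega>))\<^sup>2 \<partial>path_space) - (cmod (u2 m l v))\<^sup>2 + (cmod (u2 m l v - c))\<^sup>2" unfolding eq .
  show ?thesis unfolding *[symmetric] using int unfolding eq[symmetric]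
    by (intro nn_integral_eq_integral) auto
qed

lemma nn_integral_Wn_variance:
  assumes v: "valid m v"
  shows "(\<integral>\<^sup>+\<omega>. ennreal ((cmod (Wn n v \<omega> - u2 m l v))\<^sup>2) \<partial>path_space) \<le> ennreal (Cvar * rate m v)"
proof -
  have "(\<integral>\<omega>. (cmod (Wn n v \<omega>))\<^sup>2 \<partial>path_space) \<le> (cmod (u2 m l v))\<^sup>2 + Cvar * rate m v"
    using second_moment[OF v, of n] v Cvar_nonneg
      unfolding nn_integral_eq_integral[OF integrable_Wn_sq[OF v]  AE_I2[OF zero_le_power2]]
    by (subst (asm) ennreal_le_iff) (auto simp: valid_def)
  then show ?thesis unfolding nn_integral_Wn_center[OF v] by (intro ennreal_leI) simp
qed

lemma nn_integral_Wn_center_ge: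
  assumes v: "valid m v"
  shows "(\<integral>\<^sup>+\<omega>. ennreal ((cmod (Wn n v \<omega> - c))\<^sup>2) \<partial>path_space) \<ge> ennreal ((cmod (u2 m l v - c))\<^sup>2)"
proof -
  have "(cmod (u2 m l v))\<^sup>2 \<le> (\<integral>\<omega>. (cmod (Wn n v \<omega>))\<^sup>2 \<partial>path_space)"
    using path_space.norm_integral_sq_le(3)[OF measurable_Wn[of n v], of "\<integral>\<omega>. (cmod (Wn n v \<omega>))\<^sup>2 \<partial>path_space"]
      nn_integral_eq_integral[OF integrable_Wn_sq[OF v]] expectation_Wn[OF v, of n] by simp
  then show ?thesis unfolding nn_integral_Wn_center[OF v] by (intro ennreal_leI) simp
qed

text \<open>The induction over first steps needs an arbitrary centre \<open>c\<close>,
  because the first step rescales the rest of the path.\<close>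

lemma doob_maximal:
  assumes "valid m v" "e \<ge> 0"
  shows "ennreal (e\<^sup>2) * emeasure path_space {\<omega>. \<exists>j\<le>N. e \<le> cmod (Wn j v \<omega> - c)} \<le>
    (\<integral>\<^sup>+\<omega>. ennreal ((cmod (Wn N v \<omega> - c))\<^sup>2) \<partial>path_space)"
  using assms
proof (induction N arbitrary: v e c)
  case 0
  have "ennreal (e\<^sup>2) * emeasure path_space {\<omega>. \<exists>j\<le>0. e \<le> cmod (Wn j v \<omega> - c)} \<le> ennreal ((cmod (u2 m l v - c))\<^sup>2)"
    using 0 by (cases "e \<le> cmod (u2 m l v - c)") (auto simp: path_space.emeasure_space_1[simplified] intro!: ennreal_leI power_mono)
  also have "\<dots> \<le> (\<integral>\<^sup>+\<omega>. ennreal ((cmod (Wn 0 v \<omega> - c))\<^sup>2) \<partial>path_space)"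
    by (rule nn_integral_Wn_center_ge) fact
  finally show ?case .
next
  case (Suc N)
  \<comment> \<open>If the start is already at distance \<open>e\<close> from \<open>c\<close>, the
    event is the whole space and the submartingale bound suffices. Otherwise \<open>j = 0\<close>
    drops out, and the first step replaces \<open>e\<close> and \<open>c\<close> by their quotients
    by the discount factor.\<close>
  show ?case
  proof (cases "e \<le> cmod (u2 m l v - c)")
    case True
    have "ennreal (e\<^sup>2) * emeasure path_space {\<omega>. \<exists>j\<le>Suc N. e \<le> cmod (Wn j v \<omega> - c)} \<le> ennreal (e\<^sup>2) * 1"
      by (intro mult_left_mono) (auto intro: path_space.emeasure_le_1)
    also have "\<dots> \<le> ennreal ((cmod (u2 m l v - c))\<^sup>2)" using True Suc.prems by (auto intro!: ennreal_leI power_mono)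
    also have "\<dots> \<le> (\<integral>\<^sup>+\<omega>. ennreal ((cmod (Wn (Suc N) v \<omega> - c))\<^sup>2) \<partial>path_space)"
      by (rule nn_integral_Wn_center_ge) fact
    finally show ?thesis .
  next
    case False
    let ?E = "\<lambda>N v e c. {\<omega>. \<exists>j\<le>N. e \<le> cmod (Wn j v \<omega> - c)}"
    have E[measurable]: "?E N v e c \<in> sets path_space" for N v e c
    proof -
      have "Measurable.pred path_space (\<lambda>\<omega>. e \<le> cmod (Wn j v \<omega> - c))" for j by measurable
      from predE[OF this] have "{\<omega>. e \<le> cmod (Wn j v \<omega> - c)} \<in> sets path_space" for j by simp
      moreover have "?E N v e c = (\<Union>j\<in>{..N}. {\<omega>. e \<le> cmod (Wn j v \<omega> - c)})" by auto
      ultimately show ?thesis by (simp only:) (intro sets.finite_UN; simp)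
    qed
    have norm_eq: "cmod (fac v x * z - c) = cmod (fac v x) * cmod (z - c / fac v x)" for x z c
      by (simp add: norm_mult[symmetric] right_diff_distrib)
    have ind: "indicator (?E (Suc N) v e c) (case_nat x \<omega>) =
       (indicator (?E N (stepv m v x) (e / cmod (fac v x)) (c / fac v x)) \<omega> :: ennreal)" for x \<omega>
    proof -
      have "(\<exists>j\<le>Suc N. e \<le> cmod (Wn j v (case_nat x \<omega>) - c)) \<longleftrightarrow>
         (\<exists>j\<le>N. e \<le> cmod (Wn (Suc j) v (case_nat x \<omega>) - c))"
        using False by (metis Suc_le_mono Wn.simps(1) not0_implies_Suc)
      then show ?thesis unfolding Wn_case_nat norm_eq
        by (auto simp: indicator_def pos_divide_le_eq mult.commute)
    qed
    have "ennreal (e\<^sup>2) * emeasure path_space (?E (Suc N) v e c) =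
       ennreal (e\<^sup>2) * (\<integral>\<^sup>+x. emeasure path_space (?E N (stepv m v x) (e / cmod (fac v x)) (c / fac v x)) \<partial>step_space)"
      by (subst nn_integral_indicator[OF E, symmetric], subst nn_integral_path, measurable) (simp only: ind nn_integral_indicator[OF E])
    also have "\<dots> = (\<integral>\<^sup>+x. ennreal (e\<^sup>2) * (\<integral>\<^sup>+\<omega>. indicator (?E (Suc N) v e c) (case_nat x \<omega>) \<partial>path_space) \<partial>step_space)"
      by (subst nn_integral_cmult) (measurable, simp only: ind nn_integral_indicator[OF E])
    also have "\<dots> \<le> (\<integral>\<^sup>+x. (\<integral>\<^sup>+\<omega>. ennreal ((cmod (Wn (Suc N) v (case_nat x \<omega>) - c))\<^sup>2) \<partial>path_space) \<partial>step_space)"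
    proof (rule nn_integral_mono_AE)
      show "AE x in step_space. ennreal (e\<^sup>2) * (\<integral>\<^sup>+\<omega>. indicator (?E (Suc N) v e c) (case_nat x \<omega>) \<partial>path_space) \<le>
         (\<integral>\<^sup>+\<omega>. ennreal ((cmod (Wn (Suc N) v (case_nat x \<omega>) - c))\<^sup>2) \<partial>path_space)"
        using AE_step_valid[OF m3 Suc.prems(1)]
      proof eventually_elim
        case (elim x)
        let ?a = "cmod (fac v x)" and ?e = "e / cmod (fac v x)" and ?c = "c / fac v x"
        have a: "?a > 0" by simp
        have "ennreal (e\<^sup>2) = ennreal (?a\<^sup>2) * ennreal (?e\<^sup>2)" using a
          by (simp add: ennreal_mult[symmetric] power_divide)
        then have "ennreal (e\<^sup>2) * (\<integral>\<^sup>+\<omega>. indicator (?E (Suc N) v e c) (case_nat x \<omega>) \<partial>path_space) =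
           ennreal (?a\<^sup>2) * (ennreal (?e\<^sup>2) * emeasure path_space (?E N (stepv m v x) ?e ?c))"
          by (simp only: ind nn_integral_indicator[OF E] mult.assoc)
        also have "\<dots> \<le> ennreal (?a\<^sup>2) * (\<integral>\<^sup>+\<omega>. ennreal ((cmod (Wn N (stepv m v x) \<omega> - ?c))\<^sup>2) \<partial>path_space)"
          using elim Suc.prems by (intro mult_left_mono Suc.IH) auto
        also have "\<dots> = (\<integral>\<^sup>+\<omega>. ennreal ((cmod (Wn (Suc N) v (case_nat x \<omega>) - c))\<^sup>2) \<partial>path_space)"
          by (subst nn_integral_cmult[symmetric], measurable)
             (simp only: Wn_case_nat norm_eq power_mult_distrib ennreal_mult'[symmetric] zero_le_power2)
        finally show ?case .
      qed
    qed
    also have "\<dots> = (\<integral>\<^sup>+\<omega>. ennreal ((cmod (Wn (Suc N) v \<omega> - c))\<^sup>2) \<partial>path_space)"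
      by (rule nn_integral_path[symmetric]) measurable
    finally show ?thesis .
  qed
qed

lemma measurable_nn_integral_case_nat:
  assumes [measurable]: "f \<in> borel_measurable path_space"
  shows "(\<lambda>x. \<integral>\<^sup>+\<omega>. f (case_nat x \<omega>) \<partial>path_space) \<in> borel_measurable step_space"
  by measurable

lemma pred_tail[measurable]: "Measurable.pred path_space (\<lambda>\<omega>. e \<le> cmod (Wn j v \<omega> - Wn n v \<omega>))"
  by measurable

lemma tail_sets:
  "{\<omega>. \<exists>j\<le>N. e \<le> cmod (Wn (n + j) v \<omega> - Wn n v \<omega>)} \<in> sets path_space"
proof -
  from predE[OF pred_tail] have "{\<omega>. e \<le> cmod (Wn (n + j) v \<omega> - Wn n v \<omega>)} \<in> sets path_space" for j
    by simp
  moreover have "{\<omega>. \<exists>j\<le>N. e \<le> cmod (Wn (n + j) v \<omega> - Wn n v \<omega>)}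
      = (\<Union>j\<in>{..N}. {\<omega>. e \<le> cmod (Wn (n + j) v \<omega> - Wn n v \<omega>)})" by auto
  ultimately show ?thesis by (simp only:) (intro sets.finite_UN; simp)
qed

text \<open>The induction step common to \<open>tail_L2\<close>, \<open>tail_maximal\<close> and
  \<open>expectation_time\<close>: averaging over the jump with the squared discount raises the
  index of \<open>tail_var\<close> by one and keeps the constant.\<close>

lemma tail_step:
  assumes v: "valid m v" and C: "C \<ge> 0"
    and G: "\<And>v'. valid m v' \<Longrightarrow> rate m v' = rate m v + 1 \<Longrightarrow> G v' \<le> ennreal (C * tail_var (Re l) n (rate m v'))"
  shows "(\<integral>\<^sup>+x. ennreal ((cmod (fac v x))\<^sup>2) * G (stepv m v x) \<partial>step_space)
      \<le> ennreal (C * tail_var (Re l) (Suc n) (rate m v))"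
proof -
  have q: "rate m v > 0" using v by (simp add: valid_def)
  have "(\<Sum>k=1..m-1. ennreal (jump_prob m v k) * G (vadd v (wvec m k))) \<le>
    ennreal (\<Sum>k=1..m-1. jump_prob m v k * (C * tail_var (Re l) n (rate m v + 1)))"
  proof (rule sum_jump_le[OF v])
    fix k assume k: "k \<in> {1..m-1}" "v k > 0"
    then have "rate m (vadd v (wvec m k)) = rate m v + 1" by (simp add: rate_vadd rate_wvec[OF m3])
    with G[OF valid_vadd_wvec[OF m3 v k]] show "G (vadd v (wvec m k))
        \<le> ennreal (C * tail_var (Re l) n (rate m v + 1))" by simp
  qed (use q Re_half C in \<open>auto intro!: mult_nonneg_nonneg tail_var_nonneg\<close>)
  also have "(\<Sum>k=1..m-1. jump_prob m v k * (C * tail_var (Re l) n (rate m v + 1)))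
      = C * tail_var (Re l) n (rate m v + 1)"
    unfolding sum_distrib_right[symmetric] sum_jump_prob[OF v] by simp
  finally have "(\<integral>\<^sup>+x. ennreal ((cmod (fac v x))\<^sup>2) * G (stepv m v x) \<partial>step_space) \<le>
     ennreal (rate m v / (rate m v + 2 * Re l)) * ennreal (C * tail_var (Re l) n (rate m v + 1))"
    unfolding nn_integral_fac_step[OF v] by (intro mult_left_mono) auto
  also have "\<dots> = ennreal (C * tail_var (Re l) (Suc n) (rate m v))"
    using q Re_half by (subst ennreal_mult'[symmetric]) (auto simp: mult_ac)
  finally show ?thesis .
qed

lemma tail_L2:
  assumes "valid m v"
  shows "(\<integral>\<^sup>+\<omega>. ennreal ((cmod (Wn (n + j) v \<omega> - Wn n v \<omega>))\<^sup>2) \<partial>path_space)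
      \<le> ennreal (Cvar * tail_var (Re l) n (rate m v))"
  using assms
proof (induction n arbitrary: v)
  case 0
  then show ?case using nn_integral_Wn_variance by simp
next
  case (Suc n)
  let ?G = "\<lambda>v. \<integral>\<^sup>+\<omega>. ennreal ((cmod (Wn (n + j) v \<omega> - Wn n v \<omega>))\<^sup>2) \<partial>path_space"
  have "(\<integral>\<^sup>+\<omega>. ennreal ((cmod (Wn (Suc n + j) v \<omega> - Wn (Suc n) v \<omega>))\<^sup>2) \<partial>path_space) =
    (\<integral>\<^sup>+x. ennreal ((cmod (fac v x))\<^sup>2) * ?G (stepv m v x) \<partial>step_space)"
    by (subst nn_integral_path, measurable, simp only: Wn_case_nat add_Suc right_diff_distrib[symmetric] norm_mult power_mult_distrib)
       (simp add: ennreal_mult nn_integral_cmult)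
  also have "\<dots> \<le> ennreal (Cvar * tail_var (Re l) (Suc n) (rate m v))"
    by (rule tail_step[OF Suc.prems Cvar_nonneg]) (rule Suc.IH)
  finally show ?case .
qed

text \<open>Doob's inequality for the path after the n-th jump. Each of the first n steps rescales
  the threshold \<open>e\<close>; the factor \<open>ennreal (e\<^sup>2)\<close> makes the estimate
  homogeneous, so the rescaling becomes the squared discount.\<close>

lemma tail_maximal:
  assumes "valid m v" "e > 0"
  shows "ennreal (e\<^sup>2) * emeasure path_space {\<omega>. \<exists>j\<le>N. e \<le> cmod (Wn (n + j) v \<omega> - Wn n v \<omega>)}
      \<le> ennreal (Cvar * tail_var (Re l) n (rate m v))"
  using assms
proof (induction n arbitrary: v e)
  case 0
  have "ennreal (e\<^sup>2) * emeasure path_space {\<omega>. \<exists>j\<le>N. e \<le> cmod (Wn j v \<omega> - u2 m l v)} \<le>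
     (\<integral>\<^sup>+\<omega>. ennreal ((cmod (Wn N v \<omega> - u2 m l v))\<^sup>2) \<partial>path_space)"
    using 0 by (intro doob_maximal) auto
  also have "\<dots> \<le> ennreal (Cvar * rate m v)" using 0 by (intro nn_integral_Wn_variance)
  finally show ?case by simp
next
  case (Suc n)
  let ?E = "\<lambda>n v e. {\<omega>. \<exists>j\<le>N. e \<le> cmod (Wn (n + j) v \<omega> - Wn n v \<omega>)}"
  have ind: "indicator (?E (Suc n) v e) (case_nat x \<omega>) =
       (indicator (?E n (stepv m v x) (e / cmod (fac v x))) \<omega> :: ennreal)" for x \<omega>
  proof -
    let ?s = "stepv m v x"
    have "e \<le> cmod (Wn (Suc n + j) v (case_nat x \<omega>) - Wn (Suc n) v (case_nat x \<omega>)) \<longleftrightarrow>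
       e / cmod (fac v x) \<le> cmod (Wn (n + j) ?s \<omega> - Wn n ?s \<omega>)" for j
    proof -
      have "Wn (Suc n + j) v (case_nat x \<omega>) - Wn (Suc n) v (case_nat x \<omega>) = fac v x * (Wn (n + j) ?s \<omega> - Wn n ?s \<omega>)"
        unfolding add_Suc Wn_case_nat by (rule right_diff_distrib[symmetric])
      then show ?thesis by (simp only: norm_mult) (subst pos_divide_le_eq, simp, simp only: mult.commute)
    qed
    then show ?thesis by (simp only: indicator_def mem_Collect_eq)
  qed
  define G where "G x = emeasure path_space (?E n (stepv m v x) (e / cmod (fac v x)))" for x
  have Geq: "G x = (\<integral>\<^sup>+\<omega>. indicator (?E (Suc n) v e) (case_nat x \<omega>) \<partial>path_space)" for x
  proof -
    have "G x = (\<integral>\<^sup>+\<omega>. indicator (?E n (stepv m v x) (e / cmod (fac v x))) \<omega> \<partial>path_space)"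
      unfolding G_def by (rule nn_integral_indicator[symmetric]) (rule tail_sets)
    then show ?thesis by (simp only: ind)
  qed
  have ind_meas: "(indicator (?E (Suc n) v e) :: _ \<Rightarrow> ennreal) \<in> borel_measurable path_space"
    by (rule borel_measurable_indicator[OF tail_sets])
  have G_meas: "G \<in> borel_measurable step_space"
  proof -
    have "G = (\<lambda>x. \<integral>\<^sup>+\<omega>. indicator (?E (Suc n) v e) (case_nat x \<omega>) \<partial>path_space)"
      by (rule ext) (rule Geq)
    then show ?thesis by (simp only: measurable_nn_integral_case_nat[OF ind_meas])
  qed
  have "emeasure path_space (?E (Suc n) v e) = (\<integral>\<^sup>+\<omega>. indicator (?E (Suc n) v e) \<omega> \<partial>path_space)"
    by (rule nn_integral_indicator[OF tail_sets, symmetric])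
  also have "\<dots> = (\<integral>\<^sup>+x. \<integral>\<^sup>+\<omega>. indicator (?E (Suc n) v e) (case_nat x \<omega>) \<partial>path_space \<partial>step_space)"
    by (rule nn_integral_path[OF ind_meas])
  also have "\<dots> = (\<integral>\<^sup>+x. G x \<partial>step_space)" by (simp only: Geq)
  finally have "ennreal (e\<^sup>2) * emeasure path_space (?E (Suc n) v e) = ennreal (e\<^sup>2) * (\<integral>\<^sup>+x. G x \<partial>step_space)"
    by (rule arg_cong)
  also have "\<dots> = (\<integral>\<^sup>+x. ennreal (e\<^sup>2) * G x \<partial>step_space)"
    by (rule nn_integral_cmult[symmetric, OF G_meas])
  also have "\<dots> \<le> (\<integral>\<^sup>+x. ennreal ((cmod (fac v x))\<^sup>2) * ennreal (Cvar
      * tail_var (Re l) n (rate m (stepv m v x))) \<partial>step_space)"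
  proof (rule nn_integral_mono_AE)
    show "AE x in step_space. ennreal (e\<^sup>2) * G x
        \<le> ennreal ((cmod (fac v x))\<^sup>2) * ennreal (Cvar * tail_var (Re l) n (rate m (stepv m v x)))"
      using AE_step_valid[OF m3 Suc.prems(1)]
    proof eventually_elim
      case (elim x)
      let ?a = "cmod (fac v x)" and ?e = "e / cmod (fac v x)"
      have "ennreal (e\<^sup>2) = ennreal (?a\<^sup>2) * ennreal (?e\<^sup>2)" by (simp add: ennreal_mult[symmetric] power_divide)
      then have "ennreal (e\<^sup>2) * G x = ennreal (?a\<^sup>2) * (ennreal (?e\<^sup>2) * G x)" by (simp only: mult.assoc)
      also have "\<dots> \<le> ennreal (?a\<^sup>2) * ennreal (Cvar * tail_var (Re l) n (rate m (stepv m v x)))"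
        unfolding G_def using elim Suc.prems by (intro mult_left_mono Suc.IH) auto
      finally show ?case .
    qed
  qed
  also have "\<dots> \<le> ennreal (Cvar * tail_var (Re l) (Suc n) (rate m v))"
    by (rule tail_step[OF Suc.prems(1) Cvar_nonneg, where G="\<lambda>v'. ennreal (Cvar
        * tail_var (Re l) n (rate m v'))"]) simp
  finally show ?case .
qed

lemma tail_maximal_inf:
  assumes "valid m v" "e > 0"
  shows "ennreal (e\<^sup>2) * emeasure path_space {\<omega>. \<exists>j. e \<le> cmod (Wn (n + j) v \<omega> - Wn n v \<omega>)}
      \<le> ennreal (Cvar * tail_var (Re l) n (rate m v))"
proof -
  let ?A = "\<lambda>N. {\<omega>. \<exists>j\<le>N. e \<le> cmod (Wn (n + j) v \<omega> - Wn n v \<omega>)}"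
  have eq: "{\<omega>. \<exists>j. e \<le> cmod (Wn (n + j) v \<omega> - Wn n v \<omega>)} = (\<Union>N. ?A N)" by auto
  have "(\<lambda>N. emeasure path_space (?A N)) \<longlonglongrightarrow> emeasure path_space (\<Union>N. ?A N)"
    using tail_sets by (intro Lim_emeasure_incseq) (auto simp: incseq_def intro: order_trans)
  then have "(\<lambda>N. ennreal (e\<^sup>2) * emeasure path_space (?A N)) \<longlonglongrightarrow> ennreal (e\<^sup>2) * emeasure path_space (\<Union>N. ?A N)"
    by (intro ennreal_tendsto_cmult) auto
  then show ?thesis unfolding eq
    by (rule LIMSEQ_le_const2) (use tail_maximal[OF assms] in auto)
qed

lemma AE_tail_small:
  assumes v: "valid m v" and e: "e > 0"
  shows "AE \<omega> in path_space. \<exists>n. \<forall>j. cmod (Wn (n + j) v \<omega> - Wn n v \<omega>) < e"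
proof -
  let ?B = "\<lambda>n. {\<omega>. \<exists>j. e \<le> cmod (Wn (n + j) v \<omega> - Wn n v \<omega>)}"
  have q: "rate m v > 0" using v by (simp add: valid_def)
  have sets: "?B n \<in> sets path_space" for n
  proof -
    have "?B n = (\<Union>N. {\<omega>. \<exists>j\<le>N. e \<le> cmod (Wn (n + j) v \<omega> - Wn n v \<omega>)})" by auto
    then show ?thesis using tail_sets by auto
  qed
  then have sets': "(\<Inter>n. ?B n) \<in> sets path_space" by auto
  have le: "ennreal (e\<^sup>2) * emeasure path_space (\<Inter>n. ?B n) \<le> ennreal (Cvar * tail_var (Re l) n (rate m v))" for n
  proof -
    have "emeasure path_space (\<Inter>n. ?B n) \<le> emeasure path_space (?B n)" using sets by (intro emeasure_mono) auto
    then have "ennreal (e\<^sup>2) * emeasure path_space (\<Inter>n. ?B n) \<le> ennreal (e\<^sup>2) * emeasure path_space (?B n)"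
      by (intro mult_left_mono) auto
    also note tail_maximal_inf[OF v e]
    finally show ?thesis .
  qed
  have "(\<lambda>n. ennreal (Cvar * tail_var (Re l) n (rate m v))) \<longlonglongrightarrow> ennreal (Cvar * 0)"
    using q Re_half by (intro tendsto_ennrealI tendsto_mult tail_var_tendsto_0) auto
  then have "ennreal (e\<^sup>2) * emeasure path_space (\<Inter>n. ?B n) \<le> ennreal (Cvar * 0)"
    by (rule LIMSEQ_le_const) (use le in auto)
  then have "emeasure path_space (\<Inter>n. ?B n) = 0" using e by auto
  then show ?thesis using sets'
    by (intro AE_I'[of "\<Inter>n. ?B n"]) (auto simp: not_less null_setsI)
qed

lemma AE_convergent_Wn:
  assumes v: "valid m v"
  shows "AE \<omega> in path_space. convergent (\<lambda>n. Wn n v \<omega>)"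
proof -
  have "AE \<omega> in path_space. \<forall>k. \<exists>n. \<forall>j. cmod (Wn (n + j) v \<omega> - Wn n v \<omega>) < inverse (real (Suc k))"
    by (subst AE_all_countable) (auto intro!: AE_tail_small v)
  then show ?thesis
  proof eventually_elim
    case (elim \<omega>)
    have "Cauchy (\<lambda>n. Wn n v \<omega>)"
    proof (rule CauchyI)
      fix e :: real assume "e > 0"
      then obtain k where k: "inverse (real (Suc k)) < e / 2" using reals_Archimedean[of "e/2"] by auto
      obtain n where n: "\<And>j. cmod (Wn (n + j) v \<omega> - Wn n v \<omega>) < inverse (real (Suc k))" using elim by blast
      have "cmod (Wn i v \<omega> - Wn j v \<omega>) < e" if "i \<ge> n" "j \<ge> n" for i j
      proof -
        have "cmod (Wn i v \<omega> - Wn j v \<omega>) \<le> cmod (Wn i v \<omega> - Wn n v \<omega>) + cmod (Wn j v \<omega> - Wn n v \<omega>)"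
          by norm
        also have "\<dots> < e" using n[of "i - n"] n[of "j - n"] that k by simp
        finally show ?thesis .
      qed
      then show "\<exists>M. \<forall>i\<ge>M. \<forall>j\<ge>M. cmod (Wn i v \<omega> - Wn j v \<omega>) < e" by blast
    qed
    then show ?case by (rule Cauchy_convergent)
  qed
qed

section \<open>The limit of the martingale\<close>

definition W :: "(nat \<Rightarrow> int) \<Rightarrow> (nat \<Rightarrow> real \<times> real) \<Rightarrow> complex" where
  "W v \<omega> = lim (\<lambda>n. Wn n v \<omega>)"

lemma measurable_W[measurable]: "W v \<in> borel_measurable path_space"
  unfolding W_def by measurable

lemma AE_Wn_tendsto_W: "valid m v \<Longrightarrow> AE \<omega> in path_space. (\<lambda>n. Wn n v \<omega>) \<longlonglongrightarrow> W v \<omega>"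
  using AE_convergent_Wn by (auto simp: W_def convergent_LIMSEQ_iff elim: eventually_mono)

text \<open>The smoothing equation in pathwise form; the equations for the characteristic function
  (\<open>phi_step\<close>) and for the law (\<open>emeasure_W_unit\<close>) both come from
  it.\<close>

lemma AE_W_step:
  assumes v: "valid m v"
  shows "AE x in step_space. AE \<omega> in path_space. W v (case_nat x \<omega>) = fac v x * W (stepv m v x) \<omega>"
  using AE_step_valid[OF m3 v]
proof eventually_elim
  case (elim x)
  then have "AE \<omega> in path_space. (\<lambda>n. Wn n (stepv m v x) \<omega>) \<longlonglongrightarrow> W (stepv m v x) \<omega>" by (intro AE_Wn_tendsto_W) simp
  then show ?case
  proof eventually_elim
    case (elim \<omega>)
    have "(\<lambda>n. Wn (Suc n) v (case_nat x \<omega>)) \<longlonglongrightarrow> fac v x * W (stepv m v x) \<omega>"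
      unfolding Wn_case_nat by (intro tendsto_mult elim tendsto_const)
    then have "(\<lambda>n. Wn n v (case_nat x \<omega>)) \<longlonglongrightarrow> fac v x * W (stepv m v x) \<omega>" by (rule LIMSEQ_imp_Suc)
    then show ?case unfolding W_def[of v] by (rule limI)
  qed
qed

text \<open>Fatou's lemma applied to \<open>tail_L2\<close>. This estimate carries mean and variance
  from the approximations over to the limit.\<close>

lemma W_Wn_L2:
  assumes v: "valid m v"
  shows "(\<integral>\<^sup>+\<omega>. ennreal ((cmod (W v \<omega> - Wn n v \<omega>))\<^sup>2) \<partial>path_space) \<le> ennreal (Cvar * tail_var (Re l) n (rate m v))"
proof -
  let ?f = "\<lambda>j \<omega>. ennreal ((cmod (Wn (n + j) v \<omega> - Wn n v \<omega>))\<^sup>2)"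
  have "(\<integral>\<^sup>+\<omega>. ennreal ((cmod (W v \<omega> - Wn n v \<omega>))\<^sup>2) \<partial>path_space) \<le> (\<integral>\<^sup>+\<omega>. liminf (\<lambda>j. ?f j \<omega>) \<partial>path_space)"
  proof (rule nn_integral_mono_AE)
    show "AE \<omega> in path_space. ennreal ((cmod (W v \<omega> - Wn n v \<omega>))\<^sup>2) \<le> liminf (\<lambda>j. ?f j \<omega>)"
      using AE_Wn_tendsto_W[OF v]
    proof eventually_elim
      case (elim \<omega>)
      have "(\<lambda>j. Wn (n + j) v \<omega>) \<longlonglongrightarrow> W v \<omega>" using LIMSEQ_ignore_initial_segment[OF elim, of n]
        by (simp add: add.commute)
      then have "(\<lambda>j. ?f j \<omega>) \<longlonglongrightarrow> ennreal ((cmod (W v \<omega> - Wn n v \<omega>))\<^sup>2)"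
        by (intro tendsto_intros)
      from lim_imp_Liminf[OF sequentially_bot this, symmetric] show ?case by (rule eq_refl)
    qed
  qed
  also have "\<dots> \<le> liminf (\<lambda>j. \<integral>\<^sup>+\<omega>. ?f j \<omega> \<partial>path_space)" by (rule nn_integral_liminf) measurable
  also have "\<dots> \<le> ennreal (Cvar * tail_var (Re l) n (rate m v))"
    using tail_L2[OF v] by (intro Liminf_le) auto
  finally show ?thesis .
qed

lemma integrable_W: assumes v: "valid m v" shows "integrable path_space (W v)"
proof -
  have "integrable path_space (\<lambda>\<omega>. W v \<omega> - Wn 0 v \<omega>)"
    using W_Wn_L2[OF v, of 0] v Cvar_nonneg
      by (intro path_space.norm_integral_sq_le(1)[where B="Cvar * rate m v"]) (simp_all add: valid_def)
  from Bochner_Integration.integrable_add[OF this integrable_Wn[OF v, of 0]] show ?thesis by simp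
qed

lemma expectation_W:
  assumes v: "valid m v"
  shows "(\<integral>\<omega>. W v \<omega> \<partial>path_space) = u2 m l v"
proof -
  have q: "rate m v > 0" using v by (simp add: valid_def)
  have le: "(cmod ((\<integral>\<omega>. W v \<omega> \<partial>path_space) - u2 m l v))\<^sup>2 \<le> Cvar * tail_var (Re l) n (rate m v)" for n
  proof -
    have "(cmod (\<integral>\<omega>. W v \<omega> - Wn n v \<omega> \<partial>path_space))\<^sup>2 \<le> Cvar * tail_var (Re l) n (rate m v)"
      using W_Wn_L2[OF v, of n] q Re_half Cvar_nonneg
      by (intro path_space.norm_integral_sq_le(3)) (auto intro!: mult_nonneg_nonneg tail_var_nonneg)
    then show ?thesis using integrable_W[OF v] integrable_Wn[OF v] by (simp add: expectation_Wn[OF v])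
  qed
  have "(\<lambda>n. Cvar * tail_var (Re l) n (rate m v)) \<longlonglongrightarrow> Cvar * 0"
    using q Re_half by (intro tendsto_mult tail_var_tendsto_0) auto
  then have "(cmod ((\<integral>\<omega>. W v \<omega> \<partial>path_space) - u2 m l v))\<^sup>2 \<le> Cvar * 0" by (rule LIMSEQ_le_const) (use le in auto)
  then show ?thesis by simp
qed

lemma W_variance:
  assumes v: "valid m v"
  shows "(\<integral>\<^sup>+\<omega>. ennreal ((cmod (W v \<omega> - u2 m l v))\<^sup>2) \<partial>path_space) \<le> ennreal (Cvar * rate m v)"
  using W_Wn_L2[OF v, of 0] by simp

end

section \<open>The branching property\<close>

lemma borel_measurable_cis[measurable]: "cis \<in> borel_measurable borel"
  by (intro borel_measurable_continuous_onI continuous_intros)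

lemma norm_integral_le_AE:
  fixes f :: "'a \<Rightarrow> 'b::{banach, second_countable_topology}"
  assumes "integrable M g" "AE x in M. norm (f x) \<le> g x"
  shows "norm (\<integral>x. f x \<partial>M) \<le> (\<integral>x. g x \<partial>M)"
proof -
  have "AE x in M. 0 \<le> g x" using assms(2) by eventually_elim (rule order_trans[OF norm_ge_zero])
  then show ?thesis
    by (intro order_trans[OF integral_norm_bound integral_mono_AE'] assms)
qed

text \<open>The vanishing mean kills the linear term and leaves a quadratic error, the order at
  which \<open>tail_var\<close> controls the iteration of \<open>gap_step\<close>.\<close>

lemma (in prob_space) char_fun_expansion:
  fixes X :: "'a \<Rightarrow> real"
  assumes X: "integrable M X" "(\<integral>x. X x \<partial>M) = 0" and V: "(\<integral>\<^sup>+x. ennreal ((X x)\<^sup>2) \<partial>M) \<le> ennreal V" "V \<ge> 0"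
  shows "cmod ((\<integral>x. cis (X x) \<partial>M) - 1) \<le> V / 2"
proof -
  have [measurable]: "X \<in> borel_measurable M" using X by auto
  have X2: "integrable M (\<lambda>x. (X x)\<^sup>2)"
    by (intro integrableI_bounded) (use V in \<open>auto intro: le_less_trans\<close>)
  have Xle: "(\<integral>x. (X x)\<^sup>2 \<partial>M) \<le> V"
    using V unfolding nn_integral_eq_integral[OF X2 AE_I2[OF zero_le_power2]] by simp
  have ic: "integrable M (\<lambda>x. cis (X x))"
    by (rule integrable_const_bound[where B=1]) (auto simp: cis_conv_exp)
  have iX: "integrable M (\<lambda>x. \<i> * of_real (X x))" using X by simp
  have EX: "(\<integral>x. \<i> * of_real (X x) \<partial>M) = 0" using X by simp
  have "(\<integral>x. cis (X x) \<partial>M) - 1 = (\<integral>x. cis (X x) - 1 - \<i> * of_real (X x) \<partial>M)"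
    using ic iX EX by (simp add: prob_space)
  also have "cmod \<dots> \<le> (\<integral>x. (X x)\<^sup>2 / 2 \<partial>M)"
  proof (rule norm_integral_le_AE, goal_cases)
    case 2
    have "cmod (cis (X x) - 1 - \<i> * of_real (X x)) \<le> (X x)\<^sup>2 / 2" for x
      using iexp_approx1[of "X x" 1] by (simp add: cis_conv_exp numeral_2_eq_2 power2_eq_square algebra_simps)
    then show ?case by simp
  qed (use X2 in auto)
  also have "\<dots> \<le> V / 2" using Xle by simp
  finally show ?thesis .
qed

lemma (in prob_space) norm_integral_le_const:
  fixes f :: "'a \<Rightarrow> 'b::{banach, second_countable_topology}"
  assumes "\<And>x. norm (f x) \<le> B"
  shows "norm (\<integral>x. f x \<partial>M) \<le> B"
proof (cases "integrable M f")
  case True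
  then show ?thesis by (intro order_trans[OF integral_norm_bound integral_le_const]) (auto simp: assms)
next
  case False
  then show ?thesis using order_trans[OF norm_ge_zero assms] by (simp add: not_integrable_integral_eq)
qed

text \<open>The function sought is the tail integral of
  \<open>q * exp (- q * r) *\<^sub>R h r\<close>. Some antiderivative exists on the whole line; its
  increments beyond \<open>a\<close> are at most \<open>B * exp (- q * a)\<close>, so it has a limit
  at infinity, which is subtracted.\<close>

lemma vanishing_antiderivative:
  fixes h :: "real \<Rightarrow> complex"
  assumes q: "q > 0" and h: "\<And>s. isCont h s" and B: "\<And>s. cmod (h s) \<le> B"
  obtains F where "\<And>s. (F has_vector_derivative - ((q * exp (- q * s)) *\<^sub>R h s)) (at s)" "(F \<longlongrightarrow> 0) at_top"
proof -
  have "\<exists>F. \<forall>x::real. -\<infinity> < ereal x \<longrightarrow> ereal x < \<infinity> \<longrightarrow> (F has_vector_derivative - ((q * exp (- q * x)) *\<^sub>R h x)) (at x)"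
    by (rule einterval_antiderivative) (auto intro!: continuous_intros h)
  then obtain F where F: "\<And>x. (F has_vector_derivative - ((q * exp (- q * x)) *\<^sub>R h x)) (at x)" by auto
  have contF: "continuous_on A F" for A
    by (meson F continuous_at_imp_continuous_on has_vector_derivative_continuous)
  have bd: "cmod (F b - F a) \<le> B * exp (- q * a)" if "a \<le> b" for a b
  proof (cases "a = b")
    case True
    then show ?thesis using B[of 0] norm_ge_zero[of "h 0"] by (simp add: order_trans[OF norm_ge_zero])
  next
    case False
    with that have "a < b" by simp
    have "cmod (F b - F a) \<le> - B * exp (- q * b) - (- B * exp (- q * a))"
    proof (rule differentiable_bound_general[OF \<open>a < b\<close> contF, where f'="\<lambda>x. - ((q * exp (- q * x)) *\<^sub>R h x)" and \<phi>'="\<lambda>x. B * (q * exp (- q * x))"])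
      show "((\<lambda>x. - B * exp (- q * x)) has_vector_derivative B * (q * exp (- q * x))) (at x)" for x
        unfolding has_real_derivative_iff_has_vector_derivative[symmetric]
        by (auto intro!: derivative_eq_intros)
      show "cmod (- ((q * exp (- q * x)) *\<^sub>R h x)) \<le> B * (q * exp (- q * x))" for x
        using mult_right_mono[OF B[of x], of "q * exp (- q * x)"] q by (simp add: mult_ac)
      show "(F has_vector_derivative - ((q * exp (- q * x)) *\<^sub>R h x)) (at x)" for x by (rule F)
    qed (intro continuous_intros)
    also have "\<dots> \<le> B * exp (- q * a)" using B[of 0] order_trans[OF norm_ge_zero B[of 0]] by simp
    finally show ?thesis .
  qed
  have "B * exp (- q * t) \<le> e" if "e > 0" "t \<ge> B / (q * e)" "t > 0" for e t
  proof -
    have B0: "B \<ge> 0" using order_trans[OF norm_ge_zero B[of 0]] .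
    have "q * t \<le> exp (q * t)" using exp_ge_add_one_self[of "q * t"] by linarith
    then have "B * exp (- q * t) \<le> B * (1 / (q * t))"
      using q that B0 by (intro mult_left_mono) (auto simp: exp_minus field_simps)
    also have "\<dots> \<le> e" using that q by (simp add: field_simps)
    finally show ?thesis .
  qed
  note small = this
  have "convergent (\<lambda>n::nat. F (real n))"
  proof (rule Cauchy_convergent, rule CauchyI')
    fix e :: real assume e: "e > 0"
    obtain M :: nat where M: "real M \<ge> max 1 (B / (q * (e / 2)))" using real_arch_simple by blast
    have "cmod (F (real i) - F (real j)) < e" if "i \<ge> M" "j > i" for i j
    proof -
      have "cmod (F (real i) - F (real j)) \<le> B * exp (- q * real i)" using bd[of "real i" "real j"] that
        by (simp add: norm_minus_commute)
      also have "\<dots> \<le> e / 2" using that M e by (intro small) auto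
      finally show ?thesis using e by simp
    qed
    then show "\<exists>M. \<forall>i\<ge>M. \<forall>j>i. dist (F (real i)) (F (real j)) < e" by (auto simp: dist_norm)
  qed
  then obtain L where L: "(\<lambda>n::nat. F (real n)) \<longlonglongrightarrow> L" by (auto simp: convergent_def)
  have bdL: "cmod (F t - L) \<le> B * exp (- q * t)" for t
  proof -
    have "(\<lambda>n::nat. cmod (F (real n) - F t)) \<longlonglongrightarrow> cmod (L - F t)" by (intro tendsto_intros L)
    moreover have "\<exists>N. \<forall>n\<ge>N. cmod (F (real n) - F t) \<le> B * exp (- q * t)"
    proof -
      obtain N :: nat where "real N \<ge> t" using real_arch_simple by blast
      then show ?thesis by (intro exI[of _ N] allI impI bd) auto
    qed
    ultimately have "cmod (L - F t) \<le> B * exp (- q * t)" by (rule LIMSEQ_le_const2)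
    then show ?thesis by (simp add: norm_minus_commute)
  qed
  show ?thesis
  proof (rule that[of "\<lambda>s. F s - L"])
    show "((\<lambda>s. F s - L) has_vector_derivative - ((q * exp (- q * s)) *\<^sub>R h s)) (at s)" for s
      using has_vector_derivative_diff[OF F has_vector_derivative_const] by simp
    have "((\<lambda>t. B * exp (- q * t)) \<longlongrightarrow> 0) at_top" using q by real_asymp
    then show "((\<lambda>s. F s - L) \<longlongrightarrow> 0) at_top"
      by (rule Lim_null_comparison[rotated]) (intro always_eventually allI bdL)
  qed
qed

text \<open>The substitution \<open>r = s + e / q\<close> gives
  \<open>\<psi> s = exp (q * s) *\<^sub>R F s\<close> with the tail integral \<open>F\<close>;
  differentiating this product gives the resolvent equation.\<close>

lemma resolvent_derivative:
  fixes h :: "real \<Rightarrow> complex"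
  assumes q: "q > 0" and h: "\<And>s. isCont h s" and B: "\<And>s. cmod (h s) \<le> B"
    and psi: "\<And>s. \<psi> s = (\<integral>e. h (s + e / q) \<partial>expo)"
  shows "(\<psi> has_vector_derivative of_real q * (\<psi> s - h s)) (at s)"
proof -
  obtain F where F: "\<And>s. (F has_vector_derivative - ((q * exp (- q * s)) *\<^sub>R h s)) (at s)" and F0: "(F \<longlongrightarrow> 0) at_top"
    by (rule vanishing_antiderivative[OF q h B]) blast
  have contF: "isCont F s" for s using F has_vector_derivative_continuous by blast
  have conth: "continuous_on UNIV h" using h by (simp add: continuous_at_imp_continuous_on)
  have psi_eq: "\<psi> s = exp (q * s) *\<^sub>R F s" for s
    unfolding psi
  proof (rule integral_expo_FTC[where F="\<lambda>r. exp (q * s) *\<^sub>R F (s + r)" and B=B])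
    fix r
    have "((\<lambda>r. F (s + r)) has_vector_derivative (1 *\<^sub>R - ((q * exp (- q * (s + r))) *\<^sub>R h (s + r)))) (at r)"
    proof -
      have "((\<lambda>r. s + r) has_vector_derivative 1) (at r)" by (auto intro!: derivative_eq_intros)
      from vector_diff_chain_at[OF this F] show ?thesis by (simp only: o_def)
    qed
    note D = has_vector_derivative_scaleR[OF DERIV_const this, of "exp (q * s)"]
    have "exp (q * s) * exp (- q * (s + r)) = exp (- q * r)"
      by (subst exp_add[symmetric]) (simp add: algebra_simps)
    then have E: "exp (q * s) *\<^sub>R - ((q * exp (- q * (s + r))) *\<^sub>R h (s + r)) = - ((q * exp (- q * r)) *\<^sub>R h (s + r))"
      by (simp only: scaleR_minus_right scaleR_scaleR mult.left_commute)
    show "((\<lambda>r. exp (q * s) *\<^sub>R F (s + r)) has_vector_derivative - ((q * exp (- q * r)) *\<^sub>R h (s + r))) (at r)"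
      using D by (simp only: scaleR_one E scaleR_zero_left add_0_right)
  next
    show "((\<lambda>r. exp (q * s) *\<^sub>R F (s + r)) \<longlongrightarrow> exp (q * s) *\<^sub>R F s) (at_right 0)"
    proof -
      have "isCont (\<lambda>r. exp (q * s) *\<^sub>R F (s + r)) 0"
        by (intro continuous_scaleR continuous_const isCont_o2[where f="\<lambda>r. s
            + r" and g=F] contF isCont_add continuous_ident)
      then show ?thesis by (auto simp: isCont_def intro: tendsto_mono[OF at_le])
    qed
    have "((\<lambda>r. F (s + r)) \<longlongrightarrow> 0) at_top"
      by (rule filterlim_compose[OF F0]) (auto intro: filterlim_tendsto_add_at_top filterlim_ident)
    from tendsto_scaleR[OF tendsto_const this, of "exp (q * s)"]
    show "((\<lambda>r. exp (q * s) *\<^sub>R F (s + r)) \<longlongrightarrow> 0) at_top" by simp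
    show "(\<lambda>a. h (s + a)) \<in> borel_measurable borel"
      by (intro borel_measurable_continuous_onI continuous_on_compose2[OF conth] continuous_intros) auto
    show "isCont (\<lambda>a. h (s + a)) r" for r
      by (intro isCont_o2[where f="\<lambda>a. s + a" and g=h] h isCont_add continuous_ident continuous_const)
  qed (use q B in auto)
  have "((\<lambda>s. exp (q * s) *\<^sub>R F s) has_vector_derivative exp (q * s) *\<^sub>R - ((q * exp (- q * s)) *\<^sub>R h s)
      + (q * exp (q * s)) *\<^sub>R F s) (at s)"
    by (rule has_vector_derivative_scaleR[OF _ F]) (auto intro!: derivative_eq_intros)
  then show ?thesis unfolding psi_eq[abs_def]
    by (simp add: scaleR_conv_of_real algebra_simps exp_minus)
qed

text \<open>The analytic form of a race of exponential clocks with rates \<open>q\<close> and \<open>q'\<close>: the first one rings at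
  rate \<open>q + q'\<close>, and the other one starts afresh.\<close>

lemma product_resolvent:
  fixes h h' :: "real \<Rightarrow> complex"
  assumes q: "q > 0" "q' > 0" and h: "\<And>s. isCont h s" "\<And>s. isCont h' s" and B: "\<And>s. cmod (h s)
      \<le> 1" "\<And>s. cmod (h' s) \<le> 1"
    and psi: "\<And>s. \<psi> s = (\<integral>e. h (s + e / q) \<partial>expo)" "\<And>s. \<psi>' s = (\<integral>e. h' (s + e / q') \<partial>expo)"
  shows "\<psi> 0 * \<psi>' 0 = (\<integral>e. of_real (q / (q + q')) * (h (e / (q + q')) * \<psi>' (e / (q + q'))) +
     of_real (q' / (q + q')) * (\<psi> (e / (q + q')) * h' (e / (q + q'))) \<partial>expo)"
proof -
  let ?Q = "q + q'"
  note D = resolvent_derivative[OF q(1) h(1) B(1) psi(1)] resolvent_derivative[OF q(2) h(2) B(2) psi(2)]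
  have cont: "isCont \<psi> s" "isCont \<psi>' s" for s using D has_vector_derivative_continuous by blast+
  have bd: "cmod (\<psi> s) \<le> 1" "cmod (\<psi>' s) \<le> 1" for s
    unfolding psi by (rule expo.norm_integral_le_const, rule B)+
  show ?thesis
  proof (rule integral_expo_FTC[where F="\<lambda>s. exp (- ?Q * s) *\<^sub>R (\<psi> s * \<psi>' s)" and B=2, symmetric])
    fix s
    have Q: "of_real ?Q \<noteq> (0::complex)" using q by (simp only: of_real_eq_0_iff)
    \<comment> \<open>The two resolvent equations contribute \<open>q + q'\<close> times the product
      of the resolvents, and the factor \<open>exp (- ?Q * s)\<close> takes exactly this away; only
      the two mixed terms remain.\<close>
    have "((\<lambda>s. exp (- ?Q * s) *\<^sub>R (\<psi> s * \<psi>' s)) has_vector_derivative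
      exp (- ?Q * s) *\<^sub>R (\<psi> s * (of_real q' * (\<psi>' s - h' s)) + (of_real q * (\<psi> s - h s)) * \<psi>' s) + (- ?Q * exp (- ?Q * s)) *\<^sub>R (\<psi> s * \<psi>' s)) (at s)"
      by (rule has_vector_derivative_scaleR[OF _ has_vector_derivative_mult[OF D]]) (auto intro!: derivative_eq_intros)
    also have "exp (- ?Q * s) *\<^sub>R (\<psi> s * (of_real q' * (\<psi>' s - h' s)) + (of_real q * (\<psi> s - h s)) * \<psi>' s)
        + (- ?Q * exp (- ?Q * s)) *\<^sub>R (\<psi> s * \<psi>' s) =
      exp (- ?Q * s) *\<^sub>R (- (of_real q * (h s * \<psi>' s) + of_real q' * (\<psi> s * h' s)))"
      by (simp add: scaleR_conv_of_real algebra_simps)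
    also have "of_real q * (h s * \<psi>' s) + of_real q' * (\<psi> s * h' s)
        = of_real ?Q * (of_real (q / ?Q) * (h s * \<psi>' s) + of_real (q' / ?Q) * (\<psi> s * h' s))"
      using Q by (simp add: distrib_left)
    finally show "((\<lambda>s. exp (- ?Q * s) *\<^sub>R (\<psi> s * \<psi>' s)) has_vector_derivative
       - ((?Q * exp (- ?Q * s)) *\<^sub>R (of_real (q / ?Q) * (h s * \<psi>' s) + of_real (q' / ?Q) * (\<psi> s * h' s)))) (at s)"
      by (simp add: scaleR_conv_of_real mult_ac)
    have le: "cmod (of_real a * (z * w)) \<le> 1" if "0 \<le> a" "a \<le> 1" "cmod z \<le> 1" "cmod w \<le> 1" for a z w
      using mult_mono[OF that(2) mult_mono[OF that(3,4)]] that by (simp add: norm_mult)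
    have "cmod (of_real (q / ?Q) * (h s * \<psi>' s) + of_real (q' / ?Q) * (\<psi> s * h' s)) \<le> 1 + 1"
      using q by (intro norm_triangle_mono le B bd) auto
    then show "cmod (of_real (q / ?Q) * (h s * \<psi>' s) + of_real (q' / ?Q) * (\<psi> s * h' s)) \<le> 2" by simp
    show "isCont (\<lambda>a. of_real (q / ?Q) * (h a * \<psi>' a) + of_real (q' / ?Q) * (\<psi> a * h' a)) s"
      by (intro continuous_intros h cont)
  next
    show "(\<lambda>a. of_real (q / ?Q) * (h a * \<psi>' a) + of_real (q' / ?Q) * (\<psi> a * h' a)) \<in> borel_measurable borel"
      by (intro borel_measurable_continuous_onI continuous_at_imp_continuous_on ballI continuous_intros h cont)
    have "isCont (\<lambda>s. exp (- ?Q * s) *\<^sub>R (\<psi> s * \<psi>' s)) 0" by (intro continuous_intros cont)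
    then show "((\<lambda>s. exp (- ?Q * s) *\<^sub>R (\<psi> s * \<psi>' s)) \<longlongrightarrow> \<psi> 0 * \<psi>' 0) (at_right 0)"
      by (auto simp: isCont_def intro: tendsto_mono[OF at_le])
    have "((\<lambda>t. exp (- ?Q * t)) \<longlongrightarrow> 0) at_top" using q by real_asymp
    then show "((\<lambda>s. exp (- ?Q * s) *\<^sub>R (\<psi> s * \<psi>' s)) \<longlongrightarrow> 0) at_top"
    proof (rule Lim_null_comparison[rotated])
      show "\<forall>\<^sub>F s in at_top. cmod (exp (- ?Q * s) *\<^sub>R (\<psi> s * \<psi>' s)) \<le> exp (- ?Q * s)"
        using mult_mono[OF bd] by (intro always_eventually) (auto simp: norm_mult)
    qed
  qed (use q in auto)
qed

context search_urn
begin

definition phi :: "(nat \<Rightarrow> int) \<Rightarrow> complex \<Rightarrow> complex" where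
  "phi v z = (\<integral>\<omega>. cis (Re (cnj z * W v \<omega>)) \<partial>path_space)"

text \<open>Conjugated so that the discount moves from the random variable to the argument:
  \<open>cnj z * (fac v x * w) = cnj (rot (fst x / rate m v) * z) * w\<close>.\<close>

definition rot :: "real \<Rightarrow> complex" where "rot s = cnj (exp (- (l * of_real s)))"

lemma rot_0[simp]: "rot 0 = 1" by (simp add: rot_def)
lemma rot_add: "rot (s + t) = rot s * rot t"
  by (simp add: rot_def algebra_simps flip: exp_add exp_cnj complex_cnj_mult)
lemma cmod_rot: "cmod (rot s) = exp (- (Re l * s))" by (simp add: rot_def)
lemma isCont_rot[continuous_intros]: "isCont rot s" unfolding rot_def by (intro continuous_intros)
lemma measurable_rot[measurable]: "rot \<in> borel_measurable borel"
  by (intro borel_measurable_continuous_onI continuous_at_imp_continuous_on ballI isCont_rot)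

lemma integrable_cis_W: "integrable path_space (\<lambda>\<omega>. cis (Re (cnj z * W v \<omega>)))"
  by (rule path_space.integrable_const_bound[where B=1]) simp_all

lemma cmod_phi_le_1: "cmod (phi v z) \<le> 1"
  unfolding phi_def by (rule path_space.norm_integral_le_const) simp

lemma isCont_phi: "isCont (phi v) z"
  unfolding continuous_at_sequentially
proof (intro allI impI)
  fix u assume u: "u \<longlonglongrightarrow> z"
  show "(phi v \<circ> u) \<longlonglongrightarrow> phi v z"
    unfolding phi_def o_def
  proof (rule integral_dominated_convergence[where w="\<lambda>_. 1"])
    show "AE \<omega> in path_space. (\<lambda>i. cis (Re (cnj (u i) * W v \<omega>))) \<longlonglongrightarrow> cis (Re (cnj z * W v \<omega>))"
      by (intro AE_I2 isCont_tendsto_compose[of _ cis] tendsto_intros u continuous_intros)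
  qed auto
qed

lemma measurable_phi[measurable]: "phi v \<in> borel_measurable borel"
  by (intro borel_measurable_continuous_onI continuous_at_imp_continuous_on ballI isCont_phi)

lemma phi_step:
  assumes v: "valid m v"
  shows "phi v z = (\<integral>e. (\<Sum>k=1..m-1. of_real (jump_prob m v k) * phi (vadd v (wvec m k)) (rot (e / rate m v)
      * z)) \<partial>expo)"
proof -
  have [measurable]: "(\<lambda>x. phi (stepv m v x) (rot (fst x / rate m v) * z)) \<in> borel_measurable (borel \<Otimes>\<^sub>M borel)"
    unfolding stepv_def
    by (rule measurable_compose_countable[of "\<lambda>k x. phi (vadd v (wvec m k)) (rot (fst x / rate m v) * z)"]) simp_all
  have "phi v z = (\<integral>x. \<integral>\<omega>. cis (Re (cnj z * W v (case_nat x \<omega>))) \<partial>path_space \<partial>step_space)"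
    unfolding phi_def by (rule integral_path[OF integrable_cis_W])
  also have "\<dots> = (\<integral>x. phi (stepv m v x) (rot (fst x / rate m v) * z) \<partial>step_space)"
  proof (rule integral_cong_AE)
    show "AE x in step_space. (\<integral>\<omega>. cis (Re (cnj z * W v (case_nat x \<omega>))) \<partial>path_space)
        = phi (stepv m v x) (rot (fst x / rate m v) * z)"
      using AE_W_step[OF v]
    proof eventually_elim
      case (elim x)
      then have "(\<integral>\<omega>. cis (Re (cnj z * W v (case_nat x \<omega>))) \<partial>path_space) =
         (\<integral>\<omega>. cis (Re (cnj (rot (fst x / rate m v) * z) * W (stepv m v x) \<omega>)) \<partial>path_space)"
      proof (intro integral_cong_AE)
        have *: "cnj z * (fac v x * w) = cnj (rot (fst x / rate m v) * z) * w" for w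
          by (simp add: fac_def rot_def mult_ac)
        assume "AE \<omega> in path_space. W v (case_nat x \<omega>) = fac v x * W (stepv m v x) \<omega>"
        then show "AE \<omega> in path_space. cis (Re (cnj z * W v (case_nat x \<omega>)))
            = cis (Re (cnj (rot (fst x / rate m v) * z) * W (stepv m v x) \<omega>))"
          by eventually_elim (simp only: *)
      qed simp_all
      then show ?case by (simp only: phi_def)
    qed
    show "(\<lambda>x. \<integral>\<omega>. cis (Re (cnj z * W v (case_nat x \<omega>))) \<partial>path_space) \<in> borel_measurable step_space"
      using path_space.borel_measurable_lebesgue_integral[of "\<lambda>x \<omega>. cis (Re (cnj z * W v (case_nat x \<omega>)))" step_space]
        measurable_case_nat_path2[OF borel_measurable_integrable[OF integrable_cis_W[of z v]]]
      by (simp add: split_beta')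
  qed measurable
  also have "\<dots> = (\<integral>e. \<integral>u. phi (stepv m v (e, u)) (rot (e / rate m v) * z) \<partial>unif \<partial>expo)"
  proof -
    have "integrable step_space (\<lambda>x. phi (stepv m v x) (rot (fst x / rate m v) * z))"
      by (rule step_space.integrable_const_bound[where B=1]) (simp_all add: cmod_phi_le_1)
    then show ?thesis unfolding step_space_def by (subst step_pair.integral_fst'[symmetric]) simp_all
  qed
  also have "\<dots> = (\<integral>e. (\<Sum>k=1..m-1. of_real (jump_prob m v k) * phi (vadd v (wvec m k)) (rot (e / rate m v)
      * z)) \<partial>expo)"
  proof (intro Bochner_Integration.integral_cong refl)
    fix e
    show "(\<integral>u. phi (stepv m v (e, u)) (rot (e / rate m v) * z) \<partial>unif) =
     (\<Sum>k=1..m-1. of_real (jump_prob m v k) * phi (vadd v (wvec m k)) (rot (e / rate m v) * z))"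
      using has_bochner_integral_integral_eq[OF has_bochner_integral_pick[OF v, of "\<lambda>k. phi (vadd v (wvec m k)) (rot (e / rate m v) * z)"]]
      by (simp add: stepv_def scaleR_conv_of_real)
  qed
  finally show ?thesis .
qed

lemma sum_jump_norm_le:
  fixes G :: "nat \<Rightarrow> complex"
  assumes v: "valid m v" and G: "\<And>k. k \<in> {1..m-1} \<Longrightarrow> v k > 0 \<Longrightarrow> cmod (G k) \<le> B" and B: "B \<ge> 0"
  shows "cmod (\<Sum>k=1..m-1. of_real (jump_prob m v k) * G k) \<le> B"
proof -
  have "cmod (\<Sum>k=1..m-1. of_real (jump_prob m v k) * G k) \<le> (\<Sum>k=1..m-1. jump_prob m v k * B)"
  proof (rule sum_norm_le)
    fix k assume k: "k \<in> {1..m-1}"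
    show "cmod (of_real (jump_prob m v k) * G k) \<le> jump_prob m v k * B"
    proof (cases "v k > 0")
      case True
      then show ?thesis using G[OF k] jump_prob_nonneg[OF v, of k] by (auto simp: norm_mult intro!: mult_left_mono)
    next
      case False
      then have "v k = 0" using v by (auto simp: valid_def antisym_conv2)
      then show ?thesis by (simp add: jump_prob_def)
    qed
  qed
  also have "\<dots> = B" unfolding sum_distrib_right[symmetric] sum_jump_prob[OF v] by simp
  finally show ?thesis .
qed

lemma valid_vadd: "valid m v \<Longrightarrow> valid m v' \<Longrightarrow> valid m (vadd v v')"
  by (simp add: valid_def rate_vadd) (simp add: vadd_def)

lemma vadd_ac: "vadd (vadd a b) c = vadd (vadd a c) b" "vadd (vadd a b) c = vadd a (vadd b c)"
  by (auto simp: vadd_def)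

text \<open>By \<open>phi_step\<close>, \<open>phi v (rot s * z)\<close> is the resolvent of the
  average after one jump, so \<open>product_resolvent\<close> applies: whichever population wins the
  race jumps, and the other one is unchanged.\<close>

lemma phi_product_step:
  assumes v: "valid m v" and v': "valid m v'"
  shows "phi v z * phi v' z = (\<integral>e. of_real (rate m v / (rate m v + rate m v')) *
     ((\<Sum>k=1..m-1. of_real (jump_prob m v k) * phi (vadd v (wvec m k)) (rot (e / (rate m v + rate m v')) * z)) * phi v' (rot (e / (rate m v + rate m v')) * z)) +
     of_real (rate m v' / (rate m v + rate m v')) *
     (phi v (rot (e / (rate m v + rate m v')) * z) * (\<Sum>k=1..m-1. of_real (jump_prob m v' k) * phi (vadd v' (wvec m k)) (rot (e / (rate m v + rate m v')) * z))) \<partial>expo)"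
proof -
  define h where "h v s = (\<Sum>k=1..m-1. of_real (jump_prob m v k) * phi (vadd v (wvec m k)) (rot s * z))" for v s
  have cont: "isCont (h v) s" for v s
    unfolding h_def by (intro continuous_intros isCont_o2[OF _ isCont_phi])
  have bd: "cmod (h v s) \<le> 1" if "valid m v" for v s
    unfolding h_def by (rule sum_jump_norm_le[OF that cmod_phi_le_1]) simp
  have psi: "phi v (rot s * z) = (\<integral>e. h v (s + e / rate m v) \<partial>expo)" if "valid m v" for v s
    unfolding h_def by (subst phi_step[OF that]) (simp add: rot_add mult_ac)
  have q: "rate m v > 0" "rate m v' > 0" using v v' by (auto simp: valid_def)
  from product_resolvent[OF q cont cont bd[OF v] bd[OF v'] psi[OF v] psi[OF v']]
  show ?thesis unfolding h_def by simp
qed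

lemma jump_prob_vadd:
  assumes "valid m v" "valid m v'"
  shows "jump_prob m (vadd v v') k = rate m v / (rate m v + rate m v') * jump_prob m v k
      + rate m v' / (rate m v + rate m v') * jump_prob m v' k"
proof -
  have "rate m v > 0" "rate m v' > 0" using assms by (auto simp: valid_def)
  moreover have "vadd v v' k = v k + v' k" by (simp add: vadd_def)
  ultimately show ?thesis by (simp add: jump_prob_def rate_vadd add_divide_distrib[symmetric] distrib_left)
qed

lemma phi_near_mean:
  assumes v: "valid m v"
  shows "cmod (phi v z * cis (- Re (cnj z * u2 m l v)) - 1) \<le> (cmod z)\<^sup>2 * (Cvar * rate m v) / 2"
proof -
  define X where "X \<omega> = Re (cnj z * (W v \<omega> - u2 m l v))" for \<omega>
  have "phi v z * cis (- Re (cnj z * u2 m l v))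
      = (\<integral>\<omega>. cis (Re (cnj z * W v \<omega>)) * cis (- Re (cnj z * u2 m l v)) \<partial>path_space)"
    unfolding phi_def by simp
  also have "\<dots> = (\<integral>\<omega>. cis (X \<omega>) \<partial>path_space)"
    unfolding X_def by (simp add: cis_mult algebra_simps)
  finally have eq: "phi v z * cis (- Re (cnj z * u2 m l v)) = (\<integral>\<omega>. cis (X \<omega>) \<partial>path_space)" .
  have i: "integrable path_space (\<lambda>\<omega>. cnj z * (W v \<omega> - u2 m l v))"
    using integrable_W[OF v] by auto
  have "(\<integral>\<omega>. W v \<omega> - u2 m l v \<partial>path_space) = 0"
    using integrable_W[OF v] by (simp add: expectation_W[OF v] path_space.prob_space[simplified])
  then have "(\<integral>\<omega>. cnj z * (W v \<omega> - u2 m l v) \<partial>path_space) = 0" by simp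
  then have X: "integrable path_space X" "(\<integral>\<omega>. X \<omega> \<partial>path_space) = 0"
    unfolding X_def using integrable_Re[OF i] integral_Re[OF i] by (simp_all only: zero_complex.sel)
  have "(\<integral>\<^sup>+\<omega>. ennreal ((X \<omega>)\<^sup>2) \<partial>path_space)
      \<le> (\<integral>\<^sup>+\<omega>. ennreal ((cmod z)\<^sup>2) * ennreal ((cmod (W v \<omega> - u2 m l v))\<^sup>2) \<partial>path_space)"
  proof (intro nn_integral_mono)
    fix \<omega>
    have "(X \<omega>)\<^sup>2 \<le> (cmod (cnj z * (W v \<omega> - u2 m l v)))\<^sup>2"
      unfolding X_def by (intro power2_le_iff_abs_le[THEN iffD2] abs_Re_le_cmod) simp
    then show "ennreal ((X \<omega>)\<^sup>2) \<le> ennreal ((cmod z)\<^sup>2) * ennreal ((cmod (W v \<omega> - u2 m l v))\<^sup>2)"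
      by (simp add: norm_mult power_mult_distrib ennreal_mult[symmetric])
  qed
  also have "\<dots> \<le> ennreal ((cmod z)\<^sup>2) * ennreal (Cvar * rate m v)"
    by (subst nn_integral_cmult) (auto intro!: mult_left_mono W_variance v)
  also have "\<dots> = ennreal ((cmod z)\<^sup>2 * (Cvar * rate m v))" by (simp add: ennreal_mult'[symmetric])
  finally show ?thesis unfolding eq
    using Cvar_nonneg v by (intro path_space.char_fun_expansion[OF X]) (auto simp: valid_def)
qed

text \<open>Both terms of \<open>gap\<close> satisfy the first-step equation of the pair of independent populations, so
  \<open>gap\<close> is reproduced by the averaging operator of \<open>gap_step\<close>; since it is quadratic at \<open>0\<close>, iterating
  that operator shrinks it like \<open>tail_var\<close>.\<close>

definition gap :: "(nat \<Rightarrow> int) \<Rightarrow> (nat \<Rightarrow> int) \<Rightarrow> complex \<Rightarrow> complex" where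
  "gap v v' z = phi (vadd v v') z - phi v z * phi v' z"

text \<open>Additivity of \<open>u2\<close> makes the phases of both terms agree, so only the
  quadratic errors of three characteristic functions remain. The bound is the case
  \<open>n = 0\<close> of \<open>gap_bound\<close>.\<close>

lemma gap_base:
  assumes v: "valid m v" and v': "valid m v'"
  shows "cmod (gap v v' z) \<le> Cvar * (rate m v + rate m v') * (cmod z)\<^sup>2"
proof -
  define \<epsilon> where "\<epsilon> v = phi v z * cis (- Re (cnj z * u2 m l v)) - 1" for v
  have b: "cmod (\<epsilon> v) \<le> (cmod z)\<^sup>2 * (Cvar * rate m v) / 2" if "valid m v" for v
    unfolding \<epsilon>_def by (rule phi_near_mean[OF that])
  have b1: "cmod (1 + \<epsilon> v) \<le> 1" for v unfolding \<epsilon>_def using cmod_phi_le_1[of v z] by (simp add: norm_mult)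
  have phi_eq: "phi v z = cis (Re (cnj z * u2 m l v)) * (1 + \<epsilon> v)" for v
    unfolding \<epsilon>_def by (simp add: mult.left_commute[of "cis _"] cis_mult del: times_complex.sel)
  have "cis (Re (cnj z * u2 m l (vadd v v'))) = cis (Re (cnj z * u2 m l v)) * cis (Re (cnj z * u2 m l v'))"
    by (simp add: u2_vadd cis_mult distrib_left del: times_complex.sel)
  then have "gap v v' z = cis (Re (cnj z * u2 m l (vadd v v'))) * (\<epsilon> (vadd v v') - \<epsilon> v - (1 + \<epsilon> v) * \<epsilon> v')"
    unfolding gap_def phi_eq by (simp add: algebra_simps)
  then have "cmod (gap v v' z) = cmod (\<epsilon> (vadd v v') - \<epsilon> v - (1 + \<epsilon> v) * \<epsilon> v')" by (simp add: norm_mult)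
  also have "\<dots> \<le> cmod (\<epsilon> (vadd v v')) + cmod (\<epsilon> v) + cmod ((1 + \<epsilon> v) * \<epsilon> v')"
    by (metis (no_types, lifting) add_right_mono norm_triangle_ineq4 order_trans)
  also have "cmod ((1 + \<epsilon> v) * \<epsilon> v') \<le> 1 * cmod (\<epsilon> v')"
    unfolding norm_mult by (intro mult_right_mono b1) simp
  finally have "cmod (gap v v' z) \<le> cmod (\<epsilon> (vadd v v')) + cmod (\<epsilon> v) + cmod (\<epsilon> v')" by simp
  also have "\<dots> \<le> (cmod z)\<^sup>2 * (Cvar * rate m (vadd v v')) / 2 + (cmod z)\<^sup>2 * (Cvar * rate m v) / 2
      + (cmod z)\<^sup>2 * (Cvar * rate m v') / 2"
    by (intro add_mono b v v' valid_vadd)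
  also have "\<dots> = Cvar * (rate m v + rate m v') * (cmod z)\<^sup>2" by (simp add: rate_vadd field_simps)
  finally show ?thesis .
qed

lemma weighted_sum_difference:
  fixes a b f g :: "'b::comm_ring"
  shows "(\<Sum>k\<in>A. a * (p k * x k) + b * (p' k * y k)) - (a * ((\<Sum>k\<in>A. p k * x' k) * f) + b * (g * (\<Sum>k\<in>A. p' k * y' k))) =
    a * (\<Sum>k\<in>A. p k * (x k - x' k * f)) + b * (\<Sum>k\<in>A. p' k * (y k - g * y' k))"
  by (induction A rule: infinite_finite_induct) (simp_all add: algebra_simps)

lemma gap_step:
  assumes v: "valid m v" and v': "valid m v'"
  shows "gap v v' z = (\<integral>e.
    of_real (rate m v / (rate m v + rate m v')) * (\<Sum>k=1..m-1. of_real (jump_prob m v k) * gap (vadd v (wvec m k)) v' (rot (e / (rate m v + rate m v')) * z)) +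
    of_real (rate m v' / (rate m v + rate m v')) * (\<Sum>k=1..m-1. of_real (jump_prob m v' k) * gap v (vadd v' (wvec m k)) (rot (e / (rate m v + rate m v')) * z)) \<partial>expo)"
proof -
  let ?Q = "rate m v + rate m v'" and ?a = "rate m v / (rate m v
      + rate m v')" and ?b = "rate m v' / (rate m v + rate m v')"
  let ?r = "\<lambda>e. rot (e / ?Q) * z"
  let ?A = "\<lambda>e. (\<Sum>k=1..m-1. of_real (jump_prob m (vadd v v') k) * phi (vadd (vadd v v') (wvec m k)) (?r e))"
  let ?B = "\<lambda>e. of_real ?a * ((\<Sum>k=1..m-1. of_real (jump_prob m v k) * phi (vadd v (wvec m k)) (?r e))
      * phi v' (?r e)) +
     of_real ?b * (phi v (?r e) * (\<Sum>k=1..m-1. of_real (jump_prob m v' k) * phi (vadd v' (wvec m k)) (?r e)))"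
  have q: "rate m v > 0" "rate m v' > 0" using v v' by (auto simp: valid_def)
  have ab: "0 \<le> ?a" "?a \<le> 1" "0 \<le> ?b" "?b \<le> 1" using q by auto
  have S: "cmod (\<Sum>k=1..m-1. of_real (jump_prob m v k) * phi (G k) y) \<le> 1" if "valid m v" for v G y
    by (rule sum_jump_norm_le[OF that cmod_phi_le_1]) simp
  have iA: "integrable expo ?A"
    by (rule integrable_expo_bounded[where B=1]) (use S[OF valid_vadd[OF v v']] in auto)
  have le: "cmod (of_real a * (x * y)) \<le> 1" if "0 \<le> a" "a \<le> 1" "cmod x \<le> 1" "cmod y \<le> 1" for a x y
    using mult_mono[OF that(2) mult_mono[OF that(3,4)]] that by (simp add: norm_mult)
  have iB: "integrable expo ?B"
  proof (rule integrable_expo_bounded[where B="1 + 1"])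
    show "cmod (?B e) \<le> 1 + 1" for e
      by (intro norm_triangle_mono le ab S v v' cmod_phi_le_1)
  qed measurable
  have "gap v v' z = (\<integral>e. ?A e \<partial>expo) - (\<integral>e. ?B e \<partial>expo)"
    unfolding gap_def phi_step[OF valid_vadd[OF v v']] phi_product_step[OF v v'] rate_vadd ..
  also have "\<dots> = (\<integral>e. ?A e - ?B e \<partial>expo)" by (rule Bochner_Integration.integral_diff[symmetric, OF iA iB])
  also have "\<dots> = (\<integral>e. of_real ?a * (\<Sum>k=1..m-1. of_real (jump_prob m v k) * gap (vadd v (wvec m k)) v' (?r e)) +
    of_real ?b * (\<Sum>k=1..m-1. of_real (jump_prob m v' k) * gap v (vadd v' (wvec m k)) (?r e)) \<partial>expo)"
  proof (intro Bochner_Integration.integral_cong refl)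
    fix e
    show "?A e - ?B e = of_real ?a * (\<Sum>k=1..m-1. of_real (jump_prob m v k) * gap (vadd v (wvec m k)) v' (?r e)) +
    of_real ?b * (\<Sum>k=1..m-1. of_real (jump_prob m v' k) * gap v (vadd v' (wvec m k)) (?r e))"
    proof -
    \<comment> \<open>A jump of the union happens in \<open>v\<close> with probability
      \<open>?a\<close> and in \<open>v'\<close> with probability \<open>?b\<close>, so both terms
      of \<open>gap\<close> are averages with the same weights.\<close>
    have "?A e = (\<Sum>k=1..m-1. of_real ?a * (of_real (jump_prob m v k) * phi (vadd (vadd v (wvec m k)) v') (?r e)) +
       of_real ?b * (of_real (jump_prob m v' k) * phi (vadd v (vadd v' (wvec m k))) (?r e)))"
      unfolding jump_prob_vadd[OF v v'] vadd_ac(2)[symmetric] vadd_ac(1)[of v "wvec m _" v']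
      by (intro sum.cong refl) (simp add: algebra_simps)
    then show ?thesis unfolding gap_def by (simp only: weighted_sum_difference)
  qed
  qed
  finally show ?thesis .
qed

lemma gap_bound:
  assumes "valid m v" "valid m v'"
  shows "cmod (gap v v' z) \<le> Cvar * tail_var (Re l) n (rate m v + rate m v') * (cmod z)\<^sup>2"
  using assms
proof (induction n arbitrary: v v' z)
  case 0
  then show ?case using gap_base by simp
next
  case (Suc n)
  let ?Q = "rate m v + rate m v'" and ?a = "rate m v / (rate m v
      + rate m v')" and ?b = "rate m v' / (rate m v + rate m v')"
  let ?K = "Cvar * tail_var (Re l) n (?Q + 1) * (cmod z)\<^sup>2"
  have q: "rate m v > 0" "rate m v' > 0" using Suc by (auto simp: valid_def)
  have ab: "0 \<le> ?a" "0 \<le> ?b" "?a + ?b = 1" using q by (auto simp: add_divide_distrib[symmetric])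
  have K: "?K \<ge> 0" using q Cvar_nonneg Re_half by (intro mult_nonneg_nonneg tail_var_nonneg) auto
  have r2: "(cmod (rot (e / ?Q) * z))\<^sup>2 = exp (- (2 * Re l / ?Q) * e) * (cmod z)\<^sup>2" for e
    by (simp add: norm_mult power_mult_distrib cmod_rot exp_double[symmetric] algebra_simps)
  have "has_bochner_integral expo (\<lambda>e. exp (- (2 * Re l / ?Q) * e)) (1 / (1 + 2 * Re l / ?Q))"
  proof (rule has_bochner_integral_nn_integral)
    have "2 * Re l / ?Q \<ge> 0" using q Re_half by simp
    then show "(\<integral>\<^sup>+e. ennreal (exp (- (2 * Re l / ?Q) * e)) \<partial>expo) = ennreal (1 / (1 + 2 * Re l / ?Q))"
      by (intro nn_integral_expo_exp) linarith
    from \<open>2 * Re l / ?Q \<ge> 0\<close> show "0 \<le> 1 / (1 + 2 * Re l / ?Q)" by simp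
  qed auto
  then have int: "has_bochner_integral expo (\<lambda>e. ?K * exp (- (2 * Re l / ?Q) * e)) (?K * (1 / (1 + 2 * Re l / ?Q)))"
    by (rule has_bochner_integral_mult_right)
  have "cmod (gap v v' z) \<le> (\<integral>e. ?K * exp (- (2 * Re l / ?Q) * e) \<partial>expo)"
    unfolding gap_step[OF Suc.prems]
  proof (rule norm_integral_le_AE)
    show "integrable expo (\<lambda>e. ?K * exp (- (2 * Re l / ?Q) * e))" using int
      by (rule has_bochner_integral_iff[THEN iffD1, THEN conjunct1])
    show "AE e in expo. cmod (of_real ?a * (\<Sum>k=1..m-1. of_real (jump_prob m v k)
        * gap (vadd v (wvec m k)) v' (rot (e / ?Q) * z)) +
      of_real ?b * (\<Sum>k=1..m-1. of_real (jump_prob m v' k) * gap v (vadd v' (wvec m k)) (rot (e / ?Q) * z))) \<le> ?K * exp (- (2 * Re l / ?Q) * e)"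
    proof (rule AE_I2)
      fix e
      let ?z = "rot (e / ?Q) * z" and ?B = "?K * exp (- (2 * Re l / ?Q) * e)"
      have B: "?B \<ge> 0" using K by simp
      have Beq: "?B = Cvar * tail_var (Re l) n (?Q + 1) * (cmod ?z)\<^sup>2" unfolding r2 by simp
      have 1: "cmod (\<Sum>k=1..m-1. of_real (jump_prob m v k) * gap (vadd v (wvec m k)) v' ?z) \<le> ?B"
      proof (rule sum_jump_norm_le[OF Suc.prems(1) _ B])
        fix k assume k: "k \<in> {1..m-1}" "v k > 0"
        have "rate m (vadd v (wvec m k)) + rate m v' = ?Q + 1" using k by (simp add: rate_vadd rate_wvec[OF m3])
        with Suc.IH[OF valid_vadd_wvec[OF m3 Suc.prems(1) k] Suc.prems(2), of ?z]
        show "cmod (gap (vadd v (wvec m k)) v' ?z) \<le> ?B" unfolding Beq by simp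
      qed
      have 2: "cmod (\<Sum>k=1..m-1. of_real (jump_prob m v' k) * gap v (vadd v' (wvec m k)) ?z) \<le> ?B"
      proof (rule sum_jump_norm_le[OF Suc.prems(2) _ B])
        fix k assume k: "k \<in> {1..m-1}" "v' k > 0"
        have "rate m v + rate m (vadd v' (wvec m k)) = ?Q + 1" using k by (simp add: rate_vadd rate_wvec[OF m3])
        with Suc.IH[OF Suc.prems(1) valid_vadd_wvec[OF m3 Suc.prems(2) k], of ?z]
        show "cmod (gap v (vadd v' (wvec m k)) ?z) \<le> ?B" unfolding Beq by simp
      qed
      have "cmod (of_real ?a * (\<Sum>k=1..m-1. of_real (jump_prob m v k) * gap (vadd v (wvec m k)) v' ?z) +
        of_real ?b * (\<Sum>k=1..m-1. of_real (jump_prob m v' k) * gap v (vadd v' (wvec m k)) ?z)) \<le> ?a * ?B + ?b * ?B"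
        by (intro norm_triangle_mono) (simp only: norm_mult norm_of_real abs_of_nonneg[OF ab(1)] abs_of_nonneg[OF ab(2)], rule mult_left_mono, fact, fact)+
      also have "\<dots> = ?B" unfolding distrib_right[symmetric] ab(3) by simp
      finally show "cmod (of_real ?a * (\<Sum>k=1..m-1. of_real (jump_prob m v k) * gap (vadd v (wvec m k)) v' ?z) +
        of_real ?b * (\<Sum>k=1..m-1. of_real (jump_prob m v' k) * gap v (vadd v' (wvec m k)) ?z)) \<le> ?B" .
    qed
  qed
  also have "\<dots> = ?K * (1 / (1 + 2 * Re l / ?Q))" using int by (rule has_bochner_integral_integral_eq)
  also have "1 / (1 + 2 * Re l / ?Q) = ?Q / (?Q + 2 * Re l)" using q Re_half by (simp add: field_simps)
  finally show ?case by (simp add: mult_ac)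
qed

theorem phi_vadd:
  assumes v: "valid m v" and v': "valid m v'"
  shows "phi (vadd v v') z = phi v z * phi v' z"
proof -
  have q: "rate m v + rate m v' > 0" using v v' by (auto simp: valid_def)
  have "(\<lambda>n. Cvar * tail_var (Re l) n (rate m v + rate m v') * (cmod z)\<^sup>2) \<longlonglongrightarrow> Cvar * 0 * (cmod z)\<^sup>2"
    using q Re_half by (intro tendsto_mult tail_var_tendsto_0 tendsto_const) auto
  then have "cmod (gap v v' z) \<le> Cvar * 0 * (cmod z)\<^sup>2" by (rule LIMSEQ_le_const) (use gap_bound[OF v v'] in auto)
  then show ?thesis by (simp add: gap_def)
qed

end

section \<open>Decay of the characteristic function\<close>

lemma measure_expo_greaterThan:
  assumes "a \<ge> 0"
  shows "measure expo {a<..} = exp (- a)"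
proof -
  have "distributed expo lborel (\<lambda>x. x) (exponential_density 1)"
    unfolding distributed_def expo_def by (auto intro!: distr_id2)
  from expo.exponential_distributedD_gt[OF this assms] show ?thesis by (simp add: greaterThan_def)
qed

text \<open>Nonstationary phase: the derivative of \<open>f\<close> is
  \<open>- exp (- (s * r)) * k r\<close>, and \<open>k\<close> is positive during a quarter turn.
  One integration by parts, with \<open>g\<close> the quotient of \<open>exp (- r)\<close> by this
  derivative, gains the factor \<open>1 / \<rho>\<close>.\<close>

lemma oscillation_interval:
  fixes s t :: real
  assumes t: "t > 0" and s: "s > 0"
  obtains C where "\<And>\<rho>. \<rho> > 0 \<Longrightarrow> cmod (integral {0..pi/(2*t)} (\<lambda>r. exp (- r) *\<^sub>R cis (\<rho> * (exp (- (s * r))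
      * cos (t * r))))) \<le> C / \<rho>"
proof -
  define b where "b = pi / (2 * t)"
  have b: "b > 0" using t by (simp add: b_def)
  define f where "f r = exp (- (s * r)) * cos (t * r)" for r
  define k where "k r = s * cos (t * r) + t * sin (t * r)" for r
  define g where "g r = - exp (- ((1 - s) * r)) / k r" for r
  define g' where "g' r = ((1 - s) * exp (- ((1 - s) * r)) * k r + exp (- ((1 - s) * r)) * (t\<^sup>2 * cos (t
      * r) - s * t * sin (t * r))) / (k r)\<^sup>2" for r
  have k_pos: "k r > 0" if "r \<in> {0..b}" for r
  proof -
    have r: "0 \<le> t * r" "t * r \<le> pi / 2"
    proof -
      show "0 \<le> t * r" using that t by auto
      have "t * r \<le> t * b" using that t by (intro mult_left_mono) auto
      then show "t * r \<le> pi / 2" using t by (simp add: b_def)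
    qed
    have c: "cos (t * r) \<ge> 0" using r by (intro cos_ge_zero) auto
    have sn: "sin (t * r) \<ge> 0" using r by (intro sin_ge_zero) auto
    have "cos (t * r) > 0 \<or> sin (t * r) > 0"
      using c sn sin_cos_squared_add[of "t * r"] by (cases "cos (t * r) = 0") (auto simp: less_le)
    then show ?thesis unfolding k_def using c sn s t by (auto intro: add_pos_nonneg add_nonneg_pos)
  qed
  have f': "(f has_real_derivative - exp (- (s * r)) * k r) (at r within S)" for r S
    unfolding f_def k_def by (auto intro!: derivative_eq_intros simp: algebra_simps)
  have g': "(g has_real_derivative g' r) (at r within S)" if "r \<in> {0..b}" for r S
    unfolding g_def g'_def using k_pos[OF that] unfolding k_def
    by (auto intro!: derivative_eq_intros simp: power2_eq_square divide_simps) (simp add: algebra_simps)?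
  have contg': "continuous_on {0..b} g'"
    unfolding g'_def k_def using k_pos unfolding k_def
      by (intro continuous_intros) (auto simp: less_imp_neq[symmetric])
  have fg: "exp (- r) = - exp (- (s * r)) * k r * g r" if "r \<in> {0..b}" for r
    using k_pos[OF that] by (simp add: g_def exp_add[symmetric] algebra_simps)
  have "compact (g' ` {0..b})" by (intro compact_continuous_image contg') simp
  then obtain M where M: "\<And>r. r \<in> {0..b} \<Longrightarrow> \<bar>g' r\<bar> \<le> M"
    using compact_imp_bounded bounded_real by (metis imageI)
  define C where "C = \<bar>g b\<bar> + \<bar>g 0\<bar> + M * b"
  have "cmod (integral {0..b} (\<lambda>r. exp (- r) *\<^sub>R cis (\<rho> * f r))) \<le> C / \<rho>" if rho: "\<rho> > 0" for \<rho>
  proof -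
    have contf: "continuous_on {0..b} f" unfolding f_def by (intro continuous_intros)
    have D: "((\<lambda>r. g r *\<^sub>R cis (\<rho> * f r)) has_vector_derivative (\<i> * \<rho>) * (exp (- r) *\<^sub>R cis (\<rho> * f r))
        + g' r *\<^sub>R cis (\<rho> * f r)) (at r within {0..b})"
      if r: "r \<in> {0..b}" for r
    proof -
      have c: "((\<lambda>r. cis (\<rho> * f r)) has_vector_derivative (\<rho> * (- exp (- (s * r)) * k r)) *\<^sub>R (\<i> * cis (\<rho>
          * f r))) (at r within {0..b})"
      proof -
        have 1: "((\<lambda>r. \<rho> * f r) has_vector_derivative (\<rho> * (- exp (- (s * r)) * k r))) (at r within {0..b})"
          unfolding has_real_derivative_iff_has_vector_derivative[symmetric] by (rule DERIV_cmult[OF f'])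
        have 2: "(cis has_vector_derivative \<i> * cis x) (at x within S)" for x S
          unfolding cis_conv_exp by (auto intro!: derivative_eq_intros has_vector_derivative_real_field simp: mult_ac)
        from vector_diff_chain_within[OF 1 2] show ?thesis by (simp only: o_def)
      qed
      from has_vector_derivative_scaleR[OF g'[OF r] c] show ?thesis
        by (rule has_vector_derivative_eq_rhs) (simp add: fg[OF r] scaleR_conv_of_real mult_ac)
    qed
    have I1: "((\<lambda>r. (\<i> * \<rho>) * (exp (- r) *\<^sub>R cis (\<rho> * f r)) + g' r *\<^sub>R cis (\<rho> * f r)) has_integral
       g b *\<^sub>R cis (\<rho> * f b) - g 0 *\<^sub>R cis (\<rho> * f 0)) {0..b}"
      using b by (intro fundamental_theorem_of_calculus D) auto
    have I2: "((\<lambda>r. g' r *\<^sub>R cis (\<rho> * f r)) has_integral integral {0..b} (\<lambda>r. g' r *\<^sub>R cis (\<rho> * f r))) {0..b}"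
      by (intro integrable_integral integrable_continuous_real continuous_intros contg' contf)
    have "((\<lambda>r. (\<i> * \<rho>) * (exp (- r) *\<^sub>R cis (\<rho> * f r))) has_integral
       g b *\<^sub>R cis (\<rho> * f b) - g 0 *\<^sub>R cis (\<rho> * f 0) - integral {0..b} (\<lambda>r. g' r *\<^sub>R cis (\<rho> * f r))) {0..b}"
      using has_integral_diff[OF I1 I2] by (simp only: add_diff_cancel_right')
    moreover have "((\<lambda>r. (\<i> * \<rho>) * (exp (- r) *\<^sub>R cis (\<rho> * f r))) has_integral (\<i> * \<rho>)
        * integral {0..b} (\<lambda>r. exp (- r) *\<^sub>R cis (\<rho> * f r))) {0..b}"
      by (intro has_integral_mult_right integrable_integral integrable_continuous_real continuous_intros contf)
    ultimately have eq: "(\<i> * \<rho>) * integral {0..b} (\<lambda>r. exp (- r) *\<^sub>R cis (\<rho> * f r)) =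
       g b *\<^sub>R cis (\<rho> * f b) - g 0 *\<^sub>R cis (\<rho> * f 0) - integral {0..b} (\<lambda>r. g' r *\<^sub>R cis (\<rho> * f r))"
      by (rule has_integral_unique[symmetric])
    have "\<rho> * cmod (integral {0..b} (\<lambda>r. exp (- r) *\<^sub>R cis (\<rho> * f r))) =
       cmod (g b *\<^sub>R cis (\<rho> * f b) - g 0 *\<^sub>R cis (\<rho> * f 0) - integral {0..b} (\<lambda>r. g' r *\<^sub>R cis (\<rho> * f r)))"
      using rho by (simp only: norm_mult norm_of_real abs_of_pos norm_ii mult_1 flip: eq)
    also have "\<dots> \<le> cmod (g b *\<^sub>R cis (\<rho> * f b)) + cmod (g 0 *\<^sub>R cis (\<rho> * f 0))
        + cmod (integral {0..b} (\<lambda>r. g' r *\<^sub>R cis (\<rho> * f r)))"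
      by (metis (no_types, lifting) add_right_mono norm_triangle_ineq4 order_trans)
    also have "cmod (integral {0..b} (\<lambda>r. g' r *\<^sub>R cis (\<rho> * f r))) \<le> M * (b - 0)"
      using b M by (intro integral_bound continuous_intros contg' contf) auto
    finally have "\<rho> * cmod (integral {0..b} (\<lambda>r. exp (- r) *\<^sub>R cis (\<rho> * f r))) \<le> C" by (simp add: C_def)
    then show ?thesis using rho by (simp add: field_simps)
  qed
  then show ?thesis using that unfolding f_def b_def by blast
qed

context search_urn
begin

text \<open>The exponential lifetime moves a point along a logarithmic spiral. From a point on the positive real
  axis, the phase is monotone during a quarter turn, and it oscillates if the point is far from \<open>0\<close>.\<close>

definition spiral_char :: "complex \<Rightarrow> complex" where
  "spiral_char \<zeta> = (\<integral>e. cis (Re (\<zeta> * exp (- (l * of_real e)))) \<partial>expo)"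

lemma spiral_char_le_1: "cmod (spiral_char \<zeta>) \<le> 1"
  unfolding spiral_char_def by (rule expo.norm_integral_le_const) simp

text \<open>The spiral from \<open>\<zeta>\<close> meets the positive real axis within one turn, so
  its modulus has shrunk only by a bounded factor when it does.\<close>

lemma spiral_phase:
  assumes "\<zeta> \<noteq> 0"
  obtains s1 where "0 \<le> s1" "s1 \<le> 2 * pi / Im l" "\<zeta> * exp (- (l * of_real s1))
      = of_real (cmod \<zeta> * exp (- (Re l * s1)))"
proof -
  define s1 where "s1 = Arg2pi \<zeta> / Im l"
  have "\<zeta> * exp (- (l * of_real s1)) = of_real (cmod \<zeta>) * exp (\<i> * of_real (Arg2pi \<zeta>)) * exp (- (l * of_real s1))"
    using Arg2pi_eq[of \<zeta>] by simp
  also have "\<dots> = of_real (cmod \<zeta>) * exp (\<i> * of_real (Arg2pi \<zeta>) - l * of_real s1)"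
    by (simp add: exp_diff exp_minus field_simps)
  also have "\<i> * of_real (Arg2pi \<zeta>) - l * of_real s1 = of_real (- (Re l * s1))"
    using Im_pos by (auto simp: complex_eq_iff s1_def)
  also have "of_real (cmod \<zeta>) * exp (of_real (- (Re l * s1))) = (of_real (cmod \<zeta> * exp (- (Re l * s1))) :: complex)"
    by (simp only: exp_of_real of_real_mult)
  finally show ?thesis using Im_pos Arg2pi_ge_0[of \<zeta>] Arg2pi_lt_2pi[of \<zeta>]
    by (intro that[of s1]) (auto simp: s1_def divide_right_mono)
qed

text \<open>The quarter turn after the crossing time \<open>s1\<close> has probability at least
  \<open>2 * c\<close>. Oscillation reduces its contribution to at most \<open>c\<close> once
  \<open>\<rho>\<close> is large, and all other times contribute at most
  \<open>1 - 2 * c\<close>.\<close>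

lemma spiral_char_bound:
  obtains K c where "0 < c" "c \<le> 1" "K > 0" "\<And>\<zeta>. cmod \<zeta> \<ge> K \<Longrightarrow> cmod (spiral_char \<zeta>) \<le> 1 - c"
proof -
  define b where "b = pi / (2 * Im l)"
  define P where "P = 2 * pi / Im l"
  define c where "c = exp (- P) * (1 - exp (- b)) / 2"
  have b: "b > 0" "P > 0" using Im_pos by (auto simp: b_def P_def)
  have c: "0 < c" "c \<le> 1"
  proof -
    show "0 < c" using b by (simp add: c_def)
    have "exp (- P) * (1 - exp (- b)) \<le> 1 * 1" using b by (intro mult_mono) auto
    then show "c \<le> 1" by (simp add: c_def)
  qed
  obtain C where C: "\<And>\<rho>. \<rho> > 0 \<Longrightarrow> cmod (integral {0..b} (\<lambda>r. exp (- r) *\<^sub>R cis (\<rho> * (exp (- (Re l * r))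
      * cos (Im l * r))))) \<le> C / \<rho>"
    using oscillation_interval[OF Im_pos, of "Re l"] Re_half unfolding b_def by auto
  \<comment> \<open>The factor \<open>exp (Re l * P)\<close> compensates the contraction before the
    crossing, so that \<open>C / \<rho>\<close> is at most \<open>c\<close>.\<close>
  define K where "K = (\<bar>C\<bar> + 1) / c * exp (Re l * P)"
  have "K > 0" using c by (simp add: K_def)
  moreover have "cmod (spiral_char \<zeta>) \<le> 1 - c" if "cmod \<zeta> \<ge> K" for \<zeta>
  proof -
    have "\<zeta> \<noteq> 0" using that \<open>K > 0\<close> by auto
    obtain s1 where s1: "0 \<le> s1" "s1 \<le> P" "\<zeta> * exp (- (l * of_real s1)) = of_real (cmod \<zeta> * exp (- (Re l * s1)))"
      using spiral_phase[OF \<open>\<zeta> \<noteq> 0\<close>] unfolding P_def by blast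
    define \<rho> where "\<rho> = cmod \<zeta> * exp (- (Re l * s1))"
    have rho: "\<rho> > 0" using \<open>\<zeta> \<noteq> 0\<close> by (simp add: \<rho>_def)
    have Crho: "C / \<rho> \<le> c"
    proof -
      have "\<rho> \<ge> K * exp (- (Re l * P))"
        unfolding \<rho>_def using that s1 Re_half \<open>K > 0\<close> by (intro mult_mono) auto
      also have "K * exp (- (Re l * P)) = (\<bar>C\<bar> + 1) / c" using exp_not_eq_zero[of "Re l * P"]
        unfolding K_def exp_minus by (simp only: mult.assoc right_inverse mult_1_right not_False_eq_True)
      finally have "\<bar>C\<bar> + 1 \<le> \<rho> * c" using c by (simp add: field_simps)
      then show ?thesis using rho by (simp add: field_simps)
    qed
    let ?A = "{s1..s1 + b}"
    let ?h = "\<lambda>e. cis (Re (\<zeta> * exp (- (l * of_real e))))"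
    have h_eq: "?h s = cis (\<rho> * (exp (- (Re l * (s - s1))) * cos (Im l * (s - s1))))" for s
    proof -
      have "\<zeta> * exp (- (l * of_real s)) = \<zeta> * exp (- (l * of_real s1)) * exp (- (l * of_real (s - s1)))"
        by (simp add: mult.assoc exp_add[symmetric] algebra_simps)
      also have "\<dots> = of_real \<rho> * exp (- (l * of_real (s - s1)))" unfolding s1(3) \<rho>_def ..
      finally show ?thesis by (simp add: Re_exp)
    qed
    have conth: "continuous_on S ?h" for S by (intro continuous_intros)
    have int: "integrable expo ?h" by (rule integrable_expo_bounded[where B=1]) auto
    have intA: "integrable expo (\<lambda>e. indicator ?A e *\<^sub>R ?h e)"
      by (rule integrable_mult_indicator[OF _ int]) simp
    have intB: "integrable expo (\<lambda>e. indicator (- ?A) e *\<^sub>R ?h e)"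
      by (rule integrable_mult_indicator[OF _ int]) simp
    have "spiral_char \<zeta> = (\<integral>e. indicator ?A e *\<^sub>R ?h e + indicator (- ?A) e *\<^sub>R ?h e \<partial>expo)"
      unfolding spiral_char_def by (intro Bochner_Integration.integral_cong refl) (auto simp: indicator_def)
    also have "\<dots> = (\<integral>e. indicator ?A e *\<^sub>R ?h e \<partial>expo) + (\<integral>e. indicator (- ?A) e *\<^sub>R ?h e \<partial>expo)"
      by (rule Bochner_Integration.integral_add[OF intA intB])
    finally have "cmod (spiral_char \<zeta>) \<le> cmod (\<integral>e. indicator ?A e *\<^sub>R ?h e \<partial>expo)
        + cmod (\<integral>e. indicator (- ?A) e *\<^sub>R ?h e \<partial>expo)"
      by (simp only: norm_triangle_ineq)
    also have "cmod (\<integral>e. indicator ?A e *\<^sub>R ?h e \<partial>expo) \<le> c"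
    proof -
      have "(\<integral>e. indicator ?A e *\<^sub>R ?h e \<partial>expo) = (\<integral>e. exponential_density 1 e *\<^sub>R (indicator ?A e *\<^sub>R ?h e) \<partial>lborel)"
        unfolding expo_def by (subst integral_density) (auto simp: exponential_density_nonneg)
      also have "\<dots> = (LINT e:?A|lborel. exp (- e) *\<^sub>R ?h e)"
        unfolding set_lebesgue_integral_def using s1(1)
        by (intro Bochner_Integration.integral_cong refl) (auto simp: exponential_density_def indicator_def)
      also have "\<dots> = integral ?A (\<lambda>e. exp (- e) *\<^sub>R ?h e)"
      proof (rule set_borel_integral_eq_integral)
        show "set_integrable lborel ?A (\<lambda>e. exp (- e) *\<^sub>R ?h e)"
          unfolding set_integrable_def by (rule borel_integrable_compact) (intro continuous_intros conth compact_Icc)+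
      qed
      also have "\<dots> = integral {0..b} ((\<lambda>e. exp (- e) *\<^sub>R ?h e) \<circ> (+) s1)"
        using integral_shift_Icc_real[of 0 b "\<lambda>e. exp (- e) *\<^sub>R ?h e" s1] by (simp only: add_0_left add.commute)
      also have "\<dots> = integral {0..b} (\<lambda>r. exp (- s1) *\<^sub>R (exp (- r) *\<^sub>R cis (\<rho> * (exp (- (Re l * r))
          * cos (Im l * r)))))"
        unfolding h_eq by (simp add: o_def exp_add[symmetric] add.commute)
      also have "\<dots> = exp (- s1) *\<^sub>R integral {0..b} (\<lambda>r. (exp (- r) *\<^sub>R cis (\<rho> * (exp (- (Re l * r))
          * cos (Im l * r)))))"
        by (rule integral_cmul)
      finally have "cmod (\<integral>e. indicator ?A e *\<^sub>R ?h e \<partial>expo) =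
        exp (- s1) * cmod (integral {0..b} (\<lambda>r. (exp (- r) *\<^sub>R cis (\<rho> * (exp (- (Re l * r)) * cos (Im l * r))))))" by simp
      also have "\<dots> \<le> 1 * (C / \<rho>)" using s1 by (intro mult_mono C rho) auto
      finally show ?thesis using Crho by simp
    qed
    also have "cmod (\<integral>e. indicator (- ?A) e *\<^sub>R ?h e \<partial>expo) \<le> 1 - 2 * c"
    proof -
      have "cmod (\<integral>e. indicator (- ?A) e *\<^sub>R ?h e \<partial>expo) \<le> (\<integral>e. indicator (- ?A) e \<partial>expo)"
      proof (rule norm_integral_le_AE)
        show "integrable expo (\<lambda>e. indicat_real (- ?A) e)"
          by (rule expo.integrable_const_bound[where B=1]) auto
      qed (auto simp: indicator_def)
      also have "\<dots> = measure expo (space expo - ?A)" by (simp add: Compl_eq_Diff_UNIV)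
      also have "\<dots> = 1 - measure expo ?A" by (rule expo.prob_compl) simp
      finally have "cmod (\<integral>e. indicator (- ?A) e *\<^sub>R ?h e \<partial>expo) \<le> 1 - measure expo ?A" .
      moreover have "measure expo ?A \<ge> 2 * c"
      proof -
        have "2 * c \<le> exp (- s1) * (1 - exp (- b))" using s1 b by (simp add: c_def)
        also have "\<dots> = exp (- s1) - exp (- (s1 + b))" by (simp add: algebra_simps exp_add[symmetric])
        also have "\<dots> = measure expo {s1<..} - measure expo {s1 + b<..}" using s1 b
          by (simp add: measure_expo_greaterThan)
        also have "\<dots> = measure expo ({s1<..} - {s1 + b<..})"
          using b by (intro expo.finite_measure_Diff[symmetric]) auto
        also have "\<dots> \<le> measure expo ?A" by (intro expo.finite_measure_mono) auto
        finally show ?thesis .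
      qed
      ultimately show ?thesis by simp
    qed
    finally show ?thesis by simp
  qed
  ultimately show ?thesis using that c by blast
qed

end

section \<open>Single particles and their descendants\<close>

definition unit_state :: "nat \<Rightarrow> nat \<Rightarrow> int" where "unit_state k = (\<lambda>j. if j = k then 1 else 0)"
definition many :: "nat \<Rightarrow> nat \<Rightarrow> int" where "many n = (\<lambda>j. if j = 1 then int n else 0)"

lemma rate_unit: "k \<in> {1..m-1} \<Longrightarrow> rate m (unit_state k) = real k"
  by (simp add: rate_def unit_state_def if_distrib cong: if_cong)

lemma valid_unit: "k \<in> {1..m-1} \<Longrightarrow> valid m (unit_state k)"
  using rate_unit[of k m] by (auto simp: valid_def unit_state_def)

lemma rate_many: "m \<ge> 2 \<Longrightarrow> rate m (many n) = real n"
  by (simp add: rate_def many_def if_distrib cong: if_cong)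

lemma valid_many: "m \<ge> 2 \<Longrightarrow> n > 0 \<Longrightarrow> valid m (many n)"
  using rate_many[of m n] by (auto simp: valid_def many_def)

lemma many_Suc: "many (Suc n) = vadd (many n) (unit_state 1)"
  by (auto simp: many_def vadd_def unit_state_def)

lemma many_1: "many 1 = unit_state 1" by (auto simp: many_def unit_state_def)

lemma unit_jump: "k \<ge> 1 \<Longrightarrow> k \<le> m - 2 \<Longrightarrow> vadd (unit_state k) (wvec m k) = unit_state (Suc k)"
  by (auto simp: vadd_def unit_state_def wvec_def)

lemma unit_split: "m \<ge> 3 \<Longrightarrow> vadd (unit_state (m - 1)) (wvec m (m - 1)) = many m"
proof -
  assume m: "m \<ge> 3"
  then have "\<not> m - 1 \<le> m - 2" by simp
  with m show ?thesis by (auto simp: vadd_def unit_state_def wvec_def many_def fun_eq_iff)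
qed

lemma jump_prob_unit: "k \<in> {1..m-1} \<Longrightarrow> jump_prob m (unit_state k) j = (if j = k then 1 else 0)"
  by (simp add: jump_prob_def rate_unit) (simp add: unit_state_def)

text \<open>The infimum of the admissible \<open>B\<close> is the limit superior of
  \<open>|f|\<close> at infinity.\<close>

definition eventually_le :: "real \<Rightarrow> (complex \<Rightarrow> complex) \<Rightarrow> bool" where
  "eventually_le B f \<longleftrightarrow> (\<exists>K. \<forall>z. cmod z \<ge> K \<longrightarrow> cmod (f z) \<le> B)"

lemma eventually_le_mono: "eventually_le A f \<Longrightarrow> A \<le> B \<Longrightarrow> eventually_le B f"
  unfolding eventually_le_def by (meson order_trans)

context search_urn
begin

lemma phi_unit_step:
  assumes "k \<in> {1..m-1}"
  shows "phi (unit_state k) z = (\<integral>e. phi (vadd (unit_state k) (wvec m k)) (rot (e / real k) * z) \<partial>expo)"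
proof -
  have "(\<Sum>j=1..m-1. of_real (jump_prob m (unit_state k) j) * phi (vadd (unit_state k) (wvec m j)) y) =
      phi (vadd (unit_state k) (wvec m k)) y" for y
  proof -
    have "(\<Sum>j=1..m-1. of_real (jump_prob m (unit_state k) j) * phi (vadd (unit_state k) (wvec m j)) y) =
      (\<Sum>j=1..m-1. if j = k then phi (vadd (unit_state k) (wvec m j)) y else 0)"
      using assms by (intro sum.cong refl) (simp add: jump_prob_unit)
    also have "\<dots> = phi (vadd (unit_state k) (wvec m k)) y" using assms
      by (simp only: sum.delta finite_atLeastAtMost if_True)
    finally show ?thesis .
  qed
  then show ?thesis by (subst phi_step[OF valid_unit[OF assms]]) (simp only: rate_unit[OF assms])
qed

lemma phi_many: "n \<ge> 1 \<Longrightarrow> phi (many n) z = phi (unit_state 1) z ^ n"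
proof (induction n rule: nat_induct_at_least)
  case base
  show ?case by (simp only: many_1 power_one_right)
next
  case (Suc n)
  have "phi (many (Suc n)) z = phi (many n) z * phi (unit_state 1) z"
    unfolding many_Suc using m3 Suc by (intro phi_vadd valid_many valid_unit) auto
  then show ?case using Suc by simp
qed

lemma phi_unit_chain:
  assumes "k \<ge> 1" "k \<le> m - 2"
  shows "phi (unit_state k) z = (\<integral>e. phi (unit_state (Suc k)) (rot (e / real k) * z) \<partial>expo)"
  using phi_unit_step[of k z] assms unit_jump[OF assms] by (simp add: diff_le_mono2 order_trans)

lemma phi_unit_split:
  "phi (unit_state (m - 1)) z = (\<integral>e. phi (unit_state 1) (rot (e / real (m - 1)) * z) ^ m \<partial>expo)"
proof -
  have "m - 1 \<in> {1..m-1}" "1 \<le> m" using m3 by auto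
  then show ?thesis using phi_unit_step[of "m - 1" z] by (simp only: unit_split[OF m3] phi_many)
qed

text \<open>The mean \<open>u2 m l v\<close> is nonzero, so the limit cannot vanish almost surely,
  and some level \<open>\<eta>\<close> is reached with positive probability.\<close>

lemma W_not_AE_0:
  assumes v: "valid m v" and u: "u2 m l v \<noteq> 0"
  obtains \<eta> where "\<eta> > 0" "measure path_space {\<omega>. cmod (W v \<omega>) \<ge> \<eta>} > 0"
proof -
  have meas: "{\<omega>. cmod (W v \<omega>) \<ge> r} \<in> sets path_space" for r
  proof -
    have "Measurable.pred path_space (\<lambda>\<omega>. r \<le> cmod (W v \<omega>))" by measurable
    from predE[OF this] show ?thesis by simp
  qed
  have "\<exists>n. measure path_space {\<omega>. cmod (W v \<omega>) \<ge> inverse (real (Suc n))} > 0"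
  proof (rule ccontr)
    assume "\<not> ?thesis"
    then have z: "measure path_space {\<omega>. cmod (W v \<omega>) \<ge> inverse (real (Suc n))} = 0" for n
      by (meson measure_nonneg antisym not_less)
    have "AE \<omega> in path_space. \<not> cmod (W v \<omega>) \<ge> inverse (real (Suc n))" for n
      using z[of n] meas by (intro AE_I'[of "{\<omega>. cmod (W v \<omega>) \<ge> inverse (real (Suc n))}"])
        (auto simp: null_sets_def path_space.emeasure_eq_measure)
    then have "AE \<omega> in path_space. \<forall>n. \<not> cmod (W v \<omega>) \<ge> inverse (real (Suc n))"
      by (intro AE_all_countable[THEN iffD2] allI)
    then have "AE \<omega> in path_space. W v \<omega> = 0"
    proof eventually_elim
      case (elim \<omega>)
      show ?case
      proof (rule ccontr)
        assume "W v \<omega> \<noteq> 0"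
        then obtain n where "inverse (real (Suc n)) < cmod (W v \<omega>)" using reals_Archimedean[of "cmod (W v \<omega>)"] by auto
        with elim show False by (meson less_imp_le)
      qed
    qed
    then have "(\<integral>\<omega>. W v \<omega> \<partial>path_space) = 0" by (rule integral_eq_zero_AE)
    with u expectation_W[OF v] show False by simp
  qed
  then obtain n where "measure path_space {\<omega>. cmod (W v \<omega>) \<ge> inverse (real (Suc n))} > 0" by blast
  then show ?thesis by (intro that[of "inverse (real (Suc n))"]) auto
qed

text \<open>Given the later value of \<open>W (unit_state 2)\<close>, the lifetime of the initial
  particle contributes a factor \<open>spiral_char\<close>. That value has modulus at least
  \<open>\<eta>\<close> with probability \<open>p\<close>, and then the factor is at most
  \<open>1 - c\<close> for large \<open>z\<close>; this gives the bound
  \<open>1 - c * p\<close>.\<close>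

lemma phi_unit_1_eventually_lt_1: "\<exists>L<1. 0 \<le> L \<and> eventually_le L (phi (unit_state 1))"
proof -
  have k: "1 \<in> {1..m-1}" "2 \<in> {1..m-1}" using m3 by auto
  have "u2 m l (unit_state 2) = coef 2"
    unfolding u2_coef using k by (simp add: unit_state_def if_distrib cong: if_cong)
  also have "coef 2 = l + 1" using coef_rec[of 0] by (simp add: coef_1 numeral_2_eq_2)
  also have "\<dots> \<noteq> 0" using Re_half by (auto simp: complex_eq_iff)
  finally obtain \<eta> where eta: "\<eta> > 0" "measure path_space {\<omega>. cmod (W (unit_state 2) \<omega>) \<ge> \<eta>} > 0"
    by (rule W_not_AE_0[OF valid_unit[OF k(2)]])
  define p where "p = measure path_space {\<omega>. cmod (W (unit_state 2) \<omega>) \<ge> \<eta>}"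
  obtain K c where Kc: "0 < c" "c \<le> 1" "K > 0" "\<And>\<zeta>. cmod \<zeta> \<ge> K \<Longrightarrow> cmod (spiral_char \<zeta>) \<le> 1 - c"
    by (rule spiral_char_bound) blast
  have p: "0 < p" "p \<le> 1" using eta by (auto simp: p_def)
  interpret P: pair_sigma_finite expo path_space ..
  have bound: "cmod (phi (unit_state 1) z) \<le> 1 - c * p" if z: "cmod z \<ge> K / \<eta>" for z
  proof -
    let ?f = "\<lambda>e \<omega>. cis (Re (cnj (rot e * z) * W (unit_state 2) \<omega>))"
    interpret PP: pair_prob_space expo path_space ..
    have int: "integrable (expo \<Otimes>\<^sub>M path_space) (case_prod ?f)"
      by (rule PP.integrable_const_bound[where B=1]) (auto simp: split_beta')
    have "phi (unit_state 1) z = (\<integral>e. \<integral>\<omega>. ?f e \<omega> \<partial>path_space \<partial>expo)"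
      using phi_unit_chain[of 1 z] m3 by (simp add: phi_def numeral_2_eq_2)
    also have "\<dots> = (\<integral>\<omega>. \<integral>e. ?f e \<omega> \<partial>expo \<partial>path_space)"
      by (rule P.Fubini_integral[OF int, symmetric])
    also have "\<dots> = (\<integral>\<omega>. spiral_char (cnj z * W (unit_state 2) \<omega>) \<partial>path_space)"
      unfolding spiral_char_def rot_def by (simp only: complex_cnj_mult complex_cnj_cnj mult_ac)
    finally have eq: "phi (unit_state 1) z = (\<integral>\<omega>. spiral_char (cnj z * W (unit_state 2) \<omega>) \<partial>path_space)" .
    let ?A = "{\<omega>. cmod (W (unit_state 2) \<omega>) \<ge> \<eta>}"
    have "Measurable.pred path_space (\<lambda>\<omega>. \<eta> \<le> cmod (W (unit_state 2) \<omega>))" by measurable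
    from predE[OF this] have A: "?A \<in> sets path_space" by simp
    have iA: "integrable path_space (indicat_real ?A)"
      using A by (intro path_space.integrable_const_bound[where B=1]) auto
    have "cmod (phi (unit_state 1) z) \<le> (\<integral>\<omega>. 1 - c * indicator ?A \<omega> \<partial>path_space)"
      unfolding eq
    proof (rule norm_integral_le_AE)
      show "AE \<omega> in path_space. cmod (spiral_char (cnj z * W (unit_state 2) \<omega>)) \<le> 1 - c * indicator ?A \<omega>"
      proof (rule AE_I2)
        fix \<omega>
        show "cmod (spiral_char (cnj z * W (unit_state 2) \<omega>)) \<le> 1 - c * indicator ?A \<omega>"
        proof (cases "\<omega> \<in> ?A")
          case True
          have "K \<le> cmod z * \<eta>" using z eta by (simp add: field_simps)
          also have "\<dots> \<le> cmod z * cmod (W (unit_state 2) \<omega>)" using True by (intro mult_left_mono) auto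
          finally have "K \<le> cmod (cnj z * W (unit_state 2) \<omega>)" by (simp add: norm_mult)
          from Kc(4)[OF this] True show ?thesis by simp
        next
          case False
          then show ?thesis using spiral_char_le_1 by simp
        qed
      qed
    qed (use iA in simp)
    also have "\<dots> = 1 - c * p" using iA A by (simp add: p_def path_space.prob_space[simplified])
    finally show ?thesis .
  qed
  have "0 < c * p" "c * p \<le> 1" using Kc p by (auto intro: mult_le_one)
  then show ?thesis using bound by (intro exI[of _ "1 - c * p"]) (auto simp: eventually_le_def)
qed

text \<open>Except with probability at most \<open>\<epsilon>\<close>, the lifetime is at most
  \<open>e0\<close>; a spiral that starts far enough out is then still in the region where
  \<open>g\<close> is at most \<open>B\<close>.\<close>

lemma eventually_le_step:
  fixes f g :: "complex \<Rightarrow> complex"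
  assumes g: "eventually_le B g" "B \<ge> 0" "\<And>z. cmod (g z) \<le> 1" and k: "k > 0" and e: "\<epsilon> > 0"
    and f: "\<And>z. f z = (\<integral>e. g (rot (e / k) * z) \<partial>expo)"
  shows "eventually_le (B + \<epsilon>) f"
proof -
  obtain K where K: "\<And>z. cmod z \<ge> K \<Longrightarrow> cmod (g z) \<le> B" using g(1) unfolding eventually_le_def by blast
  define e0 where "e0 = max 0 (- ln \<epsilon>)"
  have e0: "e0 \<ge> 0" by (simp add: e0_def)
  have "exp (- e0) \<le> exp (ln \<epsilon>)" by (simp add: e0_def)
  then have e0': "exp (- e0) \<le> \<epsilon>" using e by simp
  have "cmod (f z) \<le> B + \<epsilon>" if z: "cmod z \<ge> \<bar>K\<bar> * exp (Re l * e0 / k)" for z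
  proof -
    have iA: "integrable expo (indicat_real {e0<..})" by (rule expo.integrable_const_bound[where B=1]) auto
    have "cmod (f z) \<le> (\<integral>e. B + indicator {e0<..} e \<partial>expo)"
      unfolding f
    proof (rule norm_integral_le_AE)
      show "AE e in expo. cmod (g (rot (e / k) * z)) \<le> B + indicator {e0<..} e"
      proof (rule AE_I2)
        fix e
        show "cmod (g (rot (e / k) * z)) \<le> B + indicator {e0<..} e"
        proof (cases "e > e0")
          case True
          then show ?thesis using g(3)[of "rot (e / k) * z"] g(2) by (simp add: add_increasing)
        next
          case False
          have "\<bar>K\<bar> = exp (- (Re l * e0 / k)) * (\<bar>K\<bar> * exp (Re l * e0 / k))" by (simp add: exp_minus)
          also have "\<dots> \<le> exp (- (Re l * (e / k))) * cmod z"
            using False Re_half k z by (intro mult_mono) (auto simp: divide_right_mono)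
          also have "\<dots> = cmod (rot (e / k) * z)" by (simp add: norm_mult cmod_rot)
          finally have "K \<le> cmod (rot (e / k) * z)" by linarith
          from K[OF this] False show ?thesis by simp
        qed
      qed
    qed (use iA in simp)
    also have "\<dots> = B + exp (- e0)"
      using iA e0 by (simp add: measure_expo_greaterThan expo.prob_space[simplified])
    finally show ?thesis using e0' by simp
  qed
  then show ?thesis unfolding eventually_le_def by blast
qed

lemma eventually_le_power:
  assumes "eventually_le B (phi (unit_state 1))" "B \<ge> 0" "\<epsilon> > 0"
  shows "eventually_le (B ^ m + \<epsilon>) (phi (unit_state 1))"
proof -
  have "eventually_le (B ^ m) (\<lambda>z. phi (unit_state 1) z ^ m)"
    using assms(1) unfolding eventually_le_def by (auto simp: norm_power intro!: power_mono)
  \<comment> \<open>Here \<open>j\<close> counts colours down from \<open>m - 1\<close>, the one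
    that splits. Every passage to the preceding colour costs an arbitrarily small amount, hence the
    quantifier over \<open>\<epsilon>\<close> inside the induction.\<close>
  have "\<forall>\<epsilon>>0. eventually_le (B ^ m + \<epsilon>) (phi (unit_state (m - 1 - j)))" if "j < m - 1" for j
    using that
  proof (induction j)
    case 0
    show ?case
    proof (intro allI impI)
      fix \<epsilon> :: real assume "\<epsilon> > 0"
      show "eventually_le (B ^ m + \<epsilon>) (phi (unit_state (m - 1 - 0)))"
        unfolding diff_zero
        by (rule eventually_le_step[OF \<open>eventually_le (B ^ m) _\<close> _ _ _ \<open>\<epsilon> > 0\<close> phi_unit_split])
          (use assms m3 in \<open>auto simp: norm_power power_le_one cmod_phi_le_1\<close>)
    qed
  next
    case (Suc j)
    let ?k = "m - 1 - Suc j"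
    have k: "?k \<ge> 1" "?k \<le> m - 2" "Suc ?k = m - 1 - j" using Suc.prems by auto
    show ?case
    proof (intro allI impI)
      fix \<epsilon> :: real assume "\<epsilon> > 0"
      then have "eventually_le (B ^ m + \<epsilon> / 2) (phi (unit_state (Suc ?k)))" using Suc k(3) by simp
      moreover have "B ^ m + \<epsilon> / 2 \<ge> 0" using assms(2) \<open>\<epsilon> > 0\<close> by (simp add: add_nonneg_nonneg)
      moreover have "real ?k > 0" "\<epsilon> / 2 > 0" using k \<open>\<epsilon> > 0\<close> by auto
      ultimately have "eventually_le (B ^ m + \<epsilon> / 2 + \<epsilon> / 2) (phi (unit_state ?k))"
        by (intro eventually_le_step[OF _ _ cmod_phi_le_1 _ _ phi_unit_chain[OF k(1,2)]])
      then show "eventually_le (B ^ m + \<epsilon>) (phi (unit_state ?k))"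
        by (simp only: add.assoc field_sum_of_halves)
    qed
  qed
  from this[of "m - 2"] show ?thesis using m3 assms(3) by (simp add: numeral_2_eq_2)
qed

text \<open>The infimum \<open>i\<close> of the bounds valid near infinity satisfies
  \<open>i <= i ^ m\<close> by \<open>eventually_le_power\<close>, and \<open>i < 1\<close>, so
  \<open>i = 0\<close>.\<close>

lemma phi_unit_1_vanishes:
  assumes "\<epsilon> > 0"
  shows "eventually_le \<epsilon> (phi (unit_state 1))"
proof -
  define S where "S = {B. 0 \<le> B \<and> eventually_le B (phi (unit_state 1))}"
  obtain L where L: "L < 1" "L \<in> S" using phi_unit_1_eventually_lt_1 unfolding S_def by blast
  have bdd: "bdd_below S" unfolding S_def by (rule bdd_belowI[of _ 0]) auto
  define i where "i = Inf S"
  have i0: "i \<ge> 0" unfolding i_def using L by (intro cInf_greatest) (auto simp: S_def)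
  have i1: "i < 1" using cInf_lower[OF L(2) bdd] L(1) by (simp add: i_def)
  have above: "B \<in> S" if B: "B > i" for B
  proof -
    obtain A where "A \<in> S" "A < B" using cInf_lessD[of S B] B L(2) by (auto simp: i_def)
    then show ?thesis using i0 B by (auto simp: S_def intro: eventually_le_mono)
  qed
  have "i = 0"
  proof (rule ccontr)
    assume "i \<noteq> 0"
    then have "i > 0" using i0 by simp
    have "i ^ m < i ^ 1" using \<open>i > 0\<close> i1 m3 by (intro power_strict_decreasing) auto
    then have lt: "i ^ m < i" by simp
    have "((\<lambda>x. x ^ m) \<longlongrightarrow> i ^ m) (at_right i)" by (intro tendsto_intros)
    then have "\<forall>\<^sub>F x in at_right i. x ^ m < i" using lt by (rule order_tendstoD)
    moreover have "\<forall>\<^sub>F x in at_right i. x > i" by (simp add: eventually_at_filter)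
    ultimately have "\<forall>\<^sub>F x in at_right i. x ^ m < i \<and> x > i" by eventually_elim simp
    then obtain x where x: "x ^ m < i" "x > i" using eventually_happens'[OF trivial_limit_at_right_real] by blast
    from above[OF x(2)] have "eventually_le x (phi (unit_state 1))" "x \<ge> 0" by (auto simp: S_def)
    from eventually_le_power[OF this, of "(i - x ^ m) / 2"] x
    have "eventually_le ((i + x ^ m) / 2) (phi (unit_state 1))" by (simp add: field_simps)
    moreover have "(i + x ^ m) / 2 \<ge> 0" using i0 \<open>x \<ge> 0\<close> by simp
    ultimately have "(i + x ^ m) / 2 \<in> S" by (simp add: S_def)
    then have "i \<le> (i + x ^ m) / 2" unfolding i_def using bdd by (rule cInf_lower)
    with x show False by simp
  qed
  then show ?thesis using above[of \<epsilon>] assms by (simp add: S_def)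
qed

text \<open>The factor \<open>exp (a * Re l * e / k)\<close> undoes the contraction of
  \<open>cmod z powr a\<close>, and its mean is finite because \<open>a * Re l < 1\<close>. Spirals
  move inwards, so a bound for \<open>g\<close> on the disc of radius \<open>R\<close> is
  enough.\<close>

lemma decay_step:
  fixes f g :: "complex \<Rightarrow> complex"
  assumes a: "a > 0" "a * Re l < 1" and k: "k \<ge> 1" and f: "\<And>z. f z = (\<integral>e. g (rot (e / k) * z) \<partial>expo)"
    and B: "\<And>z. cmod z \<le> R \<Longrightarrow> cmod (g z) * cmod z powr a \<le> B" "B \<ge> 0"
    and z: "cmod z \<le> R"
  shows "cmod (f z) * cmod z powr a \<le> B / (1 - a * Re l)"
proof -
  have s: "a * Re l / k < 1" "- (a * Re l / k) > -1" "1 - a * Re l \<le> 1 - a * Re l / k"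
  proof -
    have "a * Re l / k \<le> a * Re l / 1" using a k Re_half by (intro divide_left_mono) auto
    with a show "a * Re l / k < 1" "- (a * Re l / k) > -1" "1 - a * Re l \<le> 1 - a * Re l / k" by auto
  qed
  have int: "has_bochner_integral expo (\<lambda>e. exp (- (- (a * Re l / k)) * e)) (1 / (1 + - (a * Re l / k)))"
    using s by (intro has_bochner_integral_nn_integral nn_integral_expo_exp) auto
  have int': "has_bochner_integral expo (\<lambda>e. B * exp (- (- (a * Re l / k)) * e)) (B * (1 / (1 + - (a * Re l / k))))"
    by (rule has_bochner_integral_mult_right[OF int])
  have "cmod (f z) * cmod z powr a = cmod (\<integral>e. g (rot (e / k) * z) * of_real (cmod z powr a) \<partial>expo)"
    unfolding f by (simp add: norm_mult)
  also have "\<dots> \<le> (\<integral>e. B * exp (- (- (a * Re l / k)) * e) \<partial>expo)"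
  proof (rule norm_integral_le_AE)
    show "integrable expo (\<lambda>e. B * exp (- (- (a * Re l / k)) * e))" using int' by (simp add: has_bochner_integral_iff)
    show "AE e in expo. cmod (g (rot (e / k) * z) * of_real (cmod z powr a)) \<le> B * exp (- (- (a * Re l / k)) * e)"
      using AE_expo_pos
    proof eventually_elim
      case (elim e)
      let ?y = "rot (e / k) * z"
      have n: "cmod ?y = exp (- (Re l * (e / k))) * cmod z" by (simp add: norm_mult cmod_rot)
      have "cmod ?y \<le> 1 * cmod z" unfolding n using elim k Re_half by (intro mult_right_mono) auto
      then have "cmod ?y \<le> R" using z by simp
      then have "cmod (g ?y) * cmod ?y powr a \<le> B" by (rule B)
      moreover have "cmod ?y powr a = exp (- (a * Re l / k) * e) * cmod z powr a"
        unfolding n by (simp add: powr_mult exp_powr_real mult_ac)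
      ultimately have "exp (- (- (a * Re l / k)) * e) * (cmod (g ?y) * (exp (- (a * Re l / k) * e)
          * cmod z powr a)) \<le> exp (- (- (a * Re l / k)) * e) * B"
        by (intro mult_left_mono) auto
      moreover have "exp (- (- (a * Re l / k)) * e) * exp (- (a * Re l / k) * e) = 1"
        by (simp add: exp_add[symmetric])
      then have "exp (- (- (a * Re l / k)) * e) * (G * (exp (- (a * Re l / k) * e) * Z)) = G * Z" for G Z
        by (metis mult.assoc mult.left_commute mult_1)
      ultimately show ?case by (simp only: norm_mult norm_of_real abs_of_nonneg[OF powr_ge_zero] mult.commute[of B])
    qed
  qed
  also have "\<dots> = B * (1 / (1 + - (a * Re l / k)))" by (rule has_bochner_integral_integral_eq[OF int'])
  also have "\<dots> \<le> B / (1 - a * Re l)" using s a B(2) by (simp add: frac_le)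
  finally show ?thesis .
qed

text \<open>On a disc of radius \<open>R\<close> the trivial bound \<open>R powr a\<close> is
  finite. One round through the colours improves a bound \<open>B\<close> to
  \<open>M / 2 + B / 2\<close>, with \<open>M\<close> independent of the disc, because far out one
  of the m factors of the power is at most \<open>\<delta>\<close>. Iteration leaves
  \<open>M\<close>.\<close>

lemma phi_unit_1_decay:
  assumes a: "a > 0" "a * Re l < 1"
  obtains M where "M \<ge> 0" "\<And>z. cmod (phi (unit_state 1) z) * cmod z powr a \<le> M"
proof -
  define c where "c = 1 / (1 - a * Re l)"
  have c: "c \<ge> 1" using a Re_half by (simp add: c_def)
  \<comment> \<open>Each of the \<open>m - 1\<close> averaging steps costs a factor
    \<open>c\<close>; this value makes \<open>\<delta> * c ^ (m - 1) = 1/2\<close>.\<close>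
  define \<delta> where "\<delta> = 1 / (2 * c ^ (m - 1))"
  have cm: "c ^ (m - 1) \<ge> 1" using c by (rule one_le_power)
  have d: "\<delta> > 0" "\<delta> \<le> 1" using cm by (auto simp: \<delta>_def field_simps)
  obtain K where K: "\<And>z. cmod z \<ge> K \<Longrightarrow> cmod (phi (unit_state 1) z) \<le> \<delta>"
    using phi_unit_1_vanishes[OF d(1)] unfolding eventually_le_def by blast
  define M where "M = 2 * c ^ (m - 1) * \<bar>K\<bar> powr a"
  have M0: "M \<ge> 0" using cm by (simp add: M_def)
  let ?P = "\<lambda>R B f. \<forall>z. cmod z \<le> R \<longrightarrow> cmod (f z) * cmod z powr a \<le> B"
  have improve: "?P R (M / 2 + B / 2) (phi (unit_state 1))" if B: "?P R B (phi (unit_state 1))" "B \<ge> 0" for R B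
  proof -
    let ?B = "\<bar>K\<bar> powr a + \<delta> * B"
    have B0: "?B \<ge> 0" using d B by simp
    have base: "?P R ?B (\<lambda>z. phi (unit_state 1) z ^ m)"
    proof (intro allI impI)
      fix z assume z: "cmod z \<le> R"
      have m': "cmod (phi (unit_state 1) z ^ m) \<le> cmod (phi (unit_state 1) z) * cmod (phi (unit_state 1) z)"
      proof -
        have "cmod (phi (unit_state 1) z) ^ m \<le> cmod (phi (unit_state 1) z) ^ 2"
          using m3 cmod_phi_le_1 by (intro power_decreasing) auto
        then show ?thesis by (simp add: norm_power power2_eq_square)
      qed
      show "cmod (phi (unit_state 1) z ^ m) * cmod z powr a \<le> ?B"
      proof (cases "cmod z \<ge> K")
        case True
        have "cmod (phi (unit_state 1) z ^ m) \<le> \<delta> * cmod (phi (unit_state 1) z)"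
          using m' mult_right_mono[OF K[OF True], of "cmod (phi (unit_state 1) z)"] by simp
        then have "cmod (phi (unit_state 1) z ^ m) * cmod z powr a
            \<le> \<delta> * (cmod (phi (unit_state 1) z) * cmod z powr a)"
          by (subst mult.assoc[symmetric]) (rule mult_right_mono, auto)
        also have "\<dots> \<le> \<delta> * B" using B z d by (intro mult_left_mono) auto
        finally show ?thesis using powr_ge_zero[of "\<bar>K\<bar>" a] by linarith
      next
        case False
        have "cmod (phi (unit_state 1) z ^ m) * cmod z powr a \<le> 1 * \<bar>K\<bar> powr a"
          using False a by (intro mult_mono powr_mono2) (auto simp: norm_power power_le_one cmod_phi_le_1)
        moreover have "\<delta> * B \<ge> 0" using d B by simp
        ultimately show ?thesis by simp
      qed
    qed
    have "?P R (?B * c ^ (Suc j)) (phi (unit_state (m - 1 - j)))" if "j < m - 1" for j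
      using that
    proof (induction j)
      case 0
      show ?case
      proof (intro allI impI)
        fix z assume z: "cmod z \<le> R"
        have "cmod (phi (unit_state (m - 1)) z) * cmod z powr a \<le> ?B / (1 - a * Re l)"
          using base B0 m3 by (intro decay_step[OF a _ phi_unit_split _ _ z]) auto
        then show "cmod (phi (unit_state (m - 1 - 0)) z) * cmod z powr a \<le> ?B * c ^ Suc 0" by (simp add: c_def)
      qed
    next
      case (Suc j)
      let ?k = "m - 1 - Suc j"
      have k: "?k \<ge> 1" "?k \<le> m - 2" "Suc ?k = m - 1 - j" using Suc.prems by auto
      have IH: "?P R (?B * c ^ Suc j) (phi (unit_state (Suc ?k)))" unfolding k(3) using Suc by simp
      show ?case
      proof (intro allI impI)
        fix z assume z: "cmod z \<le> R"
        have "cmod (phi (unit_state ?k) z) * cmod z powr a \<le> (?B * c ^ Suc j) / (1 - a * Re l)"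
          using IH B0 k c by (intro decay_step[OF a _ phi_unit_chain[OF k(1,2)] _ _ z]) auto
        then show "cmod (phi (unit_state ?k) z) * cmod z powr a \<le> ?B * c ^ Suc (Suc j)" by (simp add: c_def mult_ac)
      qed
    qed
    from this[of "m - 2"] have "?P R (?B * c ^ (m - 1)) (phi (unit_state 1))"
      using m3 by (simp add: Suc_diff_Suc numeral_2_eq_2)
    moreover have "(x + 1 / (2 * N) * B) * N = 2 * N * x / 2 + B / 2" if "N \<ge> 1" for N x :: real
      using that by (simp add: field_simps)
    from this[OF cm] have "?B * c ^ (m - 1) = M / 2 + B / 2" unfolding M_def \<delta>_def .
    ultimately show ?thesis by simp
  qed
  have "cmod (phi (unit_state 1) z) * cmod z powr a \<le> M" for z
  proof -
    let ?R = "cmod z"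
    have "?P ?R (M + ?R powr a / 2 ^ n) (phi (unit_state 1))" for n
    proof (induction n)
      case 0
      show ?case
      proof (intro allI impI)
        fix y assume "cmod y \<le> ?R"
        then have "cmod (phi (unit_state 1) y) * cmod y powr a \<le> 1 * ?R powr a"
          using a by (intro mult_mono cmod_phi_le_1 powr_mono2) auto
        then show "cmod (phi (unit_state 1) y) * cmod y powr a \<le> M + ?R powr a / 2 ^ 0" using M0 by simp
      qed
    next
      case (Suc n)
      have "M + ?R powr a / 2 ^ n \<ge> 0" using M0 by simp
      from improve[OF Suc this] show ?case by (simp add: field_simps)
    qed
    then have "cmod (phi (unit_state 1) z) * cmod z powr a \<le> M + ?R powr a / 2 ^ n" for n by simp
    moreover have "(\<lambda>n. M + ?R powr a / 2 ^ n) \<longlonglongrightarrow> M + 0"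
      by (intro tendsto_add tendsto_const) real_asymp
    ultimately show ?thesis by (intro LIMSEQ_le_const[of _ "M + 0", simplified]) auto
  qed
  then show ?thesis using M0 that by blast
qed

end

section \<open>The law charges no null set\<close>

lemma norm_integral_le_nn_integral:
  fixes f :: "'a \<Rightarrow> 'b::{banach, second_countable_topology}"
  shows "ennreal (norm (\<integral>x. f x \<partial>M)) \<le> (\<integral>\<^sup>+x. ennreal (norm (f x)) \<partial>M)"
proof (cases "integrable M f")
  case True
  then show ?thesis by (rule integral_norm_bound_ennreal)
qed (simp add: not_integrable_integral_eq)

lemma sets_Collect_in:
  assumes "X \<in> measurable M N" "A \<in> sets N"
  shows "{\<omega> \<in> space M. X \<omega> \<in> A} \<in> sets M"
  using measurable_sets[OF assms] by (simp add: vimage_def Int_def conj_commute)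

section \<open>Gaussian smoothing of characteristic functions in the plane\<close>

definition cchar :: "'a measure \<Rightarrow> ('a \<Rightarrow> complex) \<Rightarrow> complex \<Rightarrow> complex" where
  "cchar M X t = (\<integral>\<omega>. cis (Re (cnj t * X \<omega>)) \<partial>M)"

abbreviation "gauss \<equiv> density lborel std_normal_density"

definition gauss2 :: "complex measure" where
  "gauss2 = distr (gauss \<Otimes>\<^sub>M gauss) borel (\<lambda>(s, u). Complex s u)"

interpretation gauss: prob_space gauss
  by (rule prob_space_normal_density) simp

interpretation gauss_pair: pair_prob_space gauss gauss ..

lemma measurable_Complex[measurable (raw)]:
  "f \<in> borel_measurable M \<Longrightarrow> g \<in> borel_measurable M \<Longrightarrow> (\<lambda>x. Complex (f x) (g x)) \<in> borel_measurable M"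
  by (simp add: borel_measurable_complex_iff)

interpretation gauss2: prob_space gauss2
  unfolding gauss2_def by (rule gauss_pair.prob_space_distr) simp

lemma sets_gauss2[measurable_cong, simp]: "sets gauss2 = sets borel" by (simp add: gauss2_def)

lemma gauss_char: "(\<integral>s. cis (s * a) \<partial>gauss) = of_real (exp (- (a\<^sup>2) / 2))"
proof -
  have "char gauss a = (\<integral>s. cis (s * a) \<partial>gauss)"
    unfolding char_def by (simp add: cis_conv_exp mult_ac)
  then show ?thesis by (simp add: char_std_normal_distribution)
qed

lemma gauss2_char: "(\<integral>t. cis (Re (cnj t * y)) \<partial>gauss2) = of_real (exp (- ((cmod y)\<^sup>2) / 2))"
proof -
  have int: "integrable (gauss \<Otimes>\<^sub>M gauss) (\<lambda>p. cis (fst p * Re y) * cis (snd p * Im y))"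
    by (rule gauss_pair.integrable_const_bound[where B=1]) (auto simp: norm_mult)
  have "(\<integral>t. cis (Re (cnj t * y)) \<partial>gauss2) = (\<integral>p. cis (fst p * Re y) * cis (snd p * Im y) \<partial>(gauss \<Otimes>\<^sub>M gauss))"
    unfolding gauss2_def by (subst integral_distr) (auto simp: split_beta' cis_mult)
  also have "\<dots> = (\<integral>s. \<integral>u. cis (s * Re y) * cis (u * Im y) \<partial>gauss \<partial>gauss)"
    using gauss_pair.integral_fst'[OF int] by simp
  also have "\<dots> = of_real (exp (- ((Re y)\<^sup>2) / 2)) * of_real (exp (- ((Im y)\<^sup>2) / 2))"
    by (simp add: gauss_char)
  also have "\<dots> = of_real (exp (- ((cmod y)\<^sup>2) / 2))"
    by (simp add: cmod_power2 exp_add[symmetric] of_real_mult[symmetric] add_divide_distrib del: of_real_mult)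
  finally show ?thesis .
qed

text \<open>The Gaussian weight is itself a characteristic function (\<open>gauss2_char\<close>), so
  Fubini's theorem expresses its mean through the characteristic function of \<open>X\<close>. This
  serves as inversion formula in \<open>same_char_support\<close> and in
  \<open>ball_bound\<close>.\<close>

lemma (in prob_space) gauss_average:
  fixes X :: "'a \<Rightarrow> complex"
  assumes [measurable]: "X \<in> borel_measurable M" and e: "e > 0"
  shows "of_real (\<integral>\<omega>. exp (- ((cmod (X \<omega> - x) / e)\<^sup>2) / 2) \<partial>M) =
    (\<integral>t. cis (- Re (cnj (t / of_real e) * x)) * cchar M X (t / of_real e) \<partial>gauss2)"
proof -
  interpret P: pair_prob_space gauss2 M ..
  let ?f = "\<lambda>t \<omega>. cis (Re (cnj t * ((X \<omega> - x) / of_real e)))"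
  have int: "integrable (gauss2 \<Otimes>\<^sub>M M) (case_prod ?f)"
    by (rule P.integrable_const_bound[where B=1]) (auto simp: split_beta')
  have "of_real (\<integral>\<omega>. exp (- ((cmod (X \<omega> - x) / e)\<^sup>2) / 2) \<partial>M) = (\<integral>\<omega>. \<integral>t. ?f t \<omega> \<partial>gauss2 \<partial>M)"
    unfolding gauss2_char using e by (simp add: norm_divide)
  also have "\<dots> = (\<integral>t. \<integral>\<omega>. ?f t \<omega> \<partial>M \<partial>gauss2)"
    by (rule P.Fubini_integral[OF int])
  also have "\<dots> = (\<integral>t. cis (- Re (cnj (t / of_real e) * x)) * cchar M X (t / of_real e) \<partial>gauss2)"
  proof (intro Bochner_Integration.integral_cong refl)
    fix t
    have "?f t \<omega> = cis (- Re (cnj (t / of_real e) * x)) * cis (Re (cnj (t / of_real e) * X \<omega>))" for \<omega>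
    proof -
      have "cnj t * ((X \<omega> - x) / of_real e) = cnj (t / of_real e) * X \<omega> - cnj (t / of_real e) * x"
        by (simp add: diff_divide_distrib right_diff_distrib)
      then show ?thesis by (simp only: cis_mult) simp
    qed
    then show "(\<integral>\<omega>. ?f t \<omega> \<partial>M) = cis (- Re (cnj (t / of_real e) * x)) * cchar M X (t / of_real e)"
      unfolding cchar_def by (simp only: integral_mult_right_zero)
  qed
  finally show ?thesis .
qed

lemma (in prob_space) integrable_gauss_weight:
  fixes X :: "'a \<Rightarrow> complex"
  assumes [measurable]: "X \<in> borel_measurable M"
  shows "integrable M (\<lambda>\<omega>. exp (- ((cmod (X \<omega> - x) / e)\<^sup>2) / 2))"
  by (rule integrable_const_bound[where B=1]) auto

lemma (in prob_space) gauss_average_lower: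
  fixes X :: "'a \<Rightarrow> complex"
  assumes [measurable]: "X \<in> borel_measurable M" and e: "e > 0" and d: "d > 0"
  shows "exp (- ((d / e)\<^sup>2) / 2) * prob {\<omega> \<in> space M. X \<omega> \<in> cball x d}
      \<le> (\<integral>\<omega>. exp (- ((cmod (X \<omega> - x) / e)\<^sup>2) / 2) \<partial>M)"
proof -
  let ?A = "{\<omega> \<in> space M. X \<omega> \<in> cball x d}"
  have [measurable]: "cball x d \<in> sets borel" by simp
  have A: "?A \<in> sets M" by measurable
  have iA: "integrable M (indicat_real ?A)" using A by (intro integrable_const_bound[where B=1]) auto
  have "exp (- ((d / e)\<^sup>2) / 2) * prob ?A = (\<integral>\<omega>. exp (- ((d / e)\<^sup>2) / 2) * indicator ?A \<omega> \<partial>M)"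
    using iA A by simp
  also have "\<dots> \<le> (\<integral>\<omega>. exp (- ((cmod (X \<omega> - x) / e)\<^sup>2) / 2) \<partial>M)"
  proof (rule integral_mono)
    fix \<omega> assume "\<omega> \<in> space M"
    show "exp (- ((d / e)\<^sup>2) / 2) * indicator ?A \<omega> \<le> exp (- ((cmod (X \<omega> - x) / e)\<^sup>2) / 2)"
    proof (cases "\<omega> \<in> ?A")
      case True
      then have "cmod (X \<omega> - x) / e \<le> d / e" using e
        by (intro divide_right_mono) (auto simp: dist_norm norm_minus_commute)
      then have "(cmod (X \<omega> - x) / e)\<^sup>2 \<le> (d / e)\<^sup>2" using e by (intro power_mono) auto
      then show ?thesis using True by simp
    qed simp
  qed (use iA integrable_gauss_weight in auto)
  finally show ?thesis .
qed

text \<open>At width \<open>r / sqrt n\<close> both variables have the same Gaussian mean. For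
  \<open>Y\<close> it is at least \<open>p * exp (- n / 8)\<close>, where \<open>p\<close> is the
  mass of the disc of radius \<open>r / 2\<close>; if \<open>X\<close> avoids the disc of radius
  \<open>r\<close>, it is at most \<open>exp (- n / 2)\<close>. For large n this contradicts
  \<open>p > 0\<close>.\<close>

lemma same_char_support:
  fixes X :: "'a \<Rightarrow> complex" and Y :: "'b \<Rightarrow> complex"
  assumes M: "prob_space M" and N: "prob_space N"
    and X[measurable]: "X \<in> borel_measurable M" and Y[measurable]: "Y \<in> borel_measurable N"
    and eq: "\<And>t. cchar M X t = cchar N Y t"
    and pos: "\<And>r. r > 0 \<Longrightarrow> measure N {\<omega> \<in> space N. Y \<omega> \<in> ball x r} > 0" and r: "r > 0"
  shows "measure M {\<omega> \<in> space M. X \<omega> \<in> ball x r} > 0"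
proof (rule ccontr)
  interpret M: prob_space M by fact
  interpret N: prob_space N by fact
  assume "\<not> ?thesis"
  then have 0: "M.prob {\<omega> \<in> space M. X \<omega> \<in> ball x r} = 0" by (meson measure_nonneg antisym not_less)
  define p where "p = N.prob {\<omega> \<in> space N. Y \<omega> \<in> cball x (r / 2)}"
  have "N.prob {\<omega> \<in> space N. Y \<omega> \<in> ball x (r / 2)} \<le> p"
    unfolding p_def by (intro N.finite_measure_mono) auto
  with pos[of "r / 2"] r have p: "p > 0" by simp
  have AE: "AE \<omega> in M. cmod (X \<omega> - x) \<ge> r"
  proof -
    have "AE \<omega> in M. \<omega> \<notin> {\<omega> \<in> space M. X \<omega> \<in> ball x r}"
      using 0 by (intro AE_not_in) (auto simp: null_sets_def M.emeasure_eq_measure)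
    then show ?thesis using AE_space by eventually_elim (auto simp: dist_norm norm_minus_commute)
  qed
  have le: "p \<le> exp (- (3 / 8 * real n))" if n: "n > 0" for n :: nat
  proof -
    define e where "e = r / sqrt (real n)"
    have e: "e > 0" using r n by (simp add: e_def)
    have re: "(r / e)\<^sup>2 = real n" "(r / 2 / e)\<^sup>2 = real n / 4" using r n by (auto simp: e_def power_divide)
    have "exp (- ((r / 2 / e)\<^sup>2) / 2) * p \<le> (\<integral>\<omega>. exp (- ((cmod (Y \<omega> - x) / e)\<^sup>2) / 2) \<partial>N)"
      unfolding p_def using r by (intro N.gauss_average_lower e) auto
    also have "\<dots> = (\<integral>\<omega>. exp (- ((cmod (X \<omega> - x) / e)\<^sup>2) / 2) \<partial>M)"
    proof -
      have "complex_of_real (\<integral>\<omega>. exp (- ((cmod (Y \<omega> - x) / e)\<^sup>2) / 2) \<partial>N)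
          = of_real (\<integral>\<omega>. exp (- ((cmod (X \<omega> - x) / e)\<^sup>2) / 2) \<partial>M)"
        unfolding N.gauss_average[OF Y e] M.gauss_average[OF X e] eq ..
      then show ?thesis by (simp only: of_real_eq_iff)
    qed
    also have "\<dots> \<le> (\<integral>\<omega>. exp (- ((r / e)\<^sup>2) / 2) \<partial>M)"
    proof (rule integral_mono_AE)
      show "AE \<omega> in M. exp (- ((cmod (X \<omega> - x) / e)\<^sup>2) / 2) \<le> exp (- ((r / e)\<^sup>2) / 2)"
        using AE
      proof eventually_elim
        case (elim \<omega>)
        then have "r / e \<le> cmod (X \<omega> - x) / e" using e by (intro divide_right_mono) auto
        then have "(r / e)\<^sup>2 \<le> (cmod (X \<omega> - x) / e)\<^sup>2" using e r by (intro power_mono) auto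
        then show ?case by simp
      qed
    qed (use M.integrable_gauss_weight in auto)
    also have "\<dots> = exp (- (real n / 2))" unfolding re by (simp add: M.prob_space)
    finally have "exp (real n / 8) * (exp (- (real n / 8)) * p) \<le> exp (real n / 8) * exp (- (real n / 2))"
      unfolding re by (intro mult_left_mono) auto
    then show ?thesis by (simp add: mult.assoc[symmetric] exp_add[symmetric])
  qed
  have "(\<lambda>n::nat. exp (- (3 / 8 * real n))) \<longlonglongrightarrow> 0" by real_asymp
  then have "p \<le> 0" by (rule LIMSEQ_le_const) (use le in \<open>auto intro!: exI[of _ 1]\<close>)
  with p show False by simp
qed

text \<open>The Gaussian density is at most 1, so rescaling a Cauchy kernel of width
  \<open>e\<close> produces the factor \<open>e\<close>; the two coordinates together give the
  \<open>d\<^sup>2\<close> of \<open>ball_bound\<close>.\<close>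

lemma nn_integral_gauss_cauchy:
  obtains J where "J \<ge> 0" "\<And>e. e > 0 \<Longrightarrow> (\<integral>\<^sup>+s. ennreal (1 / (1 + (s / e)\<^sup>2)) \<partial>gauss) \<le> ennreal (J * e)"
proof -
  have "set_integrable lborel (einterval (-\<infinity>) \<infinity>) (\<lambda>x::real. inverse (1 + x^2))"
    by (rule integrable_inverse_1_plus_square)
  then have i: "integrable lborel (\<lambda>x::real. 1 / (1 + x\<^sup>2))"
    unfolding set_integrable_def by (simp add: divide_inverse)
  define J where "J = integral\<^sup>L lborel (\<lambda>x::real. 1 / (1 + x\<^sup>2))"
  have J: "(\<integral>\<^sup>+x. ennreal (1 / (1 + x\<^sup>2)) \<partial>lborel) = ennreal J" "J \<ge> 0"
    unfolding J_def using i by (auto intro!: nn_integral_eq_integral Bochner_Integration.integral_nonneg)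
  have "(\<integral>\<^sup>+s. ennreal (1 / (1 + (s / e)\<^sup>2)) \<partial>gauss) \<le> ennreal (J * e)" if e: "e > 0" for e
  proof -
    have "(\<integral>\<^sup>+s. ennreal (1 / (1 + (s / e)\<^sup>2)) \<partial>gauss)
        = (\<integral>\<^sup>+s. ennreal (std_normal_density s) * ennreal (1 / (1 + (s / e)\<^sup>2)) \<partial>lborel)"
      by (subst nn_integral_density) auto
    also have "\<dots> \<le> (\<integral>\<^sup>+s. 1 * ennreal (1 / (1 + (s / e)\<^sup>2)) \<partial>lborel)"
    proof (intro nn_integral_mono mult_right_mono)
      fix s :: real
      have "sqrt (2 * pi) \<ge> 1" using pi_ge_two by simp
      then have "1 / sqrt (2 * pi) \<le> 1" by simp
      then have "1 / sqrt (2 * pi) * exp (- s\<^sup>2 / 2) \<le> 1 * 1" by (intro mult_mono) auto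
      then show "ennreal (std_normal_density s) \<le> 1" by (simp add: std_normal_density_def)
    qed auto
    also have "\<dots> = ennreal e * (\<integral>\<^sup>+s. ennreal (1 / (1 + s\<^sup>2)) \<partial>lborel)"
      using e by (subst nn_integral_real_affine[where c=e and t=0]) auto
    also have "\<dots> = ennreal (J * e)" using J e by (simp add: ennreal_mult' mult.commute)
    finally show ?thesis .
  qed
  with J(2) that show ?thesis by blast
qed

text \<open>Smoothing at the scale \<open>d\<close> of the disc costs only the constant
  \<open>exp (1/2)\<close>. The smoothed mass is bounded by an integral of the rescaled Cauchy
  kernels, which is of the order of the area.\<close>

lemma (in prob_space) ball_bound:
  fixes X :: "'a \<Rightarrow> complex"
  assumes X[measurable]: "X \<in> borel_measurable M" and C: "C \<ge> 0"
    and decay: "\<And>t. cmod (cchar M X t) \<le> C * (1 / (1 + (Re t)\<^sup>2) * (1 / (1 + (Im t)\<^sup>2)))"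
  obtains B where "B \<ge> 0" "\<And>x d. d > 0 \<Longrightarrow> prob {\<omega> \<in> space M. X \<omega> \<in> cball x d} \<le> B * d\<^sup>2"
proof -
  obtain J where J: "J \<ge> 0" "\<And>e. e > 0 \<Longrightarrow> (\<integral>\<^sup>+s. ennreal (1 / (1 + (s / e)\<^sup>2)) \<partial>gauss) \<le> ennreal (J * e)"
    by (rule nn_integral_gauss_cauchy) blast
  have "prob {\<omega> \<in> space M. X \<omega> \<in> cball x d} \<le> exp (1/2) * C * J\<^sup>2 * d\<^sup>2" if d: "d > 0" for x d
  proof -
    let ?g = "\<lambda>s. 1 / (1 + (s / d)\<^sup>2)"
    define A where "A = (\<integral>\<omega>. exp (- ((cmod (X \<omega> - x) / d)\<^sup>2) / 2) \<partial>M)"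
    have "A \<ge> 0" unfolding A_def by (rule Bochner_Integration.integral_nonneg) simp
    then have "A = cmod (of_real A)" by simp
    also have "\<dots> = cmod (\<integral>t. cis (- Re (cnj (t / of_real d) * x)) * cchar M X (t / of_real d) \<partial>gauss2)"
      unfolding A_def gauss_average[OF X d] ..
    also have "ennreal \<dots> \<le> (\<integral>\<^sup>+t. ennreal (cmod (cis (- Re (cnj (t / of_real d) * x))
        * cchar M X (t / of_real d))) \<partial>gauss2)"
      by (rule norm_integral_le_nn_integral)
    also have "\<dots> \<le> (\<integral>\<^sup>+t. ennreal (C * (?g (Re t) * ?g (Im t))) \<partial>gauss2)"
    proof (intro nn_integral_mono ennreal_leI)
      fix t
      show "cmod (cis (- Re (cnj (t / of_real d) * x)) * cchar M X (t / of_real d)) \<le> C * (?g (Re t) * ?g (Im t))"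
        using decay[of "t / of_real d"] by (simp add: norm_mult)
    qed
    also have "\<dots> = (\<integral>\<^sup>+s. \<integral>\<^sup>+u. ennreal C * (ennreal (?g s) * ennreal (?g u)) \<partial>gauss \<partial>gauss)"
    proof -
      have split: "ennreal (C * (?g a * ?g b)) = ennreal C * (ennreal (?g a) * ennreal (?g b))" for a b
        using C by (subst ennreal_mult, simp, simp, subst ennreal_mult) auto
      have "(\<integral>\<^sup>+t. ennreal (C * (?g (Re t) * ?g (Im t))) \<partial>gauss2) =
        (\<integral>\<^sup>+p. ennreal C * (ennreal (?g (fst p)) * ennreal (?g (snd p))) \<partial>(gauss \<Otimes>\<^sub>M gauss))"
        unfolding split gauss2_def by (subst nn_integral_distr) (simp_all add: split_beta')
      also have "\<dots> = (\<integral>\<^sup>+s. \<integral>\<^sup>+u. ennreal C * (ennreal (?g s) * ennreal (?g u)) \<partial>gauss \<partial>gauss)"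
        by (subst gauss.nn_integral_fst[symmetric]) simp_all
      finally show ?thesis .
    qed
    also have "\<dots> = ennreal C * ((\<integral>\<^sup>+s. ennreal (?g s) \<partial>gauss) * (\<integral>\<^sup>+s. ennreal (?g s) \<partial>gauss))"
      by (simp add: nn_integral_cmult nn_integral_multc)
    also have "\<dots> \<le> ennreal C * (ennreal (J * d) * ennreal (J * d))"
      by (intro mult_left_mono mult_mono J d) auto
    also have "\<dots> = ennreal (C * J\<^sup>2 * d\<^sup>2)" using C J(1) d
      by (simp add: ennreal_mult[symmetric] power2_eq_square mult_ac)
    finally have "A \<le> C * J\<^sup>2 * d\<^sup>2" using C J(1) by (subst (asm) ennreal_le_iff) auto
    moreover have "exp (- (1/2)) * prob {\<omega> \<in> space M. X \<omega> \<in> cball x d} \<le> A"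
      using gauss_average_lower[OF X d d, of x] d by (simp add: A_def)
    ultimately have "exp (1/2) * (exp (- (1/2)) * prob {\<omega> \<in> space M. X \<omega> \<in> cball x d}) \<le> exp (1/2) * (C * J\<^sup>2 * d\<^sup>2)"
      by (intro mult_left_mono) auto
    then show ?thesis by (simp add: mult.assoc[symmetric] exp_add[symmetric])
  qed
  then show ?thesis using C by (intro that[of "exp (1/2) * C * J\<^sup>2"]) auto
qed

text \<open>Cover the null set by squares: a square of side \<open>s\<close> lies in a disc of radius \<open>2 s\<close>,
  so its probability is at most a constant times its area.\<close>

lemma (in prob_space) ball_bound_imp_null:
  fixes X :: "'a \<Rightarrow> complex"
  assumes X[measurable]: "X \<in> borel_measurable M" and B: "B \<ge> 0"
    and le: "\<And>x d. d > 0 \<Longrightarrow> prob {\<omega> \<in> space M. X \<omega> \<in> cball x d} \<le> B * d\<^sup>2"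
    and N: "N \<in> sets borel" "negligible N"
  shows "emeasure M {\<omega> \<in> space M. X \<omega> \<in> N} = 0"
proof -
  have bounded: "emeasure M {\<omega> \<in> space M. X \<omega> \<in> N \<inter> cbox a b} = 0"
    if ab: "a = Complex (- real n) (- real n)" "b = Complex (real n) (real n)" and n: "n > 0"
      for a b :: complex and n :: nat
  proof -
    let ?S = "N \<inter> cbox a b"
    have neg: "negligible ?S" using N by (auto intro: negligible_subset)
    have Sm: "?S \<in> lmeasurable" "measure lebesgue ?S = 0"
      using neg negligible_imp_measurable negligible_imp_measure0 by auto
    have small: "emeasure M {\<omega> \<in> space M. X \<omega> \<in> ?S} \<le> ennreal (4 * B * e)" if e: "e > 0" for e
    proof -
      \<comment> \<open>Dyadic pieces of the square \<open>cbox a b\<close>: both coordinates are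
        halved equally often, so each piece is a square, and their union has area at most
        \<open>e\<close>.\<close>
      obtain D where D: "countable D"
        "\<And>K. K \<in> D \<Longrightarrow> K \<subseteq> cbox a b \<and> K \<noteq> {} \<and> (\<exists>c d. K = cbox c d)"
        "pairwise (\<lambda>A B. interior A \<inter> interior B = {}) D"
        "\<And>u v. cbox u v \<in> D \<Longrightarrow> \<exists>n. \<forall>i \<in> Basis. v \<bullet> i - u \<bullet> i = (b \<bullet> i - a \<bullet> i)/2^n"
        "?S \<subseteq> \<Union>D" "\<Union>D \<in> lmeasurable" "measure lebesgue (\<Union>D) \<le> measure lebesgue ?S + e"
        using measurable_outer_intervals_bounded[OF Sm(1) _ e, of a b] by (metis inf_le2)
      have Kb: "K \<in> sets borel" if "K \<in> D" for K using D(2)[OF that] by auto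
      \<comment> \<open>Pieces may share edges, so areas are taken of the interiors, which are
        disjoint and have the same measure.\<close>
      have K: "emeasure M {\<omega> \<in> space M. X \<omega> \<in> K} \<le> ennreal (4 * B) * emeasure lborel (interior K)" if "K \<in> D" for K
      proof -
        obtain c d where K: "K = cbox c d" using D(2)[OF \<open>K \<in> D\<close>] by blast
        obtain k where k: "\<And>i. i \<in> Basis \<Longrightarrow> d \<bullet> i - c \<bullet> i = (b \<bullet> i - a \<bullet> i) / 2 ^ k"
          using D(4)[of c d] \<open>K \<in> D\<close> K by blast
        define s where "s = 2 * real n / 2 ^ k"
        have s: "s > 0" using n by (simp add: s_def)
        have side: "Re d - Re c = s" "Im d - Im c = s"
          using k[of 1] k[of \<i>] by (auto simp: ab s_def Basis_complex_def inner_complex_def)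
        have sub: "K \<subseteq> cball c (2 * s)"
        proof
          fix z assume "z \<in> K"
          then have "Re c \<le> Re z" "Re z \<le> Re d" "Im c \<le> Im z" "Im z \<le> Im d"
            unfolding K by (auto simp: cbox_def Basis_complex_def inner_complex_def)
          then have "\<bar>Re (z - c)\<bar> + \<bar>Im (z - c)\<bar> \<le> 2 * s" using side by simp
          then have "cmod (z - c) \<le> 2 * s" using cmod_le[of "z - c"] by simp
          then show "z \<in> cball c (2 * s)" by (simp add: dist_norm norm_minus_commute)
        qed
        have "emeasure M {\<omega> \<in> space M. X \<omega> \<in> K} \<le> emeasure M {\<omega> \<in> space M. X \<omega> \<in> cball c (2 * s)}"
          using sub by (intro emeasure_mono) auto
        also have "\<dots> \<le> ennreal (B * (2 * s)\<^sup>2)" unfolding emeasure_eq_measure using s by (intro ennreal_leI le) simp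
        also have "B * (2 * s)\<^sup>2 = 4 * B * (s * s)" by (simp add: power2_eq_square)
        also have "ennreal \<dots> = ennreal (4 * B) * ennreal (s * s)" using B by (simp add: ennreal_mult')
        also have "ennreal (s * s) = emeasure lborel (interior K)"
        proof -
          have "\<And>i. i \<in> Basis \<Longrightarrow> c \<bullet> i \<le> d \<bullet> i" using side s by (auto simp: Basis_complex_def inner_complex_def)
          then have "emeasure lborel (box c d) = ennreal (\<Prod>i\<in>Basis. (d - c) \<bullet> i)" by (rule emeasure_lborel_box)
          also have "(\<Prod>i\<in>Basis. (d - c) \<bullet> i) = s * s"
            using side by (simp add: Basis_complex_def inner_complex_def)
          finally show ?thesis unfolding K interior_cbox ..
        qed
        finally show ?thesis .
      qed
      have "emeasure M {\<omega> \<in> space M. X \<omega> \<in> ?S} \<le> (\<integral>\<^sup>+\<omega>. \<integral>\<^sup>+K. indicator {\<omega> \<in> space M. X \<omega> \<in> K} \<omega> \<partial>count_space D \<partial>M)"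
      proof -
        have "emeasure M {\<omega> \<in> space M. X \<omega> \<in> ?S} = (\<integral>\<^sup>+\<omega>. indicator {\<omega> \<in> space M. X \<omega> \<in> ?S} \<omega> \<partial>M)"
          using N by (intro nn_integral_indicator[symmetric] sets_Collect_in[OF X]) auto
        also have "\<dots> \<le> (\<integral>\<^sup>+\<omega>. \<integral>\<^sup>+K. indicator {\<omega> \<in> space M. X \<omega> \<in> K} \<omega> \<partial>count_space D \<partial>M)"
        proof (rule nn_integral_mono)
          fix \<omega> assume w: "\<omega> \<in> space M"
          show "indicator {\<omega> \<in> space M. X \<omega> \<in> ?S} \<omega> \<le> (\<integral>\<^sup>+K. indicator {\<omega> \<in> space M. X \<omega> \<in> K} \<omega> \<partial>count_space D)"
          proof (cases "X \<omega> \<in> ?S")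
            case True
            then obtain K where K: "K \<in> D" "X \<omega> \<in> K" using D(5) by blast
            have "(1::ennreal) = indicator {\<omega> \<in> space M. X \<omega> \<in> K} \<omega>" using K w by simp
            also have "\<dots> \<le> (\<integral>\<^sup>+K. indicator {\<omega> \<in> space M. X \<omega> \<in> K} \<omega> \<partial>count_space D)"
              by (rule nn_integral_ge_point[OF K(1)])
            finally show ?thesis using True w by simp
          qed simp
        qed
        finally show ?thesis .
      qed
      also have "\<dots> = (\<integral>\<^sup>+K. \<integral>\<^sup>+\<omega>. indicator {\<omega> \<in> space M. X \<omega> \<in> K} \<omega> \<partial>M \<partial>count_space D)"
        by (intro nn_integral_count_space_nn_integral D(1) borel_measurable_indicator sets_Collect_in[OF X] Kb)
      also have "\<dots> = (\<integral>\<^sup>+K. emeasure M {\<omega> \<in> space M. X \<omega> \<in> K} \<partial>count_space D)"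
        using Kb by (intro nn_integral_cong nn_integral_indicator sets_Collect_in[OF X]) auto
      also have "\<dots> \<le> (\<integral>\<^sup>+K. ennreal (4 * B) * emeasure lborel (interior K) \<partial>count_space D)"
        using K by (intro nn_integral_mono) auto
      also have "\<dots> = ennreal (4 * B) * (\<integral>\<^sup>+K. emeasure lborel (interior K) \<partial>count_space D)"
        by (rule nn_integral_cmult) simp
      also have "(\<integral>\<^sup>+K. emeasure lborel (interior K) \<partial>count_space D) = emeasure lborel (\<Union>(interior ` D))"
        using D(1,3) by (intro emeasure_UN_countable[symmetric]) (auto simp: disjoint_family_on_def pairwise_def)
      also have "\<dots> \<le> emeasure lborel (\<Union>D)"
      proof (rule emeasure_mono)
        show "\<Union>(interior ` D) \<subseteq> \<Union>D" using interior_subset by fast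
        show "\<Union>D \<in> sets lborel" using D(1) Kb by (intro sets.countable_Union) auto
      qed
      also have "emeasure lborel (\<Union>D) = emeasure lebesgue (\<Union>D)"
      proof -
        have "\<Union>D \<in> sets lborel" using D(1) Kb by (intro sets.countable_Union) auto
        then show ?thesis by simp
      qed
      also have "\<dots> = ennreal (measure lebesgue (\<Union>D))" using D(6) by (intro emeasure_eq_measure2)
      also have "\<dots> \<le> ennreal e" using D(7) Sm by (intro ennreal_leI) simp
      finally show ?thesis using B e by (simp add: ennreal_mult' mult_left_mono)
    qed
    have "((\<lambda>n. ennreal (4 * B * (1 / real (Suc n)))) \<longlonglongrightarrow> ennreal (4 * B * 0))"
      by (intro tendsto_ennrealI tendsto_mult tendsto_const lim_1_over_n[THEN LIMSEQ_Suc])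
    then have "emeasure M {\<omega> \<in> space M. X \<omega> \<in> ?S} \<le> ennreal (4 * B * 0)"
      by (rule LIMSEQ_le_const) (intro exI allI impI small, simp)
    then show ?thesis by simp
  qed
  have "{\<omega> \<in> space M. X \<omega> \<in> N} = (\<Union>n. {\<omega> \<in> space M. X \<omega> \<in> N \<inter> cbox (Complex (- real (Suc n)) (- real (Suc n))) (Complex (real (Suc n)) (real (Suc n)))})"
  proof (safe)
    fix \<omega> assume w: "X \<omega> \<in> N" "\<omega> \<in> space M"
    obtain n :: nat where "real n \<ge> cmod (X \<omega>)" using real_arch_simple by blast
    then have "\<bar>Re (X \<omega>)\<bar> \<le> real (Suc n)" "\<bar>Im (X \<omega>)\<bar> \<le> real (Suc n)"
      using abs_Re_le_cmod[of "X \<omega>"] abs_Im_le_cmod[of "X \<omega>"] by simp_all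
    then have "X \<omega> \<in> cbox (Complex (- real (Suc n)) (- real (Suc n))) (Complex (real (Suc n)) (real (Suc n)))"
      by (auto simp: cbox_def Basis_complex_def inner_complex_def)
    then show "\<omega> \<in> (\<Union>n. {\<omega> \<in> space M. X \<omega> \<in> N \<inter> cbox (Complex (- real (Suc n)) (- real (Suc n))) (Complex (real (Suc n)) (real (Suc n)))})"
      using w by blast
  qed
  also have "emeasure M \<dots> = 0"
    using N by (intro emeasure_UN_eq_0 bounded[OF refl refl]) auto
  finally show ?thesis .
qed

section \<open>From m particles back to one\<close>

lemma sets_path_Collect:
  assumes "X \<in> borel_measurable path_space" "A \<in> sets borel"
  shows "{\<omega>. X \<omega> \<in> A} \<in> sets path_space"
  using sets_Collect_in[OF assms] by simp

lemma emeasure_path_Collect: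
  assumes "X \<in> borel_measurable path_space" "A \<in> sets borel"
  shows "emeasure path_space {\<omega>. X \<omega> \<in> A} = (\<integral>\<^sup>+\<omega>. indicator A (X \<omega>) \<partial>path_space)"
proof -
  have "(\<integral>\<^sup>+\<omega>. indicator A (X \<omega>) \<partial>path_space) = (\<integral>\<^sup>+\<omega>. indicator {\<omega>. X \<omega> \<in> A} \<omega> \<partial>path_space)"
    by (rule nn_integral_cong) (simp split: split_indicator)
  then show ?thesis by (simp only: nn_integral_indicator[OF sets_path_Collect[OF assms]])
qed

context search_urn
begin

lemma phi_cchar: "phi v = cchar path_space (W v)"
  by (simp add: phi_def cchar_def fun_eq_iff)

definition null_law :: "(nat \<Rightarrow> int) \<Rightarrow> bool" where
  "null_law v \<longleftrightarrow> (\<forall>N\<in>sets borel. negligible N \<longrightarrow> emeasure path_space {\<omega>. W v \<omega> \<in> N} = 0)"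

text \<open>For \<open>a > 1\<close> the function \<open>phi (unit_state 1)\<close> is
  \<open>O(1 / |t|)\<close>, so four factors give \<open>|t|\<close> to the power -4, dominated by a
  product of two Cauchy kernels. One factor would not do with this estimate, since
  \<open>a * Re l < 1\<close> forces \<open>a < 2\<close>.\<close>

lemma null_law_many:
  assumes m4: "m \<ge> 4"
  shows "null_law (many m)"
proof -
  obtain a where a: "a > 1" "a * Re l < 1"
  proof
    have r: "0 < Re l" using Re_half by simp
    show "(1 + 1 / Re l) / 2 > 1" using r Re_lt_1 by (simp add: field_simps)
    show "(1 + 1 / Re l) / 2 * Re l < 1" using r Re_lt_1 by (simp add: field_simps)
  qed
  then obtain M where M: "M \<ge> 0" "\<And>z. cmod (phi (unit_state 1) z) * cmod z powr a \<le> M"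
    using phi_unit_1_decay[of a] by auto
  define C where "C = 4 * (1 + M ^ 4)"
  have C: "C \<ge> 0" using M(1) by (simp add: C_def)
  have decay: "cmod (phi (many m) t) \<le> C * (1 / (1 + (Re t)\<^sup>2) * (1 / (1 + (Im t)\<^sup>2)))" for t
  proof -
    let ?r = "cmod t" and ?f = "cmod (phi (unit_state 1) t)"
    have f4: "cmod (phi (many m) t) \<le> ?f ^ 4"
      using m4 cmod_phi_le_1 phi_many[of m t] by (simp add: norm_power power_decreasing)
    have key: "?f ^ 4 * (1 + ?r\<^sup>2)\<^sup>2 \<le> C"
    proof (cases "?r \<le> 1")
      case True
      have "?f ^ 4 * (1 + ?r\<^sup>2)\<^sup>2 \<le> 1 * 2\<^sup>2"
        using True cmod_phi_le_1 by (intro mult_mono power_mono power_le_one) (auto simp: power_le_one)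
      also have "\<dots> \<le> C" using M(1) by (simp add: C_def)
      finally show ?thesis .
    next
      case False
      have "?f * ?r \<le> ?f * ?r powr a"
        using False a powr_mono[of 1 a ?r] by (intro mult_left_mono) auto
      then have "?f * ?r \<le> M" using M(2)[of t] by linarith
      then have "(?f * ?r) ^ 4 \<le> M ^ 4" by (intro power_mono) auto
      moreover have "(1 + ?r\<^sup>2)\<^sup>2 \<le> (2 * ?r\<^sup>2)\<^sup>2" using False by (intro power_mono) auto
      then have "?f ^ 4 * (1 + ?r\<^sup>2)\<^sup>2 \<le> ?f ^ 4 * (2 * ?r\<^sup>2)\<^sup>2" by (intro mult_left_mono) auto
      moreover have "?f ^ 4 * (2 * ?r\<^sup>2)\<^sup>2 = 4 * (?f * ?r) ^ 4" by (simp add: power_mult_distrib)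
      ultimately show ?thesis by (simp add: C_def)
    qed
    have "(1 + (Re t)\<^sup>2) * (1 + (Im t)\<^sup>2) \<le> (1 + ?r\<^sup>2) * (1 + ?r\<^sup>2)"
      unfolding cmod_power2 by (intro mult_mono) auto
    then have "?f ^ 4 * ((1 + (Re t)\<^sup>2) * (1 + (Im t)\<^sup>2)) \<le> C"
      using key by (intro order_trans[OF mult_left_mono key]) (auto simp: power2_eq_square)
    moreover have "(1 + (Re t)\<^sup>2) * (1 + (Im t)\<^sup>2) > 0" by (intro mult_pos_pos) (auto intro: add_pos_nonneg)
    ultimately have "?f ^ 4 \<le> C / ((1 + (Re t)\<^sup>2) * (1 + (Im t)\<^sup>2))" by (simp only: pos_le_divide_eq)
    with f4 show ?thesis by simp
  qed
  obtain B where B: "B \<ge> 0" "\<And>x d. d > 0 \<Longrightarrow> path_space.prob {\<omega> \<in> space path_space. W (many m) \<omega> \<in> cball x d} \<le> B * d\<^sup>2"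
    using path_space.ball_bound[OF measurable_W C decay[unfolded phi_cchar]] by blast
  show ?thesis unfolding null_law_def
    using path_space.ball_bound_imp_null[OF measurable_W B] by simp
qed

lemma AE_step_unit:
  assumes k: "k \<in> {1..m-1}"
  shows "AE x in step_space. stepv m (unit_state k) x = vadd (unit_state k) (wvec m k)"
proof -
  have pick: "AE u in unif. pick m (unit_state k) u = k"
    using AE_unif
  proof eventually_elim
    case (elim u)
    then have "unit_state k (pick m (unit_state k) u) > 0" by (intro pick_in[OF valid_unit[OF k]]) auto
    then show ?case by (simp add: unit_state_def split: if_splits)
  qed
  have "AE x in step_space. pick m (unit_state k) (snd x) = k"
    unfolding step_space_def
  proof (rule step_pair.AE_pair_measure)
    show "{x \<in> space (expo \<Otimes>\<^sub>M unif). pick m (unit_state k) (snd x) = k} \<in> sets (expo \<Otimes>\<^sub>M unif)" by measurable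
  qed (use pick in simp)
  then show ?thesis by eventually_elim (simp add: stepv_def)
qed

lemma AE_W_unit:
  assumes k: "k \<in> {1..m-1}"
  shows "AE x in step_space. AE \<omega> in path_space.
    W (unit_state k) (case_nat x \<omega>) = exp (- (l * of_real (fst x / real k))) * W (vadd (unit_state k) (wvec m k)) \<omega>"
  using AE_W_step[OF valid_unit[OF k]] AE_step_unit[OF k]
  by eventually_elim (simp add: fac_def rate_unit[OF k])

text \<open>A mixture, over the exponential lifetime, of rotated and contracted copies of the law
  after the jump. Both \<open>null_law_unit\<close> and \<open>supp_step\<close> read off their
  claims from it.\<close>

lemma emeasure_W_unit:
  assumes k: "k \<in> {1..m-1}" and A[measurable]: "A \<in> sets borel"
  shows "emeasure path_space {\<omega>. W (unit_state k) \<omega> \<in> A} =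
    (\<integral>\<^sup>+e. emeasure path_space {\<omega>. exp (- (l * of_real (e / real k))) * W (vadd (unit_state k) (wvec m k)) \<omega> \<in> A} \<partial>expo)"
proof -
  let ?w = "vadd (unit_state k) (wvec m k)"
  let ?B = "\<lambda>e. {\<omega>. exp (- (l * of_real (e / real k))) * W ?w \<omega> \<in> A}"
  have m1: "(\<lambda>p. indicator A (exp (- (l * of_real (fst p / real k)))
      * W ?w (snd p)) :: ennreal) \<in> borel_measurable (expo \<Otimes>\<^sub>M path_space)"
    by measurable
  have m2: "(\<lambda>\<omega>. exp (- (l * of_real (e / real k))) * W ?w \<omega>) \<in> borel_measurable path_space" for e by measurable
  have "emeasure path_space {\<omega>. W (unit_state k) \<omega> \<in> A} = (\<integral>\<^sup>+\<omega>. indicator A (W (unit_state k) \<omega>) \<partial>path_space)"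
    by (rule emeasure_path_Collect[OF measurable_W A])
  also have "\<dots> = (\<integral>\<^sup>+x. \<integral>\<^sup>+\<omega>. indicator A (W (unit_state k) (case_nat x \<omega>)) \<partial>path_space \<partial>step_space)"
    by (rule nn_integral_path) measurable
  also have "\<dots> = (\<integral>\<^sup>+x. \<integral>\<^sup>+\<omega>. indicator A (exp (- (l * of_real (fst x / real k))) * W ?w \<omega>) \<partial>path_space \<partial>step_space)"
  proof (rule nn_integral_cong_AE)
    show "AE x in step_space. (\<integral>\<^sup>+\<omega>. indicator A (W (unit_state k) (case_nat x \<omega>)) \<partial>path_space) =
       (\<integral>\<^sup>+\<omega>. indicator A (exp (- (l * of_real (fst x / real k))) * W ?w \<omega>) \<partial>path_space)"
      using AE_W_unit[OF k] by eventually_elim (rule nn_integral_cong_AE, auto)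
  qed
  also have "\<dots> = (\<integral>\<^sup>+x. emeasure path_space (?B (fst x)) \<partial>step_space)"
    by (simp only: emeasure_path_Collect[OF m2 A])
  also have "\<dots> = (\<integral>\<^sup>+e. emeasure path_space (?B e) \<partial>expo)"
  proof -
    have "(\<lambda>e. \<integral>\<^sup>+\<omega>. indicator A (exp (- (l * of_real (e / real k))) * W ?w \<omega>) \<partial>path_space) \<in> borel_measurable expo"
      using path_space.borel_measurable_nn_integral_fst[OF m1] by simp
    also have "(\<lambda>e. \<integral>\<^sup>+\<omega>. indicator A (exp (- (l * of_real (e / real k))) * W ?w \<omega>) \<partial>path_space)
        = (\<lambda>e. emeasure path_space (?B e))"
      by (simp only: emeasure_path_Collect[OF m2 A])
    finally have [measurable]: "(\<lambda>e. emeasure path_space (?B e)) \<in> borel_measurable borel" by simp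
    show ?thesis unfolding step_space_def
      by (subst unif.nn_integral_fst[symmetric]) (simp_all add: unif.emeasure_space_1[simplified])
  qed
  finally show ?thesis .
qed

text \<open>Multiplication by a nonzero complex number maps null sets to null sets, so each
  component of the mixture \<open>emeasure_W_unit\<close> has mass 0 on the given set.\<close>

lemma null_law_unit:
  assumes k: "k \<in> {1..m-1}" and null: "null_law (vadd (unit_state k) (wvec m k))"
  shows "null_law (unit_state k)"
  unfolding null_law_def
proof (intro ballI impI)
  fix N :: "complex set" assume N: "N \<in> sets borel" "negligible N"
  let ?w = "vadd (unit_state k) (wvec m k)"
  have "emeasure path_space {\<omega>. exp (- (l * of_real (e / real k))) * W ?w \<omega> \<in> N} = 0" for e
  proof -
    define c where "c = exp (- (l * of_real (e / real k)))"
    have c: "c \<noteq> 0" by (simp add: c_def)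
    have "(\<lambda>z. c * z) -` N \<inter> space borel \<in> sets borel"
      by (rule measurable_sets[OF _ N(1)]) measurable
    then have meas: "(\<lambda>z. c * z) -` N \<in> sets borel" by simp
    have neg: "negligible ((\<lambda>z. c * z) -` N)"
    proof -
      have "(\<lambda>z. c * z) -` N = (\<lambda>z. inverse c * z) ` N"
      proof (intro set_eqI iffI)
        fix z assume "z \<in> (\<lambda>z. c * z) -` N"
        then show "z \<in> (\<lambda>z. inverse c * z) ` N" using c
          by (intro image_eqI[of _ _ "c * z"]) (auto simp: mult.assoc[symmetric])
      next
        fix z assume "z \<in> (\<lambda>z. inverse c * z) ` N"
        then show "z \<in> (\<lambda>z. c * z) -` N" using c by (auto simp: mult.assoc[symmetric])
      qed
      then show ?thesis
        by (simp only:, intro negligible_differentiable_image_negligible N(2))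
          (auto simp: differentiable_on_def differentiable_def
            intro!: exI bounded_linear_imp_has_derivative bounded_linear_mult_right)
    qed
    from null[unfolded null_law_def, rule_format, OF meas neg] show ?thesis
      by (simp only: vimage_eq c_def)
  qed
  then show "emeasure path_space {\<omega>. W (unit_state k) \<omega> \<in> N} = 0"
    unfolding emeasure_W_unit[OF k N(1)] by simp
qed

lemma null_law_unit_1:
  assumes "m \<ge> 4"
  shows "null_law (unit_state 1)"
proof -
  have "null_law (unit_state (m - 1 - j))" if "j < m - 1" for j
    using that
  proof (induction j)
    case 0
    have "m - 1 \<in> {1..m-1}" using m3 by auto
    from null_law_unit[OF this] null_law_many[OF assms] show ?case by (simp only: unit_split[OF m3] diff_zero)
  next
    case (Suc j)
    let ?k = "m - 1 - Suc j"
    have k: "?k \<ge> 1" "?k \<le> m - 2" "?k \<in> {1..m-1}" "Suc ?k = m - 1 - j" using Suc.prems by auto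
    have "null_law (vadd (unit_state ?k) (wvec m ?k))" unfolding unit_jump[OF k(1,2)] k(4) using Suc by simp
    then show ?case by (rule null_law_unit[OF k(3)])
  qed
  from this[of "m - 2"] show ?thesis using m3 by (simp add: numeral_2_eq_2)
qed

section \<open>The support\<close>

definition supp :: "(nat \<Rightarrow> int) \<Rightarrow> complex set" where
  "supp v = {x. \<forall>r>0. measure path_space {\<omega>. W v \<omega> \<in> ball x r} > 0}"

lemma supp_limit:
  assumes "\<And>r. r > 0 \<Longrightarrow> \<exists>y\<in>supp v. dist x y < r"
  shows "x \<in> supp v"
  unfolding supp_def
proof (intro CollectI allI impI)
  fix r :: real assume r: "r > 0"
  obtain y where y: "y \<in> supp v" "dist x y < r" using assms[OF r] by blast
  have "0 < measure path_space {\<omega>. W v \<omega> \<in> ball y (r - dist x y)}" using y by (simp add: supp_def)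
  also have "\<dots> \<le> measure path_space {\<omega>. W v \<omega> \<in> ball x r}"
  proof (rule path_space.finite_measure_mono)
    show "{\<omega>. W v \<omega> \<in> ball y (r - dist x y)} \<subseteq> {\<omega>. W v \<omega> \<in> ball x r}"
    proof safe
      fix \<omega> assume "W v \<omega> \<in> ball y (r - dist x y)"
      then show "W v \<omega> \<in> ball x r" using dist_triangle[of x "W v \<omega>" y] by simp
    qed
    show "{\<omega>. W v \<omega> \<in> ball x r} \<in> path_space.events"
      using sets_Collect_in[OF measurable_W, of "ball x r" v] by simp
  qed
  finally show "measure path_space {\<omega>. W v \<omega> \<in> ball x r} > 0" .
qed

text \<open>Otherwise each point of \<open>A\<close> has a neighbourhood of mass 0, and by
  Lindelof's theorem countably many of these cover \<open>A\<close>.\<close>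

lemma supp_nonempty:
  assumes A: "A \<in> sets borel" "measure path_space {\<omega>. W v \<omega> \<in> A} > 0"
  obtains x where "x \<in> A" "x \<in> supp v"
proof (rule ccontr)
  assume "\<not> thesis"
  have "\<forall>x\<in>A. \<exists>r>0. measure path_space {\<omega>. W v \<omega> \<in> ball x r} = 0"
  proof (intro ballI)
    fix x assume "x \<in> A"
    with \<open>\<not> thesis\<close> that have "x \<notin> supp v" by blast
    then obtain r where "r > 0" "\<not> measure path_space {\<omega>. W v \<omega> \<in> ball x r} > 0" unfolding supp_def by blast
    then show "\<exists>r>0. measure path_space {\<omega>. W v \<omega> \<in> ball x r} = 0"
      by (meson measure_nonneg antisym not_less)
  qed
  then obtain r where r: "\<And>x. x \<in> A \<Longrightarrow> r x > 0 \<and> measure path_space {\<omega>. W v \<omega> \<in> ball x (r x)} = 0" by metis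
  obtain F where F: "F \<subseteq> (\<lambda>x. ball x (r x)) ` A" "countable F" "\<Union>F = (\<Union>x\<in>A. ball x (r x))"
    by (rule Lindelof[of "(\<lambda>x. ball x (r x)) ` A"]) auto
  have sub: "A \<subseteq> \<Union>F" unfolding F(3) using r by force
  have Z: "emeasure path_space {\<omega>. W v \<omega> \<in> B} = 0" if "B \<in> F" for B
    using that F(1) r by (auto simp: path_space.emeasure_eq_measure)
  have "{\<omega>. W v \<omega> \<in> B} \<in> null_sets path_space" if "B \<in> F" for B
    using Z[OF that] sets_Collect_in[OF measurable_W, of B v] that F(1) by (auto simp: null_sets_def)
  then have "(\<Union>B\<in>F. {\<omega>. W v \<omega> \<in> B}) \<in> null_sets path_space" using F(2) by (intro null_sets_UN') auto
  then have "emeasure path_space (\<Union>B\<in>F. {\<omega>. W v \<omega> \<in> B}) = 0" by (rule null_setsD1)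
  moreover have "emeasure path_space {\<omega>. W v \<omega> \<in> A} \<le> emeasure path_space (\<Union>B\<in>F. {\<omega>. W v \<omega> \<in> B})"
  proof (rule emeasure_mono)
    show "(\<Union>B\<in>F. {\<omega>. W v \<omega> \<in> B}) \<in> path_space.events"
      using \<open>(\<Union>B\<in>F. {\<omega>. W v \<omega> \<in> B}) \<in> null_sets path_space\<close> by auto
  qed (use sub in auto)
  ultimately have "emeasure path_space {\<omega>. W v \<omega> \<in> A} = 0" by simp
  with A(2) show False by (simp add: path_space.emeasure_eq_measure)
qed

text \<open>On the product space the sum of two independent copies visibly charges every ball around
  \<open>x + y\<close>. Its characteristic function is that of \<open>W (vadd v v')\<close> by
  \<open>phi_vadd\<close>, so \<open>same_char_support\<close> transfers the claim.\<close>

lemma supp_vadd: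
  assumes v: "valid m v" "valid m v'" and x: "x \<in> supp v" and y: "y \<in> supp v'"
  shows "x + y \<in> supp (vadd v v')"
proof -
  interpret P: pair_prob_space path_space path_space ..
  let ?Y = "\<lambda>p. W v (fst p) + W v' (snd p)"
  have Y: "?Y \<in> borel_measurable (path_space \<Otimes>\<^sub>M path_space)" by measurable
  have "cchar path_space (W (vadd v v')) t = cchar (path_space \<Otimes>\<^sub>M path_space) ?Y t" for t
  proof -
    have int: "integrable (path_space \<Otimes>\<^sub>M path_space) (\<lambda>p. cis (Re (cnj t * W v (fst p))) * cis (Re (cnj t
        * W v' (snd p))))"
      by (rule P.integrable_const_bound[where B=1]) (auto simp: norm_mult)
    have "cchar (path_space \<Otimes>\<^sub>M path_space) ?Y t
        = (\<integral>p. cis (Re (cnj t * W v (fst p))) * cis (Re (cnj t * W v' (snd p))) \<partial>(path_space \<Otimes>\<^sub>M path_space))"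
      unfolding cchar_def by (simp add: cis_mult distrib_left algebra_simps)
    also have "\<dots> = (\<integral>\<omega>. \<integral>\<omega>'. cis (Re (cnj t * W v \<omega>)) * cis (Re (cnj t * W v' \<omega>')) \<partial>path_space \<partial>path_space)"
      using P.integral_fst'[OF int] by simp
    also have "\<dots> = phi v t * phi v' t" by (simp only: phi_def integral_mult_right_zero integral_mult_left_zero)
    finally show ?thesis using phi_vadd[OF v, of t] by (simp add: phi_cchar)
  qed
  note char_eq = this
  have pos: "measure (path_space \<Otimes>\<^sub>M path_space) {p \<in> space (path_space \<Otimes>\<^sub>M path_space). ?Y p \<in> ball (x
      + y) r} > 0" if r: "r > 0" for r
  proof -
    let ?A = "{\<omega>. W v \<omega> \<in> ball x (r/2)}" and ?B = "{\<omega>. W v' \<omega> \<in> ball y (r/2)}"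
    have AB: "?A \<in> sets path_space" "?B \<in> sets path_space"
      using sets_Collect_in[OF measurable_W, of "ball x (r/2)" v] sets_Collect_in[OF measurable_W, of "ball y (r/2)" v'] by auto
    have "\<forall>r>0. 0 < measure path_space {\<omega>. W v \<omega> \<in> ball x r}" "\<forall>r>0. 0 < measure path_space {\<omega>. W v' \<omega> \<in> ball y r}"
      using x y by (simp_all only: supp_def mem_Collect_eq)
    then have "0 < measure path_space ?A * measure path_space ?B"
      using half_gt_zero[OF r] by (intro mult_pos_pos) blast+
    also have "\<dots> = measure (path_space \<Otimes>\<^sub>M path_space) (?A \<times> ?B)"
      unfolding measure_def path_space.emeasure_pair_measure_Times[OF AB] by (rule enn2real_mult[symmetric])
    also have "\<dots> \<le> measure (path_space \<Otimes>\<^sub>M path_space) {p \<in> space (path_space \<Otimes>\<^sub>M path_space). ?Y p \<in> ball (x + y) r}"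
    proof (rule P.finite_measure_mono)
      show "?A \<times> ?B \<subseteq> {p \<in> space (path_space \<Otimes>\<^sub>M path_space). ?Y p \<in> ball (x + y) r}"
      proof (safe)
        fix a b assume "W v a \<in> ball x (r/2)" "W v' b \<in> ball y (r/2)"
        then show "?Y (a, b) \<in> ball (x + y) r" using dist_triangle_add[of x y "W v a" "W v' b"] by simp
      qed (simp add: space_pair_measure)
      show "{p \<in> space (path_space \<Otimes>\<^sub>M path_space). ?Y p \<in> ball (x + y) r} \<in> P.events"
        by (rule sets_Collect_in[OF Y]) simp
    qed
    finally show ?thesis .
  qed
  show ?thesis unfolding supp_def
    using same_char_support[OF path_space.prob_space_axioms P.prob_space_axioms measurable_W Y char_eq pos] by simp
qed

text \<open>Lifetimes close to \<open>real k * s\<close> have positive probability, and together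
  with a value near \<open>y\<close> they lead near the target. The interval lies to the right of
  \<open>real k * s\<close> so that it consists of positive times even when
  \<open>s = 0\<close>.\<close>

lemma supp_step:
  assumes k: "k \<in> {1..m-1}" and y: "y \<in> supp (vadd (unit_state k) (wvec m k))" and s: "s \<ge> 0"
  shows "exp (- (l * of_real s)) * y \<in> supp (unit_state k)"
  unfolding supp_def
proof (intro CollectI allI impI)
  fix r :: real assume r: "r > 0"
  let ?w = "vadd (unit_state k) (wvec m k)" and ?E = "\<lambda>s. exp (- (l * of_real s))"
  have "isCont (\<lambda>p. ?E (fst p) * snd p) (s, y)" by (intro continuous_intros)
  then obtain d where d: "d > 0" "\<And>p. dist p (s, y) < d \<Longrightarrow> dist (?E (fst p) * snd p) (?E s * y) < r"
    using r unfolding continuous_at_eps_delta by force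
  have close: "?E t * w \<in> ball (?E s * y) r" if "dist t s < d / 2" "w \<in> ball y (d / 2)" for t w
  proof -
    have "dist (t, w) (s, y) \<le> dist t s + dist w y" unfolding dist_Pair_Pair by (rule sqrt_sum_squares_le_sum) auto
    also have "\<dots> < d" using that by (simp add: dist_commute)
    finally show ?thesis using d(2)[of "(t, w)"] by (simp add: dist_commute)
  qed
  have k0: "real k > 0" using k by simp
  let ?I = "{real k * s<..real k * s + real k * d / 4}"
  have I: "measure expo ?I > 0"
  proof -
    have "?I = {real k * s<..} - {real k * s + real k * d / 4<..}" by auto
    then have "measure expo ?I = measure expo {real k * s<..} - measure expo {real k * s + real k * d / 4<..}"
      using k0 d by (simp only:) (intro expo.finite_measure_Diff, auto)
    also have "\<dots> > 0" using k0 d s by (simp add: measure_expo_greaterThan)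
    finally show ?thesis .
  qed
  let ?p = "emeasure path_space {\<omega>. W ?w \<omega> \<in> ball y (d / 2)}"
  have "\<forall>r>0. 0 < measure path_space {\<omega>. W ?w \<omega> \<in> ball y r}" using y by (simp only: supp_def mem_Collect_eq)
  then have "0 < measure path_space {\<omega>. W ?w \<omega> \<in> ball y (d / 2)}" using d(1) half_gt_zero by blast
  then have p: "?p > 0" by (simp only: path_space.emeasure_eq_measure ennreal_less_zero_iff)
  have "0 < ?p * emeasure expo ?I" using p I by (simp add: ennreal_zero_less_mult_iff expo.emeasure_eq_measure)
  also have "\<dots> = (\<integral>\<^sup>+e. ?p * indicator ?I e \<partial>expo)" by (rule nn_integral_cmult_indicator[symmetric]) simp
  also have "\<dots> \<le> (\<integral>\<^sup>+e. emeasure path_space {\<omega>. ?E (e / real k) * W ?w \<omega> \<in> ball (?E s * y) r} \<partial>expo)"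
  proof (rule nn_integral_mono)
    fix e
    show "?p * indicator ?I e \<le> emeasure path_space {\<omega>. ?E (e / real k) * W ?w \<omega> \<in> ball (?E s * y) r}"
    proof (cases "e \<in> ?I")
      case True
      have "\<bar>e / real k - s\<bar> = (e - real k * s) / real k" using True k0 by (simp add: field_simps)
      also have "\<dots> \<le> (real k * d / 4) / real k" using True k0 by (intro divide_right_mono) auto
      also have "\<dots> < d / 2" using k0 d by simp
      finally have "dist (e / real k) s < d / 2" by (simp add: dist_real_def)
      from close[OF this] have "{\<omega>. W ?w \<omega> \<in> ball y (d / 2)} \<subseteq> {\<omega>. ?E (e / real k) * W ?w \<omega> \<in> ball (?E s
          * y) r}" by blast
      moreover have "{\<omega>. ?E (e / real k) * W ?w \<omega> \<in> ball (?E s * y) r} \<in> sets path_space"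
        using sets_Collect_in[of "\<lambda>\<omega>. ?E (e / real k) * W ?w \<omega>" path_space borel "ball (?E s * y) r"] by simp
      ultimately show ?thesis using True by (simp add: emeasure_mono)
    qed simp
  qed
  also have "\<dots> = emeasure path_space {\<omega>. W (unit_state k) \<omega> \<in> ball (?E s * y) r}"
    by (rule emeasure_W_unit[OF k, symmetric]) simp
  finally show "0 < measure path_space {\<omega>. W (unit_state k) \<omega> \<in> ball (?E s * y) r}"
    by (simp add: path_space.emeasure_eq_measure)
qed

lemma supp_many:
  assumes "n \<ge> 1" "\<And>i. i < n \<Longrightarrow> x i \<in> supp (unit_state 1)"
  shows "(\<Sum>i<n. x i) \<in> supp (many n)"
  using assms
proof (induction n rule: nat_induct_at_least)
  case base
  then have "x 0 \<in> supp (unit_state 1)" by simp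
  then show ?case unfolding many_1[symmetric] by simp
next
  case (Suc n)
  have "(\<Sum>i<n. x i) + x n \<in> supp (vadd (many n) (unit_state 1))"
    using Suc m3 by (intro supp_vadd valid_many valid_unit Suc.IH) auto
  then show ?case by (simp add: many_Suc)
qed

text \<open>Taking \<open>s = 0\<close> for the colours from \<open>m - 1\<close> down to 2 leaves
  \<open>y\<close> unchanged; only the lifetime of colour 1 moves it along the spiral.\<close>

lemma supp_unit_down:
  assumes y: "y \<in> supp (many m)"
  shows "y \<in> supp (unit_state 2)" "s \<ge> 0 \<Longrightarrow> exp (- (l * of_real s)) * y \<in> supp (unit_state 1)"
proof -
  have "y \<in> supp (unit_state (m - 1 - j))" if "j < m - 1" for j
    using that
  proof (induction j)
    case 0
    have "y \<in> supp (vadd (unit_state (m-1)) (wvec m (m-1)))" using y by (simp only: unit_split[OF m3])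
    from supp_step[OF _ this, of 0] show ?case using m3 by simp
  next
    case (Suc j)
    let ?k = "m - 1 - Suc j"
    have k: "?k \<ge> 1" "?k \<le> m - 2" "?k \<in> {1..m-1}" "Suc ?k = m - 1 - j" using Suc.prems by auto
    have "y \<in> supp (vadd (unit_state ?k) (wvec m ?k))" unfolding unit_jump[OF k(1,2)] k(4) using Suc by simp
    from supp_step[OF k(3) this, of 0] show ?case by simp
  qed
  from this[of "m - 3"] show 2: "y \<in> supp (unit_state 2)" using m3 by (simp add: numeral_2_eq_2 numeral_3_eq_3)
  show "exp (- (l * of_real s)) * y \<in> supp (unit_state 1)" if "s \<ge> 0"
    using supp_step[of 1 y s] unit_jump[of 1 m] 2 that m3 by (simp add: numeral_2_eq_2)
qed

lemma supp_spiral_sum: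
  assumes "\<And>i. i < m \<Longrightarrow> x i \<in> supp (unit_state 1)" "s \<ge> 0"
  shows "exp (- (l * of_real s)) * (\<Sum>i<m. x i) \<in> supp (unit_state 1)"
proof -
  have "(\<Sum>i<m. x i) \<in> supp (many m)" by (rule supp_many) (use m3 assms(1) in simp_all)
  from supp_unit_down(2)[OF this assms(2)] show ?thesis .
qed

text \<open>Long lifetimes bring 0 into the closed support; padding sums of m points with 0 then
  gives stability under addition and under motion along spirals. A nonzero point can be moved into
  any direction with arbitrarily small modulus, and integer multiples of the result approximate
  every point of that ray.\<close>

lemma supp_unit_1: "supp (unit_state 1) = UNIV"
proof -
  let ?S = "supp (unit_state 1)"
  have k1: "1 \<in> {1..m-1}" using m3 by auto
  have "u2 m l (unit_state 1) = 1"
    unfolding u2_coef using k1 by (simp add: unit_state_def coef_1 if_distrib cong: if_cong)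
  then obtain \<eta> where eta: "\<eta> > 0" "measure path_space {\<omega>. cmod (W (unit_state 1) \<omega>) \<ge> \<eta>} > 0"
    using W_not_AE_0[OF valid_unit[OF k1]] by auto
  have "{z. cmod z \<ge> \<eta>} \<in> sets borel" by measurable
  then obtain x0 where x0: "cmod x0 \<ge> \<eta>" "x0 \<in> ?S"
    using supp_nonempty[of "{z. cmod z \<ge> \<eta>}" "unit_state 1"] eta by auto
  have "x0 \<noteq> 0" using x0 eta by auto
  have lim0: "((\<lambda>s. exp (- (Re l * s)) * c) \<longlongrightarrow> 0) at_top" for c :: real
    using Re_half by real_asymp
  have zero: "0 \<in> ?S"
  proof (rule supp_limit)
    fix r :: real assume r: "r > 0"
    have "\<forall>\<^sub>F s in at_top. exp (- (Re l * s)) * cmod (of_nat m * x0) < r" using order_tendstoD(2)[OF lim0 r] .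
    then have "\<forall>\<^sub>F s in at_top. s \<ge> 0 \<and> exp (- (Re l * s)) * cmod (of_nat m * x0) < r"
      using eventually_ge_at_top[of 0] by eventually_elim simp
    then obtain s where s: "s \<ge> 0" "exp (- (Re l * s)) * cmod (of_nat m * x0) < r"
      using eventually_happens'[OF trivial_limit_at_top_linorder] by blast
    have "exp (- (l * of_real s)) * (\<Sum>i<m. x0) \<in> ?S" using x0 s by (intro supp_spiral_sum) auto
    moreover have "dist 0 (exp (- (l * of_real s)) * (\<Sum>i<m. x0)) < r" using s by (simp add: dist_norm norm_mult)
    ultimately show "\<exists>y\<in>?S. dist 0 y < r" by blast
  qed
  have scale: "exp (- (l * of_real s)) * x \<in> ?S" if "x \<in> ?S" "s \<ge> 0" for x s
  proof -
    have "exp (- (l * of_real s)) * (\<Sum>i<m. if i = 0 then x else 0) \<in> ?S"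
      using that zero by (intro supp_spiral_sum) auto
    then show ?thesis using m3 by simp
  qed
  have add: "x + y \<in> ?S" if "x \<in> ?S" "y \<in> ?S" for x y
  proof -
    have "exp (- (l * of_real 0)) * (\<Sum>i<m. if i = 0 then x else if i = 1 then y else 0) \<in> ?S"
      using that zero by (intro supp_spiral_sum) auto
    moreover have "(\<Sum>i<m. if i = 0 then x else if i = 1 then y else 0) = x + y"
    proof -
      have "{..<m} = insert 0 (insert 1 {2..<m})" using m3 by auto
      then show ?thesis by simp
    qed
    ultimately show ?thesis by simp
  qed
  have mult: "of_nat n * x \<in> ?S" if "x \<in> ?S" for n x
  proof (induction n)
    case 0
    show ?case using zero by (simp only: of_nat_0 mult_zero_left)
  next
    case (Suc n)
    show ?case using add[OF that Suc] by (simp only: of_nat_Suc distrib_right mult_1)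
  qed
  have "z \<in> ?S" if z: "z \<noteq> 0" for z
  proof (rule supp_limit)
    fix r :: real assume r: "r > 0"
    define u where "u = z / of_real (cmod z)"
    have u: "cmod u = 1" "u \<noteq> 0" using z by (auto simp: u_def norm_divide)
    \<comment> \<open>At \<open>s1\<close> the spiral from \<open>x0\<close> crosses the ray through
      \<open>z\<close>; it does so again after every full turn, of duration
      \<open>2 * pi / Im l\<close>, and ever closer to 0.\<close>
    obtain s1 where s1: "0 \<le> s1" "(x0 / u) * exp (- (l * of_real s1)) = of_real (cmod (x0 / u) * exp (- (Re l * s1)))"
      using spiral_phase[of "x0 / u"] \<open>x0 \<noteq> 0\<close> u by auto
    define s where "s j = s1 + real j * (2 * pi / Im l)" for j :: nat
    have rot_s: "exp (- (l * of_real (s j))) * x0 = of_real (exp (- (Re l * s j)) * cmod x0) * u" for j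
    proof -
      define T where "T = real j * (2 * pi / Im l)"
      have "Im l * T = 2 * real j * pi" using Im_pos by (simp add: T_def)
      then have "exp (- (l * of_real T)) = of_real (exp (- (Re l * T)))"
        by (simp add: complex_eq_iff Re_exp Im_exp)
      moreover have "exp (- (l * of_real (s j))) = exp (- (l * of_real s1)) * exp (- (l * of_real T))"
        by (simp add: s_def T_def exp_add[symmetric] distrib_left)
      moreover have "exp (- (l * of_real s1)) * x0 = of_real (cmod x0 * exp (- (Re l * s1))) * u"
        using s1(2) u by (simp add: norm_divide field_simps)
      moreover have "exp (- (Re l * s j)) = exp (- (Re l * s1)) * exp (- (Re l * T))"
        by (simp add: s_def T_def exp_add[symmetric] distrib_left)
      ultimately show ?thesis by (simp add: mult_ac)
    qed
    have "filterlim s at_top sequentially"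
      unfolding s_def using Im_pos by real_asymp
    from filterlim_compose[OF lim0 this] have "(\<lambda>j. exp (- (Re l * s j)) * cmod x0) \<longlonglongrightarrow> 0" .
    from order_tendstoD(2)[OF this r] obtain j where j: "exp (- (Re l * s j)) * cmod x0 < r"
      using eventually_happens'[OF sequentially_bot] by blast
    define \<rho> where "\<rho> = exp (- (Re l * s j)) * cmod x0"
    have rho: "0 < \<rho>" "\<rho> < r" using j \<open>x0 \<noteq> 0\<close> by (auto simp: \<rho>_def)
    have "s j \<ge> 0" using s1 Im_pos by (simp add: s_def)
    from scale[OF x0(2) this] have "of_real \<rho> * u \<in> ?S" unfolding rot_s \<rho>_def .
    define n where "n = nat \<lfloor>cmod z / \<rho>\<rfloor>"
    have n: "real n \<le> cmod z / \<rho>" "cmod z / \<rho> < real n + 1"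
      using rho by (auto simp: n_def le_nat_floor of_nat_floor)
    have "real n * \<rho> \<le> cmod z" "cmod z < real n * \<rho> + \<rho>" using n rho by (auto simp: field_simps)
    then have "\<bar>cmod z - real n * \<rho>\<bar> < r" using rho by simp
    moreover have "z - of_nat n * (of_real \<rho> * u) = of_real (cmod z - real n * \<rho>) * u"
      using z by (simp add: u_def algebra_simps)
    ultimately have "dist z (of_nat n * (of_real \<rho> * u)) < r" using u
      by (simp add: dist_norm norm_mult del: of_real_diff)
    then show "\<exists>y\<in>?S. dist z y < r" using mult[OF \<open>of_real \<rho> * u \<in> ?S\<close>] by blast
  qed
  then show ?thesis using zero by (metis UNIV_eq_I)
qed

end

section \<open>Continuous time\<close>

lemma e1_eq: "e1 = unit_state 1" by (auto simp: e1_def unit_state_def)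

text \<open>Recursion on the first step, as for \<open>Wn\<close>; \<open>state_at_Suc\<close> is
  the last-step form that matches \<open>Ychain\<close>.\<close>

primrec state_at :: "nat \<Rightarrow> nat \<Rightarrow> (nat \<Rightarrow> int) \<Rightarrow> (nat \<Rightarrow> real \<times> real) \<Rightarrow> nat \<Rightarrow> int" where
  "state_at m 0 v p = v"
| "state_at m (Suc n) v p = state_at m n (stepv m v (p 0)) (\<lambda>i. p (Suc i))"

definition time_at :: "nat \<Rightarrow> nat \<Rightarrow> (nat \<Rightarrow> int) \<Rightarrow> (nat \<Rightarrow> real \<times> real) \<Rightarrow> real" where
  "time_at m n v p = (\<Sum>i<n. fst (p i) / rate m (state_at m i v p))"

lemma state_at_Suc: "state_at m (Suc n) v p = stepv m (state_at m n v p) (p n)"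
proof (induction n arbitrary: v p)
  case (Suc n)
  show ?case using Suc[of "stepv m v (p 0)" "\<lambda>i. p (Suc i)"] by simp
qed simp

lemma Ychain_eq: "Ychain m (\<lambda>n. snd (p n)) n = state_at m n e1 p"
  by (induction n) (simp_all add: state_at_Suc stepv_def vadd_def del: state_at.simps(2))

lemma Tjump_eq: "Tjump m (\<lambda>n. fst (p n)) (\<lambda>n. snd (p n)) n = time_at m n e1 p"
  by (simp add: Tjump_def time_at_def Ychain_eq)

lemma time_at_Suc_shift: "time_at m (Suc n) v p
    = fst (p 0) / rate m v + time_at m n (stepv m v (p 0)) (\<lambda>i. p (Suc i))"
  unfolding time_at_def by (subst sum.lessThan_Suc_shift) simp

lemma time_at_Suc: "time_at m (Suc n) v p = time_at m n v p + fst (p n) / rate m (state_at m n v p)"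
  by (simp add: time_at_def)

lemma measurable_state_at: "state_at m n v \<in> measurable path_space (count_space UNIV)"
proof (induction n arbitrary: v)
  case 0
  have "state_at m 0 v = (\<lambda>_. v)" by auto
  then show ?case by simp
next
  case (Suc n)
  have "state_at m (Suc n) v = (\<lambda>p. state_at m n (stepv m v (p 0)) (\<lambda>i. p (Suc i)))" by auto
  then show ?case using measurable_shift_step[of "state_at m n", OF Suc] by simp
qed

lemma measurable_state_at_fun: "(\<lambda>p. g (state_at m n v p)) \<in> borel_measurable path_space"
  by (rule measurable_compose[OF measurable_state_at]) simp

lemma measurable_time_at[measurable]: "time_at m n v \<in> borel_measurable path_space"
proof -
  note measurable_state_at_fun[of "rate m" m _ v, measurable]
  have "time_at m n v = (\<lambda>p. \<Sum>i<n. fst (p i) / rate m (state_at m i v p))" by (auto simp: time_at_def)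
  then show ?thesis by simp
qed

lemma stepv_valid:
  assumes "m \<ge> 3" "valid m v" "0 \<le> snd x" "snd x < 1"
  shows "valid m (stepv m v x)" "rate m (stepv m v x) = rate m v + 1"
  using pick_in[OF assms(2-4)] valid_vadd_wvec[OF assms(1,2)] rate_wvec[OF assms(1)]
  by (auto simp: stepv_def rate_vadd)

lemma state_at_valid:
  assumes "m \<ge> 3" "valid m v" "\<And>i. 0 \<le> snd (p i) \<and> snd (p i) < 1"
  shows "valid m (state_at m n v p) \<and> rate m (state_at m n v p) = rate m v + real n"
proof (induction n)
  case (Suc n)
  then show ?case using stepv_valid[OF assms(1), of "state_at m n v p" "p n"] assms(3)[of n]
    by (simp add: state_at_Suc del: state_at.simps)
qed (use assms in simp)

section \<open>Measurability of the continuous-time limit\<close>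

definition clock :: "(nat \<Rightarrow> real) \<Rightarrow> real \<Rightarrow> nat" where "clock T t = (LEAST n. t < T (Suc n))"

text \<open>If \<open>t\<close> is never passed, the \<open>LEAST\<close> expressions at
  \<open>t\<close> and at later times range over the same empty predicate and agree. So right
  continuity holds on every path, null sets included, and the measurability proof can rely on
  it.\<close>

lemma clock_right_const:
  obtains d where "d > 0" "\<And>t'. t \<le> t' \<Longrightarrow> t' < t + d \<Longrightarrow> clock T t' = clock T t"
proof (cases "\<exists>n. t < T (Suc n)")
  case True
  then have n: "t < T (Suc (clock T t))" unfolding clock_def by (rule LeastI_ex)
  show ?thesis
  proof (rule that[of "T (Suc (clock T t)) - t"])
    fix t' assume t': "t \<le> t'" "t' < t + (T (Suc (clock T t)) - t)"
    show "clock T t' = clock T t"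
      unfolding clock_def[of T t']
    proof (rule Least_equality)
      fix y assume "t' < T (Suc y)"
      then have "t < T (Suc y)" using t' by simp
      then show "clock T t \<le> y" unfolding clock_def by (rule Least_le)
    qed (use t' in simp)
  qed (use n in simp)
next
  case False
  show ?thesis
  proof (rule that[of 1])
    fix t' assume "t \<le> t'"
    with False have "(\<lambda>n. t' < T (Suc n)) = (\<lambda>n. t < T (Suc n))" by (intro ext) (meson not_less order_trans)
    then show "clock T t' = clock T t" by (simp add: clock_def)
  qed simp
qed

text \<open>The definition of \<open>W1\<close> branches on the existence of a limit over
  uncountably many times. For right-continuous functions this is the Cauchy condition at rational
  times, a countable combination of measurable conditions.\<close>

lemma right_continuous_convergence:
  fixes f :: "real \<Rightarrow> complex"
  assumes rc: "\<And>t e. e > 0 \<Longrightarrow> \<exists>d>0. \<forall>t'. t \<le> t' \<and> t' < t + d \<longrightarrow> cmod (f t' - f t) < e"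
  shows "(\<exists>L. (f \<longlongrightarrow> L) at_top) \<longleftrightarrow>
    (\<forall>k::nat. \<exists>n::nat. \<forall>r s::rat. real n \<le> of_rat r \<and> real n \<le> of_rat s \<longrightarrow> cmod (f (of_rat r) - f (of_rat s)) \<le> inverse (real (Suc k)))"
    (is "?conv \<longleftrightarrow> ?cauchy")
proof
  assume ?conv
  then obtain L where L: "(f \<longlongrightarrow> L) at_top" by blast
  show ?cauchy
  proof
    fix k :: nat
    have "\<forall>\<^sub>F t in at_top. dist (f t) L < inverse (real (Suc k)) / 2"
      by (rule tendstoD[OF L]) simp
    then obtain K where K: "\<And>t. t \<ge> K \<Longrightarrow> dist (f t) L < inverse (real (Suc k)) / 2"
      by (auto simp: eventually_at_top_linorder)
    obtain n :: nat where n: "real n \<ge> K" using real_arch_simple by blast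
    show "\<exists>n::nat. \<forall>r s::rat. real n \<le> of_rat r \<and> real n \<le> of_rat s \<longrightarrow> cmod (f (of_rat r) - f (of_rat s))
        \<le> inverse (real (Suc k))"
    proof (intro exI[of _ n] allI impI)
      fix r s :: rat assume "real n \<le> of_rat r \<and> real n \<le> of_rat s"
      then have "dist (f (of_rat r)) L < inverse (real (Suc k)) / 2" "dist (f (of_rat s)) L < inverse (real (Suc k)) / 2"
        using K n by auto
      then have "dist (f (of_rat r)) (f (of_rat s)) < inverse (real (Suc k))" by (rule dist_triangle_half_l)
      then show "cmod (f (of_rat r) - f (of_rat s)) \<le> inverse (real (Suc k))" by (simp add: dist_norm)
    qed
  qed
next
  assume C: ?cauchy
  have near: "\<exists>r::rat. of_rat r \<ge> t \<and> cmod (f (of_rat r) - f t) < e" if "e > 0" for t e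
  proof -
    obtain d where d: "d > 0" "\<And>t'. t \<le> t' \<Longrightarrow> t' < t + d \<Longrightarrow> cmod (f t' - f t) < e" using rc[OF \<open>e > 0\<close>] by blast
    obtain r :: rat where "t < of_rat r" "of_rat r < t + d" using of_rat_dense[of t "t + d"] d(1) by auto
    with d(2)[of "of_rat r"] show ?thesis by (intro exI[of _ r]) auto
  qed
  have real_cauchy: "\<exists>n::nat. \<forall>t u. real n \<le> t \<and> real n \<le> u \<longrightarrow> cmod (f t - f u) \<le> e" if e: "e > 0" for e
  proof -
    obtain k :: nat where k: "inverse (real (Suc k)) < e / 3" using reals_Archimedean[of "e / 3"] e by auto
    obtain n :: nat where n: "\<And>r s::rat. real n \<le> of_rat r \<Longrightarrow> real n \<le> of_rat s
        \<Longrightarrow> cmod (f (of_rat r) - f (of_rat s)) \<le> inverse (real (Suc k))"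
      using C by blast
    show ?thesis
    proof (intro exI[of _ n] allI impI)
      fix t u assume tu: "real n \<le> t \<and> real n \<le> u"
      obtain r :: rat where r: "of_rat r \<ge> t" "cmod (f (of_rat r) - f t) < e / 3" using near[of "e/3" t] e by auto
      obtain s :: rat where s: "of_rat s \<ge> u" "cmod (f (of_rat s) - f u) < e / 3" using near[of "e/3" u] e by auto
      have "cmod (f (of_rat r) - f (of_rat s)) \<le> inverse (real (Suc k))" using n[of r s] tu r s by linarith
      moreover have "cmod (f t - f u) \<le> cmod (f (of_rat r) - f t) + cmod (f (of_rat r) - f (of_rat s))
          + cmod (f (of_rat s) - f u)"
        by norm
      ultimately show "cmod (f t - f u) \<le> e" using r s k by linarith
    qed
  qed
  have "Cauchy (\<lambda>n::nat. f (real n))"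
  proof (rule CauchyI)
    fix e :: real assume e: "e > 0"
    obtain n :: nat where "\<And>t u. real n \<le> t \<Longrightarrow> real n \<le> u \<Longrightarrow> cmod (f t - f u) \<le> e / 2"
      using real_cauchy[of "e / 2"] e by auto
    then show "\<exists>M. \<forall>i\<ge>M. \<forall>j\<ge>M. cmod (f (real i) - f (real j)) < e"
      using e by (intro exI[of _ n] allI impI) (smt (verit) field_sum_of_halves of_nat_mono)
  qed
  then obtain L where L: "(\<lambda>n::nat. f (real n)) \<longlonglongrightarrow> L" using Cauchy_convergent convergent_def by blast
  have "(f \<longlongrightarrow> L) at_top"
  proof (rule tendstoI)
    fix e :: real assume e: "e > 0"
    obtain n :: nat where n: "\<And>t u. real n \<le> t \<Longrightarrow> real n \<le> u \<Longrightarrow> cmod (f t - f u) \<le> e / 2"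
      using real_cauchy[of "e / 2"] e by auto
    have "dist (f t) L < e" if t: "t \<ge> real n" for t
    proof -
      have "(\<lambda>i::nat. cmod (f t - f (real i))) \<longlonglongrightarrow> cmod (f t - L)" by (intro tendsto_intros L)
      then have "cmod (f t - L) \<le> e / 2"
        by (rule LIMSEQ_le_const2) (use n t in \<open>auto intro!: exI[of _ n]\<close>)
      then show ?thesis using e by (simp add: dist_norm)
    qed
    then show "\<forall>\<^sub>F t in at_top. dist (f t) L < e" by (auto simp: eventually_at_top_linorder)
  qed
  then show ?conv by blast
qed

lemma Lim_at_top_eq_lim:
  fixes f :: "real \<Rightarrow> complex"
  assumes "\<exists>L. (f \<longlongrightarrow> L) at_top"
  shows "Lim at_top f = lim (\<lambda>n::nat. f (real n))"
proof -
  obtain L where L: "(f \<longlongrightarrow> L) at_top" using assms by blast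
  have "(\<lambda>n::nat. f (real n)) \<longlonglongrightarrow> L" by (rule filterlim_compose[OF L filterlim_real_sequentially])
  then show ?thesis using tendsto_Lim[OF trivial_limit_at_top_linorder L] limI by metis
qed

definition path_W1 :: "nat \<Rightarrow> complex \<Rightarrow> (nat \<Rightarrow> real \<times> real) \<Rightarrow> complex" where
  "path_W1 m l p = W1 m l (\<lambda>n. fst (p n)) (\<lambda>n. snd (p n))"

definition scaled :: "nat \<Rightarrow> complex \<Rightarrow> (nat \<Rightarrow> real \<times> real) \<Rightarrow> real \<Rightarrow> complex" where
  "scaled m l p t = exp (- l * of_real t) * u2 m l (state_at m (clock (\<lambda>n. time_at m n e1 p) t) e1 p)"

lemma path_W1_eq:
  "path_W1 m l p = (if \<exists>L. (scaled m l p \<longlongrightarrow> L) at_top then Lim at_top (scaled m l p) else 0)"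
proof -
  have "scaled m l p = (\<lambda>t. exp (- l * of_real t) * u2 m l (Xproc m (\<lambda>n. fst (p n)) (\<lambda>n. snd (p n)) t))"
    by (auto simp: scaled_def Xproc_def Ychain_eq Tjump_eq clock_def)
  then show ?thesis by (simp add: path_W1_def W1_def)
qed

lemma measurable_scaled[measurable]: "(\<lambda>p. scaled m l p t) \<in> borel_measurable path_space"
proof -
  have "(\<lambda>p. clock (\<lambda>n. time_at m n e1 p) t) \<in> measurable path_space (count_space UNIV)"
    unfolding clock_def by measurable
  from measurable_compose_countable[of "\<lambda>n p. u2 m l (state_at m n e1 p)", OF measurable_state_at_fun this]
  have "(\<lambda>p. u2 m l (state_at m (clock (\<lambda>n. time_at m n e1 p) t) e1 p)) \<in> borel_measurable path_space" .
  then show ?thesis unfolding scaled_def by simp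
qed

lemma scaled_right_cont:
  assumes e: "e > 0"
  shows "\<exists>d>0. \<forall>t'. t \<le> t' \<and> t' < t + d \<longrightarrow> cmod (scaled m l p t' - scaled m l p t) < e"
proof -
  let ?T = "\<lambda>n. time_at m n e1 p"
  obtain d1 where d1: "d1 > 0" "\<And>t'. t \<le> t' \<Longrightarrow> t' < t + d1 \<Longrightarrow> clock ?T t' = clock ?T t"
    by (rule clock_right_const) blast
  let ?c = "u2 m l (state_at m (clock ?T t) e1 p)"
  have "isCont (\<lambda>s. exp (- l * of_real s) * ?c) t" by (intro continuous_intros)
  then obtain d2 where d2: "d2 > 0" "\<And>s. dist s t < d2
      \<Longrightarrow> dist (exp (- l * of_real s) * ?c) (exp (- l * of_real t) * ?c) < e"
    unfolding continuous_at_eps_delta using e by blast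
  show ?thesis
  proof (intro exI[of _ "min d1 d2"] conjI allI impI)
    fix t' assume t': "t \<le> t' \<and> t' < t + min d1 d2"
    then have "clock ?T t' = clock ?T t" by (intro d1(2)) auto
    then have "scaled m l p t' = exp (- l * of_real t') * ?c" by (simp only: scaled_def)
    moreover have "dist t' t < d2" using t' unfolding dist_real_def by linarith
    ultimately show "cmod (scaled m l p t' - scaled m l p t) < e"
      using d2(2)[of t'] by (simp add: dist_norm scaled_def)
  qed (use d1(1) d2(1) in simp)
qed

lemma measurable_path_W1[measurable]: "path_W1 m l \<in> borel_measurable path_space"
proof -
  let ?C = "\<lambda>p. \<forall>k::nat. \<exists>n::nat. \<forall>r s::rat. real n \<le> of_rat r \<and> real n \<le> of_rat s \<longrightarrow>
    cmod (scaled m l p (of_rat r) - scaled m l p (of_rat s)) \<le> inverse (real (Suc k))"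
  have conv: "(\<exists>L. (scaled m l p \<longlongrightarrow> L) at_top) \<longleftrightarrow> ?C p" for p
    by (rule right_continuous_convergence) (rule scaled_right_cont)
  have eq: "path_W1 m l p = (if ?C p then lim (\<lambda>n::nat. scaled m l p (real n)) else 0)" for p
    unfolding path_W1_eq conv[of p, symmetric] using Lim_at_top_eq_lim[of "scaled m l p"] by simp
  have "Measurable.pred path_space ?C" by measurable
  then show ?thesis unfolding eq[abs_def] by (intro measurable_If predE) auto
qed

context search_urn
begin

section \<open>Jump times, and convergence in continuous time\<close>

lemma Wn_eq: "Wn n v p = exp (- (l * of_real (time_at m n v p))) * u2 m l (state_at m n v p)"
proof (induction n arbitrary: v p)
  case 0
  show ?case by (simp add: time_at_def)
next
  case (Suc n)
  show ?case by (simp add: Suc time_at_Suc_shift fac_def exp_add[symmetric] distrib_left)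
qed

text \<open>The recursion of \<open>tail_step\<close> with constant 1, started from
  \<open>1 <= rate\<close>. The mean squared discount tends to 0, which is incompatible with bounded
  jump times.\<close>

lemma expectation_time:
  assumes "valid m v"
  shows "(\<integral>\<^sup>+p. ennreal ((cmod (exp (- (l * of_real (time_at m n v p)))))\<^sup>2) \<partial>path_space)
      \<le> ennreal (1 * tail_var (Re l) n (rate m v))"
  using assms
proof (induction n arbitrary: v)
  case 0
  then show ?case using rate_ge_1[OF 0] by (simp add: time_at_def path_space.emeasure_space_1[simplified])
next
  case (Suc n)
  let ?G = "\<lambda>v. \<integral>\<^sup>+p. ennreal ((cmod (exp (- (l * of_real (time_at m n v p)))))\<^sup>2) \<partial>path_space"
  have split: "(cmod (exp (- (l * of_real (time_at m (Suc n) v (case_nat x p))))))\<^sup>2 =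
     (cmod (fac v x))\<^sup>2 * (cmod (exp (- (l * of_real (time_at m n (stepv m v x) p)))))\<^sup>2" for x p
    unfolding power_mult_distrib[symmetric] norm_mult[symmetric]
    by (simp add: time_at_Suc_shift fac_def exp_add[symmetric] distrib_left del: norm_exp_eq_Re)
  have "(\<integral>\<^sup>+p. ennreal ((cmod (exp (- (l * of_real (time_at m (Suc n) v p)))))\<^sup>2) \<partial>path_space) =
    (\<integral>\<^sup>+x. ennreal ((cmod (fac v x))\<^sup>2) * ?G (stepv m v x) \<partial>step_space)"
    by (subst nn_integral_path, measurable, simp only: split)
       (simp add: ennreal_mult nn_integral_cmult del: norm_exp_eq_Re)
  also have "\<dots> \<le> ennreal (1 * tail_var (Re l) (Suc n) (rate m v))"
    by (rule tail_step[OF Suc.prems]) (simp, rule Suc.IH)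
  finally show ?case .
qed

lemma AE_path_component:
  assumes "AE x in step_space. P x"
  shows "AE p in path_space. \<forall>i. P (p i)"
  unfolding path_space_def AE_all_countable
  using path.AE_component[OF _ assms] by simp

lemma AE_good_path: "AE p in path_space. \<forall>i. 0 < fst (p i) \<and> 0 \<le> snd (p i) \<and> snd (p i) < 1"
proof (rule AE_path_component)
  have "AE x in step_space. 0 < fst x"
    unfolding step_space_def
  proof (rule step_pair.AE_pair_measure)
    show "{x \<in> space (expo \<Otimes>\<^sub>M unif). 0 < fst x} \<in> sets (expo \<Otimes>\<^sub>M unif)" by measurable
  qed (use AE_expo_pos in simp)
  moreover have "AE x in step_space. 0 \<le> snd x \<and> snd x < 1"
    unfolding step_space_def
  proof (rule step_pair.AE_pair_measure)
    show "{x \<in> space (expo \<Otimes>\<^sub>M unif). 0 \<le> snd x \<and> snd x < 1} \<in> sets (expo \<Otimes>\<^sub>M unif)" by measurable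
  qed (use AE_unif in simp)
  ultimately show "AE x in step_space. 0 < fst x \<and> 0 \<le> snd x \<and> snd x < 1" by eventually_elim simp
qed

text \<open>Non-explosion: if the jump times stayed below \<open>K\<close>, the squared discount
  would stay above the square of \<open>exp (- (Re l * K))\<close>, while by Fatou's lemma its limit
  inferior has mean 0.\<close>

lemma AE_time_unbounded:
  assumes v: "valid m v"
  shows "AE p in path_space. \<forall>K. \<exists>n. time_at m n v p > K"
proof -
  let ?h = "\<lambda>n p. ennreal ((cmod (exp (- (l * of_real (time_at m n v p)))))\<^sup>2)"
  have q: "rate m v > 0" using v by (simp add: valid_def)
  have "(\<integral>\<^sup>+p. liminf (\<lambda>n. ?h n p) \<partial>path_space) \<le> liminf (\<lambda>n. \<integral>\<^sup>+p. ?h n p \<partial>path_space)"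
    by (rule nn_integral_liminf) measurable
  also have "\<dots> \<le> liminf (\<lambda>n. ennreal (1 * tail_var (Re l) n (rate m v)))"
    by (intro Liminf_mono always_eventually allI expectation_time v)
  also have "\<dots> = ennreal (1 * 0)"
    by (intro lim_imp_Liminf tendsto_ennrealI tendsto_mult tendsto_const tail_var_tendsto_0 q Re_half) simp
  finally have "(\<integral>\<^sup>+p. liminf (\<lambda>n. ?h n p) \<partial>path_space) = 0" by simp
  moreover have lim: "(\<lambda>p. liminf (\<lambda>n. ?h n p)) \<in> borel_measurable path_space"
    by (intro borel_measurable_liminf) measurable
  ultimately have "AE p in path_space. liminf (\<lambda>n. ?h n p) = 0"
    by (simp only: nn_integral_0_iff_AE[OF lim])
  then show ?thesis
  proof eventually_elim
    case (elim p)
    show ?case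
    proof (rule ccontr)
      assume "\<not> (\<forall>K. \<exists>n. time_at m n v p > K)"
      then obtain K where K: "\<And>n. time_at m n v p \<le> K" by (auto simp: not_less)
      have "ennreal ((exp (- (Re l * K)))\<^sup>2) \<le> liminf (\<lambda>n. ?h n p)"
      proof (rule Liminf_bounded, rule always_eventually, rule allI)
        fix n
        have "Re l * time_at m n v p \<le> Re l * K" using Re_half by (intro mult_left_mono K) auto
        then show "ennreal ((exp (- (Re l * K)))\<^sup>2) \<le> ?h n p" by (intro ennreal_leI power_mono) auto
      qed
      with elim show False by simp
    qed
  qed
qed

lemma measure_path_component:
  assumes "a \<ge> 0"
  shows "measure path_space {p. fst (p n) > a} = exp (- a)" "{p. fst (p n) > a} \<in> sets path_space"
proof -
  have c: "(\<lambda>p. p n) \<in> measurable path_space step_space"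
    unfolding path_space_def by (rule measurable_component_singleton) simp
  have "Measurable.pred path_space (\<lambda>p. fst (p n) > a)" by measurable
  from predE[OF this] show "{p. fst (p n) > a} \<in> sets path_space" by simp
  have A: "{x. fst x > a} \<in> sets step_space"
  proof -
    have "Measurable.pred step_space (\<lambda>x. fst x > a)" by measurable
    from predE[OF this] show ?thesis by simp
  qed
  have d: "distr path_space step_space (\<lambda>p. p n) = step_space"
    unfolding path_space_def using path.PiM_component[of n] by simp
  have "measure path_space {p. fst (p n) > a} = measure (distr path_space step_space (\<lambda>p. p n)) {x. fst x > a}"
    by (subst measure_distr[OF c A]) (simp add: vimage_def)
  also have "\<dots> = measure step_space ({a<..} \<times> UNIV)"
    unfolding d by (intro arg_cong[of _ _ "measure step_space"]) auto
  also have "\<dots> = measure expo {a<..}"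
  proof -
    have "emeasure step_space ({a<..} \<times> UNIV) = emeasure expo {a<..} * emeasure unif UNIV"
      unfolding step_space_def by (rule unif.emeasure_pair_measure_Times) auto
    then show ?thesis by (simp add: measure_def unif.emeasure_space_1[simplified])
  qed
  finally show "measure path_space {p. fst (p n) > a} = exp (- a)"
    by (simp only: measure_expo_greaterThan[OF assms])
qed

text \<open>From one particle of colour 1 these are the holding times. The n-th one exceeds
  \<open>1 / (k + 1)\<close> with probability \<open>exp (- (n + 1) / (k + 1))\<close>, which is
  summable in n, so Borel-Cantelli applies for each k.\<close>

lemma AE_small_gaps: "AE p in path_space. (\<lambda>n. fst (p n) / real (Suc n)) \<longlonglongrightarrow> 0"
proof -
  have "AE p in path_space. \<forall>\<^sub>F n in sequentially. p \<in> space path_space - {p. fst (p n) > real (Suc n)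
      * inverse (real (Suc k))}" for k
  proof (rule borel_cantelli_AE1)
    have "summable (\<lambda>n. exp (- inverse (real (Suc k))) * exp (- inverse (real (Suc k))) ^ n)"
      by (intro summable_mult summable_geometric) simp
    moreover have "exp (- inverse (real (Suc k))) * exp (- inverse (real (Suc k))) ^ n
        = exp (- (real (Suc n) * inverse (real (Suc k))))" for n
      using exp_of_nat_mult[of "Suc n" "- inverse (real (Suc k))"] by (simp del: of_nat_Suc)
    ultimately have "summable (\<lambda>n. exp (- (real (Suc n) * inverse (real (Suc k)))))"
      by (simp only:)
    then show "summable (\<lambda>n. measure path_space {p. fst (p n) > real (Suc n) * inverse (real (Suc k))})"
      by (simp add: measure_path_component(1) del: of_nat_Suc)
  qed (auto intro!: measure_path_component(2) simp: path_space.emeasure_eq_measure)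
  then have "AE p in path_space. \<forall>k. \<forall>\<^sub>F n in sequentially. p \<in> space path_space - {p. fst (p n) > real (Suc n) * inverse (real (Suc k))}"
    by (intro AE_all_countable[THEN iffD2] allI)
  then show ?thesis using AE_good_path
  proof eventually_elim
    case (elim p)
    show ?case
    proof (rule tendstoI)
      fix e :: real assume "e > 0"
      then obtain k where k: "inverse (real (Suc k)) < e" using reals_Archimedean by blast
      show "\<forall>\<^sub>F n in sequentially. dist (fst (p n) / real (Suc n)) 0 < e"
        using elim(1)[rule_format, of k]
      proof eventually_elim
        case (elim n)
        then have "fst (p n) \<le> real (Suc n) * inverse (real (Suc k))" by (simp del: of_nat_Suc)
        then have "fst (p n) / real (Suc n) \<le> inverse (real (Suc k))"
          by (simp add: divide_le_eq mult.commute del: of_nat_Suc)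
        moreover have "fst (p n) / real (Suc n) \<ge> 0" using \<open>\<forall>i. 0 < fst (p i) \<and> _ i\<close>
          by (simp add: less_imp_le del: of_nat_Suc)
        ultimately show ?case using k by (simp add: dist_real_def del: of_nat_Suc)
      qed
    qed
  qed
qed

text \<open>Between jumps the state is constant, so the value at \<open>t\<close> differs from that
  at the last jump only by the discount over the time elapsed since. That time is at most the
  current holding time, which tends to 0.\<close>

lemma AE_scaled_tendsto:
  "AE p in path_space. (scaled m l p \<longlongrightarrow> W (unit_state 1) p) at_top"
proof -
  have v: "valid m (unit_state 1)" and r1: "rate m (unit_state 1) = 1"
    using valid_unit[of 1 m] rate_unit[of 1 m] m3 by auto
  show ?thesis
    using AE_good_path AE_time_unbounded[OF v] AE_small_gaps AE_Wn_tendsto_W[OF v]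
  proof eventually_elim
    case (elim p)
    let ?T = "\<lambda>n. time_at m n (unit_state 1) p" and ?N = "clock (\<lambda>n. time_at m n (unit_state 1) p)"
    have gap: "?T (Suc n) = ?T n + fst (p n) / real (Suc n)" for n
      using state_at_valid[OF m3 v, of p n] elim(1) r1 by (simp add: time_at_Suc)
    have pos: "fst (p n) / real (Suc n) > 0" for n using elim(1) by (simp del: of_nat_Suc)
    have mono: "mono ?T" using gap pos by (intro incseq_SucI) (simp add: less_imp_le del: of_nat_Suc)
    have N: "t < ?T (Suc (?N t))" for t
    proof -
      obtain n where "?T n > t" using elim(2) by blast
      then have "t < ?T (Suc n)" using monoD[OF mono, of n "Suc n"] by simp
      then show ?thesis unfolding clock_def by (rule LeastI)
    qed
    have N': "?T (?N t) \<le> t" if "t \<ge> 0" for t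
    proof (cases "?N t")
      case 0
      then show ?thesis using that by (simp add: time_at_def)
    next
      case (Suc j)
      then have "\<not> t < ?T (Suc j)" using not_less_Least[of j "\<lambda>n. t < ?T (Suc n)"] by (simp add: clock_def)
      then show ?thesis using Suc by simp
    qed
    have N_top: "filterlim ?N sequentially at_top"
      unfolding filterlim_at_top
    proof
      fix K
      show "\<forall>\<^sub>F t in at_top. K \<le> ?N t"
        using eventually_ge_at_top[of "?T K"]
      proof eventually_elim
        case (elim t)
        show ?case
        proof (rule ccontr)
          assume "\<not> K \<le> ?N t"
          then have "?T (Suc (?N t)) \<le> ?T K" by (intro monoD[OF mono]) simp
          with N[of t] elim show False by simp
        qed
      qed
    qed
    have "((\<lambda>t. t - ?T (?N t)) \<longlongrightarrow> 0) at_top"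
    proof (rule tendsto_sandwich)
      show "\<forall>\<^sub>F t in at_top. 0 \<le> t - ?T (?N t)" using eventually_ge_at_top[of 0]
        by eventually_elim (use N' in fastforce)
      show "\<forall>\<^sub>F t in at_top. t - ?T (?N t) \<le> fst (p (?N t)) / real (Suc (?N t))"
      proof (intro always_eventually allI)
        fix t show "t - ?T (?N t) \<le> fst (p (?N t)) / real (Suc (?N t))" using N[of t] gap[of "?N t"] by linarith
      qed
      show "((\<lambda>t. fst (p (?N t)) / real (Suc (?N t))) \<longlongrightarrow> 0) at_top" by (rule filterlim_compose[OF elim(3) N_top])
    qed simp
    then have "((\<lambda>t. exp (- (l * of_real (t - ?T (?N t))))) \<longlongrightarrow> exp (- (l * of_real 0))) at_top"
      by (intro tendsto_intros)
    moreover have "((\<lambda>t. Wn (?N t) (unit_state 1) p) \<longlongrightarrow> W (unit_state 1) p) at_top"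
      by (rule filterlim_compose[OF elim(4) N_top])
    ultimately have "((\<lambda>t. exp (- (l * of_real (t - ?T (?N t)))) * Wn (?N t) (unit_state 1) p) \<longlongrightarrow> exp (- (l
        * of_real 0)) * W (unit_state 1) p) at_top"
      by (rule tendsto_mult)
    moreover have "scaled m l p t = exp (- (l * of_real (t - ?T (?N t)))) * Wn (?N t) (unit_state 1) p" for t
    proof -
      have "exp (- (l * of_real (t - ?T (?N t)))) * exp (- (l * of_real (?T (?N t)))) = exp (- l * of_real t)"
        unfolding exp_add[symmetric] by (simp add: algebra_simps)
      then show ?thesis unfolding Wn_eq scaled_def e1_eq by (simp only: mult.assoc[symmetric])
    qed
    ultimately have "((\<lambda>t. scaled m l p t) \<longlongrightarrow> exp (- (l * of_real 0)) * W (unit_state 1) p) at_top"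
      by (simp only:)
    then show ?case by (simp only: of_real_0 mult_zero_right minus_zero exp_zero mult_1)
  qed
qed

lemma AE_path_W1: "AE p in path_space. path_W1 m l p = W (unit_state 1) p"
  using AE_scaled_tendsto
proof eventually_elim
  case (elim p)
  then have "\<exists>L. (scaled m l p \<longlongrightarrow> L) at_top" by blast
  then show ?case unfolding path_W1_eq using tendsto_Lim[OF trivial_limit_at_top_linorder elim] by simp
qed

end

text \<open>Independence is given for one family indexed by \<open>nat + nat\<close>; grouping
  \<open>Inl n\<close> with \<open>Inr n\<close> yields independent pairs, each with law
  \<open>step_space\<close>.\<close>

lemma (in prob_space) distr_path_space:
  assumes ind: "indep_vars (\<lambda>_. borel) (\<lambda>i::nat + nat. case i of Inl n \<Rightarrow> E n | Inr n \<Rightarrow> U n) UNIV"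
    and E: "\<And>n. distributed M lborel (E n) (\<lambda>x. ennreal (exponential_density 1 x))"
    and U: "\<And>n. distributed M lborel (U n) (\<lambda>x. indicator {0..1} x)"
  shows "(\<lambda>\<omega> n. (E n \<omega>, U n \<omega>)) \<in> measurable M path_space"
    "distr M path_space (\<lambda>\<omega> n. (E n \<omega>, U n \<omega>)) = path_space"
proof -
  let ?X = "\<lambda>i::nat + nat. case i of Inl n \<Rightarrow> E n | Inr n \<Rightarrow> U n"
  have mE[measurable]: "E n \<in> borel_measurable M" for n using E[of n] by (simp add: distributed_def)
  have mU[measurable]: "U n \<in> borel_measurable M" for n using U[of n] by (simp add: distributed_def)
  have dE: "distr M borel (E n) = expo" for n
    using E[of n] unfolding distributed_def expo_def by (metis distr_cong sets_lborel)
  have dU: "distr M borel (U n) = unif" for n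
    using U[of n] unfolding distributed_def unif_def by (metis distr_cong sets_lborel)
  have iv: "indep_var borel (E n) borel (U n)" for n
    using indep_var_compose[OF indep_var_restrict[OF ind, of "{Inl n}" "{Inr n}"], of "\<lambda>f. f (Inl n)" borel "\<lambda>f. f (Inr n)" borel]
    by (simp add: comp_def)
  have pair: "distr M (borel \<Otimes>\<^sub>M borel) (\<lambda>\<omega>. (E n \<omega>, U n \<omega>)) = step_space" for n
    using indep_var_distribution_eq[THEN iffD1, OF iv[of n]] unfolding dE dU step_space_def by simp
  have "indep_vars (\<lambda>j. PiM {Inl j, Inr j} (\<lambda>_. borel)) (\<lambda>j \<omega>. restrict (\<lambda>i. ?X i \<omega>) {Inl j, Inr j}) (UNIV :: nat set)"
    by (rule indep_vars_restrict[OF ind]) (auto simp: disjoint_family_on_def)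
  from indep_vars_compose2[OF this, of "\<lambda>j f. (f (Inl j), f (Inr j))" "\<lambda>_. borel \<Otimes>\<^sub>M borel"]
  have ind2: "indep_vars (\<lambda>_. borel \<Otimes>\<^sub>M borel) (\<lambda>j \<omega>. (E j \<omega>, U j \<omega>)) (UNIV :: nat set)"
    by simp
  have "distr M (PiM UNIV (\<lambda>_. borel \<Otimes>\<^sub>M borel)) (\<lambda>\<omega>. \<lambda>i\<in>UNIV. (E i \<omega>, U i \<omega>)) = PiM UNIV (\<lambda>i::nat. step_space)"
    using ind2 by (subst (asm) indep_vars_iff_distr_eq_PiM) (simp_all add: pair)
  moreover have "distr M path_space (\<lambda>\<omega> n. (E n \<omega>, U n \<omega>)) =
    distr M (PiM UNIV (\<lambda>_. borel \<Otimes>\<^sub>M borel)) (\<lambda>\<omega> n. (E n \<omega>, U n \<omega>))"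
    by (rule distr_cong[OF refl sets_path_space refl])
  ultimately show "distr M path_space (\<lambda>\<omega> n. (E n \<omega>, U n \<omega>)) = path_space"
    unfolding restrict_UNIV path_space_def by (simp only:)
  show "(\<lambda>\<omega> n. (E n \<omega>, U n \<omega>)) \<in> measurable M path_space"
    unfolding measurable_cong_sets[OF refl sets_path_space]
    by (rule measurable_PiM_single') (simp_all add: space_pair_measure)
qed

theorem theorem1p1:
  fixes m :: nat and lam2 :: complex and M :: "'a measure"
    and E U :: "nat \<Rightarrow> 'a \<Rightarrow> real"
  assumes "m \<ge> 27"
    and "is_lambda2 m lam2"
    and "prob_space M"
    and "prob_space.indep_vars M (\<lambda>_. borel) (\<lambda>i::nat + nat. case i of Inl n \<Rightarrow> E n | Inr n \<Rightarrow> U n) UNIV"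
    and "\<And>n. distributed M lborel (E n) (\<lambda>x. ennreal (exponential_density 1 x))"
    and "\<And>n. distributed M lborel (U n) (\<lambda>x. indicator {0..1} x)"
  defines "W \<equiv> (\<lambda>\<omega>. W1 m lam2 (\<lambda>n. E n \<omega>) (\<lambda>n. U n \<omega>))"
  shows "(\<exists>f. f \<in> borel_measurable lborel \<and> distr M lborel W = density lborel f)
       \<and> (\<forall>z r. r > 0 \<longrightarrow> measure M {\<omega> \<in> space M. W \<omega> \<in> ball z r} > 0)
       \<and> (\<exists>a>1. (\<lambda>t. cmod (LINT \<omega>|M. cis (Re (cnj t * W \<omega>))))
                  \<in> O[at_infinity](\<lambda>t. cmod t powr (- a)))"
proof -
  interpret M: prob_space M by (rule assms(3))
  interpret S: search_urn m lam2
  proof (rule search_urn.intro)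
    show "m \<ge> 3" using assms(1) by linarith
  qed (rule is_lambda2_bounds[OF assms(1,2)])+
  define Z where "Z = (\<lambda>\<omega> n. (E n \<omega>, U n \<omega>))"
  have Z[measurable]: "Z \<in> measurable M path_space" and dZ: "distr M path_space Z = path_space"
    unfolding Z_def by (rule M.distr_path_space[OF assms(4-6)])+
  have W: "W = (\<lambda>\<omega>. path_W1 m lam2 (Z \<omega>))" by (simp add: W_def path_W1_def Z_def)
  have W_meas[measurable]: "W \<in> borel_measurable M" unfolding W by measurable
  let ?V = "S.W (unit_state 1)"
  have law: "emeasure M {\<omega> \<in> space M. W \<omega> \<in> A} = emeasure path_space {p. ?V p \<in> A}"
    if A[measurable]: "A \<in> sets borel" for A
  proof -
    have "emeasure path_space {p. ?V p \<in> A} = emeasure path_space {p. path_W1 m lam2 p \<in> A}"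
      using S.AE_path_W1 sets_path_Collect[OF S.measurable_W A] sets_path_Collect[OF measurable_path_W1 A]
      by (intro emeasure_eq_AE) (auto elim!: eventually_mono)
    also have "\<dots> = emeasure (distr M path_space Z) {p. path_W1 m lam2 p \<in> A}" by (simp only: dZ)
    also have "\<dots> = emeasure M {\<omega> \<in> space M. W \<omega> \<in> A}"
      by (subst emeasure_distr[OF Z sets_path_Collect[OF measurable_path_W1 A]])
        (auto simp: W intro!: arg_cong[of _ _ "emeasure M"])
    finally show ?thesis ..
  qed
  have char: "(LINT \<omega>|M. cis (Re (cnj t * W \<omega>))) = S.phi (unit_state 1) t" for t
  proof -
    have "(LINT \<omega>|M. cis (Re (cnj t * W \<omega>))) = (\<integral>p. cis (Re (cnj t * path_W1 m lam2 p)) \<partial>distr M path_space Z)"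
      unfolding W by (subst integral_distr[OF Z]) simp_all
    also have "\<dots> = S.phi (unit_state 1) t"
      unfolding dZ S.phi_def using S.AE_path_W1 by (intro integral_cong_AE) (auto elim!: eventually_mono)
    finally show ?thesis .
  qed
  have 1: "\<exists>f. f \<in> borel_measurable lborel \<and> distr M lborel W = density lborel f"
  proof -
    have "absolutely_continuous lborel (distr M lborel W)"
      unfolding absolutely_continuous_def
    proof
      fix N :: "complex set" assume N: "N \<in> null_sets lborel"
      then have Nb: "N \<in> sets borel" "negligible N"
        by (auto simp: negligible_iff_null_sets intro: null_sets_completionI)
      have "emeasure path_space {p. ?V p \<in> N} = 0"
        using S.null_law_unit_1 assms(1) Nb unfolding S.null_law_def by auto
      with law[OF Nb(1)] have "emeasure M {\<omega> \<in> space M. W \<omega> \<in> N} = 0" by simp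
      moreover have "emeasure (distr M lborel W) N = emeasure M {\<omega> \<in> space M. W \<omega> \<in> N}"
        using Nb by (subst emeasure_distr) (auto intro!: arg_cong[of _ _ "emeasure M"])
      ultimately show "N \<in> null_sets (distr M lborel W)" using Nb by (intro null_setsI) auto
    qed
    then show ?thesis
      using sigma_finite_measure.density_RN_deriv[OF sigma_finite_lborel, of "distr M lborel W"]
        by (intro exI[of _ "RN_deriv lborel (distr M lborel W)"]) auto
  qed
  have 2: "measure M {\<omega> \<in> space M. W \<omega> \<in> ball z r} > 0" if "r > 0" for z r
  proof -
    have "z \<in> S.supp (unit_state 1)" using S.supp_unit_1 by blast
    with that have "measure path_space {p. ?V p \<in> ball z r} > 0" by (simp only: S.supp_def mem_Collect_eq)
    then show ?thesis using law[of "ball z r"] by (simp add: measure_def)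
  qed
  have 3: "\<exists>a>1. (\<lambda>t. cmod (LINT \<omega>|M. cis (Re (cnj t * W \<omega>)))) \<in> O[at_infinity](\<lambda>t. cmod t powr (- a))"
  proof -
    \<comment> \<open>The midpoint of 1 and \<open>1 / Re lam2\<close>, strictly between them
      because \<open>Re lam2 < 1\<close>.\<close>
    define a where "a = (1 + 1 / Re lam2) / 2"
    have a: "a > 1" "a * Re lam2 < 1" using S.Re_half S.Re_lt_1 by (auto simp: a_def field_simps)
    obtain C where C: "C \<ge> 0" "\<And>z. cmod (S.phi (unit_state 1) z) * cmod z powr a \<le> C"
      using S.phi_unit_1_decay[of a] a by auto
    have "(\<lambda>t. cmod (S.phi (unit_state 1) t)) \<in> O[at_infinity](\<lambda>t. cmod t powr (- a))"
    proof (rule bigoI[of _ C])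
      show "\<forall>\<^sub>F t in at_infinity. norm (cmod (S.phi (unit_state 1) t)) \<le> C * norm (cmod t powr (- a))"
        unfolding eventually_at_infinity
      proof (intro exI[of _ 1] allI impI)
        fix t :: complex assume "1 \<le> cmod t"
        then have "cmod t powr a > 0" by auto
        then show "norm (cmod (S.phi (unit_state 1) t)) \<le> C * norm (cmod t powr (- a))"
          using C(2)[of t] by (simp add: powr_minus field_simps)
      qed
    qed
    with a(1) show ?thesis unfolding char by (intro exI[of _ a] conjI)
  qed
  show ?thesis by (intro conjI allI impI 1 2 3)
qed

end
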